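(* Let $(\mathcal{V},\mathcal{H})$ be a complete interaction of $\Gamma^+$ on a unital C$^*$-algebra $\mathcal{A}$ such that at least one of the following holds: (a) each $\mathcal{V}_x$, $x\in\Gamma^+$, is a $*$-endomorphism (i.e. $(\mathcal{A},\Gamma^+,\mathcal{V})$ is a C$^*$-dynamical system); (b) $\mathcal{H}_x(1)\in Z(\mathcal{A})$ for all $x\in\Gamma^+$; (a') each $\mathcal{H}_x$ is a $*$-endomorphism; (b') $\mathcal{V}_x(1)\in Z(\mathcal{A})$ for all $x\in\Gamma^+$. Then both $\mathcal{V}$ and $\mathcal{H}$ are finely representable actions.
   Context: $Z(\mathcal{A})$ denotes the center of $\mathcal{A}$. $\Gamma$ is a totally ordered abelian group with identity $0$ and $\Gamma^+=\{x\in\Gamma:0\le x\}$. An action of $\Gamma^+$ on $\mathcal{A}$ is a map $x\mapsto\mathcal{V}_x$ from $\Gamma^+$ into the bounded positive linear maps $\mathcal{A}\to\mathcal{A}$ with $\mathcal{V}_0=\mathrm{Id}$ and $\mathcal{V}_x\circ\mathcal{V}_y=\mathcal{V}_{x+y}$. An interaction is a pair $(\mathcal{V},\mathcal{H})$ of actions such that for every $x\in\Gamma^+$: (i) $\mathcal{V}_x\mathcal{H}_x\mathcal{V}_x=\mathcal{V}_x$; (ii) $\mathcal{H}_x\mathcal{V}_x\mathcal{H}_x=\mathcal{H}_x$; (iii) $\mathcal{V}_x(ab)=\mathcal{V}_x(a)\mathcal{V}_x(b)$ whenever $a$ or $b$ belongs to $\mathcal{H}_x(\mathcal{A})$; (iv)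 $\mathcal{H}_x(ab)=\mathcal{H}_x(a)\mathcal{H}_x(b)$ whenever $a$ or $b$ belongs to $\mathcal{V}_x(\mathcal{A})$. It is complete if moreover $\mathcal{H}_x(\mathcal{V}_x(a))=\mathcal{H}_x(1)a\mathcal{H}_x(1)$ and $\mathcal{V}_x(\mathcal{H}_x(a))=\mathcal{V}_x(1)a\mathcal{V}_x(1)$ for all $x,a$, and $\mathcal{H}_y(1)\mathcal{V}_x(1)=\mathcal{V}_x(1)\mathcal{H}_y(1)$ for all $x,y\in\Gamma^+$. A covariant representation of an action $\mathcal{V}$ is a triple $(C,\sigma,U)$ with $C$ a unital C$^*$-algebra, $\sigma:\mathcal{A}\to C$ a unital injective $*$-homomorphism, and $U:\Gamma^+\to C$ a semigroup homomorphism with each $U_x$ a partial isometry, such that $\sigma(\mathcal{V}_x(a))=U_x\sigma(a)U_x^*$ and $U_x^*\sigma(a)U_x\in\sigma(\mathcal{A})$ for all $a\in\mathcal{A}$, $x\in\Gamma^+$; $\mathcal{V}$ is finely representable if it admits a covariant representation. *)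

theory Defs
  imports Complex_Main
begin

record 'a calg =
  car :: "'a set"
  zer :: 'a
  un  :: 'a
  pl  :: "'a \<Rightarrow> 'a \<Rightarrow> 'a"
  mul :: "'a \<Rightarrow> 'a \<Rightarrow> 'a"
  sm  :: "complex \<Rightarrow> 'a \<Rightarrow> 'a"
  st  :: "'a \<Rightarrow> 'a"
  nm  :: "'a \<Rightarrow> real"

definition minus :: "'a calg \<Rightarrow> 'a \<Rightarrow> 'a \<Rightarrow> 'a" where
  "minus A a b = pl A a (sm A (-1) b)"

definition unital_cstar_algebra :: "'a calg \<Rightarrow> bool" where
  "unital_cstar_algebra A \<longleftrightarrow>
     \<comment> \<open>closure\<close>
     zer A \<in> car A \<and> un A \<in> car A \<and>
     (\<forall>a\<in>car A. \<forall>b\<in>car A. pl A a b \<in> car A \<and> mul A a b \<in> car A) \<and>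
     (\<forall>a\<in>car A. st A a \<in> car A \<and> (\<forall>c. sm A c a \<in> car A)) \<and>
     \<comment> \<open>complex vector space\<close>
     (\<forall>a\<in>car A. \<forall>b\<in>car A. \<forall>d\<in>car A. pl A (pl A a b) d = pl A a (pl A b d)) \<and>
     (\<forall>a\<in>car A. \<forall>b\<in>car A. pl A a b = pl A b a) \<and>
     (\<forall>a\<in>car A. pl A a (zer A) = a) \<and>
     (\<forall>a\<in>car A. \<exists>b\<in>car A. pl A a b = zer A) \<and>
     (\<forall>a\<in>car A. \<forall>b\<in>car A. \<forall>c. sm A c (pl A a b) = pl A (sm A c a) (sm A c b)) \<and>
     (\<forall>a\<in>car A. \<forall>c d. sm A (c + d) a = pl A (sm A c a) (sm A d a)) \<and>
     (\<forall>a\<in>car A. \<forall>c d. sm A (c * d) a = sm A c (sm A d a)) \<and>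
     (\<forall>a\<in>car A. sm A 1 a = a) \<and>
     \<comment> \<open>associative unital algebra\<close>
     (\<forall>a\<in>car A. \<forall>b\<in>car A. \<forall>d\<in>car A. mul A (mul A a b) d = mul A a (mul A b d)) \<and>
     (\<forall>a\<in>car A. \<forall>b\<in>car A. \<forall>d\<in>car A.
        mul A a (pl A b d) = pl A (mul A a b) (mul A a d) \<and>
        mul A (pl A a b) d = pl A (mul A a d) (mul A b d)) \<and>
     (\<forall>a\<in>car A. \<forall>b\<in>car A. \<forall>c.
        sm A c (mul A a b) = mul A (sm A c a) b \<and> sm A c (mul A a b) = mul A a (sm A c b)) \<and>
     (\<forall>a\<in>car A. mul A (un A) a = a \<and> mul A a (un A) = a) \<and>
     \<comment> \<open>involution\<close>
     (\<forall>a\<in>car A. st A (st A a) = a) \<and>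
     (\<forall>a\<in>car A. \<forall>b\<in>car A. st A (pl A a b) = pl A (st A a) (st A b)) \<and>
     (\<forall>a\<in>car A. \<forall>b\<in>car A. st A (mul A a b) = mul A (st A b) (st A a)) \<and>
     (\<forall>a\<in>car A. \<forall>c. st A (sm A c a) = sm A (cnj c) (st A a)) \<and>
     \<comment> \<open>norm\<close>
     (\<forall>a\<in>car A. 0 \<le> nm A a \<and> (nm A a = 0 \<longleftrightarrow> a = zer A)) \<and>
     (\<forall>a\<in>car A. \<forall>b\<in>car A. nm A (pl A a b) \<le> nm A a + nm A b) \<and>
     (\<forall>a\<in>car A. \<forall>c. nm A (sm A c a) = cmod c * nm A a) \<and>
     (\<forall>a\<in>car A. \<forall>b\<in>car A. nm A (mul A a b) \<le> nm A a * nm A b) \<and>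
     (\<forall>a\<in>car A. nm A (mul A (st A a) a) = (nm A a)\<^sup>2) \<and>
     \<comment> \<open>completeness\<close>
     (\<forall>f :: nat \<Rightarrow> 'a. (\<forall>n. f n \<in> car A) \<longrightarrow>
          (\<forall>e::real>0. \<exists>N. \<forall>m\<ge>N. \<forall>n\<ge>N. nm A (minus A (f m) (f n)) < e) \<longrightarrow>
          (\<exists>l\<in>car A. \<forall>e::real>0. \<exists>N. \<forall>n\<ge>N. nm A (minus A (f n) l) < e))"

definition center :: "'a calg \<Rightarrow> 'a set" where
  "center A = {z \<in> car A. \<forall>a\<in>car A. mul A z a = mul A a z}"

definition positive :: "'a calg \<Rightarrow> 'a \<Rightarrow> bool" where
  "positive A a \<longleftrightarrow> a \<in> car A \<and> (\<exists>b\<in>car A. a = mul A (st A b) b)"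

definition linear_map :: "'a calg \<Rightarrow> 'b calg \<Rightarrow> ('a \<Rightarrow> 'b) \<Rightarrow> bool" where
  "linear_map A B T \<longleftrightarrow>
     (\<forall>a\<in>car A. T a \<in> car B) \<and>
     (\<forall>a\<in>car A. \<forall>b\<in>car A. T (pl A a b) = pl B (T a) (T b)) \<and>
     (\<forall>a\<in>car A. \<forall>c. T (sm A c a) = sm B c (T a))"

definition bounded_positive_map :: "'a calg \<Rightarrow> ('a \<Rightarrow> 'a) \<Rightarrow> bool" where
  "bounded_positive_map A T \<longleftrightarrow>
     linear_map A A T \<and> (\<exists>K. \<forall>a\<in>car A. nm A (T a) \<le> K * nm A a) \<and>
     (\<forall>a. positive A a \<longrightarrow> positive A (T a))"

definition star_hom :: "'a calg \<Rightarrow> 'b calg \<Rightarrow> ('a \<Rightarrow> 'b) \<Rightarrow> bool" where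
  "star_hom A B f \<longleftrightarrow> linear_map A B f \<and>
     (\<forall>a\<in>car A. \<forall>b\<in>car A. f (mul A a b) = mul B (f a) (f b)) \<and>
     (\<forall>a\<in>car A. f (st A a) = st B (f a))"

definition star_endo :: "'a calg \<Rightarrow> ('a \<Rightarrow> 'a) \<Rightarrow> bool" where
  "star_endo A f \<longleftrightarrow> star_hom A A f"

definition is_action :: "'a calg \<Rightarrow> ('g::linordered_ab_group_add \<Rightarrow> 'a \<Rightarrow> 'a) \<Rightarrow> bool" where
  "is_action A V \<longleftrightarrow>
     (\<forall>x\<ge>0. bounded_positive_map A (V x)) \<and>
     (\<forall>a\<in>car A. V 0 a = a) \<and>
     (\<forall>x y a. 0 \<le> x \<longrightarrow> 0 \<le> y \<longrightarrow> a \<in> car A \<longrightarrow> V x (V y a) = V (x + y) a)"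

definition interaction :: "'a calg \<Rightarrow> ('g::linordered_ab_group_add \<Rightarrow> 'a \<Rightarrow> 'a) \<Rightarrow> ('g \<Rightarrow> 'a \<Rightarrow> 'a) \<Rightarrow> bool" where
  "interaction A V H \<longleftrightarrow> is_action A V \<and> is_action A H \<and>
     (\<forall>x\<ge>0.
        (\<forall>a\<in>car A. V x (H x (V x a)) = V x a) \<and>
        (\<forall>a\<in>car A. H x (V x (H x a)) = H x a) \<and>
        (\<forall>a\<in>car A. \<forall>b\<in>car A. (a \<in> H x ` car A \<or> b \<in> H x ` car A) \<longrightarrow>
            V x (mul A a b) = mul A (V x a) (V x b)) \<and>
        (\<forall>a\<in>car A. \<forall>b\<in>car A. (a \<in> V x ` car A \<or> b \<in> V x ` car A) \<longrightarrow>
            H x (mul A a b) = mul A (H x a) (H x b)))"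

definition complete_interaction :: "'a calg \<Rightarrow> ('g::linordered_ab_group_add \<Rightarrow> 'a \<Rightarrow> 'a) \<Rightarrow> ('g \<Rightarrow> 'a \<Rightarrow> 'a) \<Rightarrow> bool" where
  "complete_interaction A V H \<longleftrightarrow> interaction A V H \<and>
     (\<forall>x\<ge>0. \<forall>a\<in>car A.
        H x (V x a) = mul A (mul A (H x (un A)) a) (H x (un A)) \<and>
        V x (H x a) = mul A (mul A (V x (un A)) a) (V x (un A))) \<and>
     (\<forall>x\<ge>0. \<forall>y\<ge>0. mul A (H y (un A)) (V x (un A)) = mul A (V x (un A)) (H y (un A)))"

definition partial_isometry :: "'c calg \<Rightarrow> 'c \<Rightarrow> bool" where
  "partial_isometry C u \<longleftrightarrow> u \<in> car C \<and> mul C (mul C u (st C u)) u = u"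

definition covariant_rep ::
  "'a calg \<Rightarrow> ('g::linordered_ab_group_add \<Rightarrow> 'a \<Rightarrow> 'a) \<Rightarrow> 'c calg \<Rightarrow> ('a \<Rightarrow> 'c) \<Rightarrow> ('g \<Rightarrow> 'c) \<Rightarrow> bool" where
  "covariant_rep A V C \<sigma> U \<longleftrightarrow>
     unital_cstar_algebra C \<and>
     star_hom A C \<sigma> \<and> \<sigma> (un A) = un C \<and> inj_on \<sigma> (car A) \<and>
     (\<forall>x\<ge>0. partial_isometry C (U x)) \<and>
     (\<forall>x\<ge>0. \<forall>y\<ge>0. U (x + y) = mul C (U x) (U y)) \<and>
     (\<forall>x\<ge>0. \<forall>a\<in>car A.
        \<sigma> (V x a) = mul C (mul C (U x) (\<sigma> a)) (st C (U x)) \<and>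
        mul C (mul C (st C (U x)) (\<sigma> a)) (U x) \<in> \<sigma> ` car A)"

definition finely_representable :: "'a calg \<Rightarrow> ('g::linordered_ab_group_add \<Rightarrow> 'a \<Rightarrow> 'a) \<Rightarrow> bool" where
  "finely_representable A V \<longleftrightarrow>
     (\<exists>(C :: (nat \<Rightarrow> ('a \<times> 'g \<times> nat) list) calg) \<sigma> U. covariant_rep A V C \<sigma> U)"

end

theory Submission
  imports Defs "HOL-Algebra.FiniteProduct"
begin

text \<open>
  Write \<open>p x = H x 1\<close> and \<open>q x = V x 1\<close>. Completeness makes \<open>V x\<close> an isomorphism from the corner
  of \<open>p x\<close> onto the corner of \<open>q x\<close> with inverse \<open>H x\<close>, and \<open>V x\<close> is multiplicative exactly when
  \<open>p x\<close> is central. Passing to adjoints exchanges \<open>V\<close> and \<open>H\<close>, so one may assume this, and then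
  \<open>H x (V x a b) = a (H x b)\<close>.

  The representation acts on the right Hilbert module of finitely supported families
  \<open>f(g) \<in> q(g\<^sup>-) A q(g\<^sup>+)\<close>, indexed by the whole group, with
  \<open>\<langle>f, h\<rangle> = \<Sum>g. H(g\<^sup>+) (f(g)\<^sup>\<star> h(g))\<close>: this is the regular representation of the algebra spanned
  by the elements \<open>U(g\<^sup>-)\<^sup>\<star> a U(g\<^sup>+)\<close>. All covariance relations hold exactly there, and the degree
  zero component makes it faithful on \<open>A\<close>. The required C*-algebra is the completion of the
  algebra generated by \<open>A\<close> and the \<open>U x\<close>, whose elements are named by sequences of words.

  The Cauchy-Schwarz inequality for the module needs only that the elements \<open>b\<^sup>\<star> b\<close> lie in a
  proper cone on which the norm is monotone; this is obtained from square roots alone, without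
  spectral theory.
\<close>

section \<open>Star-algebras and C*-seminorms on carrier sets\<close>

text \<open>Centrality of \<open>p x\<close> is what makes a normal form possible. If
  \<open>U\<close> implements \<open>V\<close>, then \<open>p x\<close> becomes
  \<open>U(x)\<^sup>\<star> U(x)\<close>, and once it commutes with \<open>A\<close> one has
  \<open>U(x) a = V x a U(x)\<close> and
  \<open>a U(x)\<^sup>\<star> = U(x)\<^sup>\<star> V x a\<close>. Products of elements of
  \<open>A\<close>, of the \<open>U(x)\<close> and of their adjoints can then be pushed into the
  shape used for the module; the total order decides which of two adjacent powers is cancelled by
  the other.

  The type of \<open>C\<close> shapes the end of the proof. \<open>finely_representable\<close> asks
  for an algebra on \<open>nat \<Rightarrow> ('a \<times> 'g \<times> nat) list\<close>, and the
  algebra of all operators on the module need not fit there. The generated star-algebra does: one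
  list of tagged letters names a finite sum of products, and a sequence of lists names a Cauchy
  sequence. Since a completion is taken only at this last stage, the module stays uncompleted and
  the intermediate algebras carry mere seminorms until the final quotient.\<close>

locale star_alg =
  fixes A :: "'a calg"
  assumes zer_closed [simp]: "zer A \<in> car A"
    and un_closed [simp]: "un A \<in> car A"
    and pl_closed [simp]: "\<lbrakk>a \<in> car A; b \<in> car A\<rbrakk> \<Longrightarrow> pl A a b \<in> car A"
    and mul_closed [simp]: "\<lbrakk>a \<in> car A; b \<in> car A\<rbrakk> \<Longrightarrow> mul A a b \<in> car A"
    and st_closed [simp]: "a \<in> car A \<Longrightarrow> st A a \<in> car A"
    and sm_closed [simp]: "a \<in> car A \<Longrightarrow> sm A c a \<in> car A"
    and pl_assoc: "\<lbrakk>a \<in> car A; b \<in> car A; e \<in> car A\<rbrakk> \<Longrightarrow> pl A (pl A a b) e = pl A a (pl A b e)"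
    and pl_comm: "\<lbrakk>a \<in> car A; b \<in> car A\<rbrakk> \<Longrightarrow> pl A a b = pl A b a"
    and pl_zer [simp]: "a \<in> car A \<Longrightarrow> pl A a (zer A) = a"
    and pl_inverse: "a \<in> car A \<Longrightarrow> \<exists>b\<in>car A. pl A a b = zer A"
    and sm_pl: "\<lbrakk>a \<in> car A; b \<in> car A\<rbrakk> \<Longrightarrow> sm A c (pl A a b) = pl A (sm A c a) (sm A c b)"
    and sm_add: "a \<in> car A \<Longrightarrow> sm A (c + d) a = pl A (sm A c a) (sm A d a)"
    and sm_mult: "a \<in> car A \<Longrightarrow> sm A (c * d) a = sm A c (sm A d a)"
    and sm_one [simp]: "a \<in> car A \<Longrightarrow> sm A 1 a = a"
    and mul_assoc: "\<lbrakk>a \<in> car A; b \<in> car A; e \<in> car A\<rbrakk> \<Longrightarrow> mul A (mul A a b) e = mul A a (mul A b e)"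
    and mul_pl: "\<lbrakk>a \<in> car A; b \<in> car A; e \<in> car A\<rbrakk> \<Longrightarrow> mul A a (pl A b e) = pl A (mul A a b) (mul A a e)"
    and pl_mul: "\<lbrakk>a \<in> car A; b \<in> car A; e \<in> car A\<rbrakk> \<Longrightarrow> mul A (pl A a b) e = pl A (mul A a e) (mul A b e)"
    and sm_mul_left: "\<lbrakk>a \<in> car A; b \<in> car A\<rbrakk> \<Longrightarrow> sm A c (mul A a b) = mul A (sm A c a) b"
    and sm_mul_right: "\<lbrakk>a \<in> car A; b \<in> car A\<rbrakk> \<Longrightarrow> sm A c (mul A a b) = mul A a (sm A c b)"
    and un_mul [simp]: "a \<in> car A \<Longrightarrow> mul A (un A) a = a"
    and mul_un [simp]: "a \<in> car A \<Longrightarrow> mul A a (un A) = a"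
    and st_st [simp]: "a \<in> car A \<Longrightarrow> st A (st A a) = a"
    and st_pl: "\<lbrakk>a \<in> car A; b \<in> car A\<rbrakk> \<Longrightarrow> st A (pl A a b) = pl A (st A a) (st A b)"
    and st_mul: "\<lbrakk>a \<in> car A; b \<in> car A\<rbrakk> \<Longrightarrow> st A (mul A a b) = mul A (st A b) (st A a)"
    and st_sm: "a \<in> car A \<Longrightarrow> st A (sm A c a) = sm A (cnj c) (st A a)"
begin

abbreviation zero' ("\<^bold>0") where "\<^bold>0 \<equiv> zer A"
abbreviation one' ("\<^bold>1") where "\<^bold>1 \<equiv> un A"
abbreviation add' (infixl "\<boxplus>" 65) where "a \<boxplus> b \<equiv> pl A a b"
abbreviation mult' (infixl "\<boxdot>" 70) where "a \<boxdot> b \<equiv> mul A a b"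
abbreviation diff' (infixl "\<boxminus>" 65) where "a \<boxminus> b \<equiv> minus A a b"
abbreviation scal' (infixr "\<bullet>" 75) where "c \<bullet> a \<equiv> sm A c a"
abbreviation star' ("_\<^sup>\<star>" [1000] 999) where "a\<^sup>\<star> \<equiv> st A a"
abbreviation norm' ("\<parallel>_\<parallel>") where "\<parallel>a\<parallel> \<equiv> nm A a"

lemma pl_left_comm: "\<lbrakk>a \<in> car A; b \<in> car A; d \<in> car A\<rbrakk> \<Longrightarrow> a \<boxplus> (b \<boxplus> d) = b \<boxplus> (a \<boxplus> d)"
  by (metis pl_assoc pl_comm)

lemmas pl_ac = pl_assoc pl_comm pl_left_comm

lemma zer_pl [simp]: "a \<in> car A \<Longrightarrow> \<^bold>0 \<boxplus> a = a"
  using pl_comm by fastforce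

lemma pl_left_cancel:
  assumes "a \<in> car A" "b \<in> car A" "d \<in> car A" "a \<boxplus> b = a \<boxplus> d"
  shows "b = d"
proof -
  obtain e where e: "e \<in> car A" "a \<boxplus> e = \<^bold>0"
    using pl_inverse assms by blast
  have "e \<boxplus> a = \<^bold>0" using e assms pl_comm by metis
  then have "b = (e \<boxplus> a) \<boxplus> b" "d = (e \<boxplus> a) \<boxplus> d" using assms by simp_all
  then show ?thesis using assms e pl_assoc by metis
qed

lemma sm_zero_left [simp]:
  assumes "a \<in> car A" shows "0 \<bullet> a = \<^bold>0"
proof -
  have "0 \<bullet> a \<boxplus> 0 \<bullet> a = 0 \<bullet> a \<boxplus> \<^bold>0"
    using sm_add[of a 0 0] assms by simp
  then show ?thesis using pl_left_cancel[of "0 \<bullet> a"] assms by simp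
qed

lemma sm_sm [simp]: "a \<in> car A \<Longrightarrow> c \<bullet> d \<bullet> a = (c * d) \<bullet> a"
  by (simp add: sm_mult)

lemma sm_zer [simp]: "c \<bullet> \<^bold>0 = \<^bold>0"
  using sm_sm[of "\<^bold>0" c 0] by simp

lemma mul_zer [simp]:
  assumes "a \<in> car A" shows "a \<boxdot> \<^bold>0 = \<^bold>0"
  using sm_mul_right[of a "\<^bold>0" 0] assms by simp

lemma zer_mul [simp]:
  assumes "a \<in> car A" shows "\<^bold>0 \<boxdot> a = \<^bold>0"
  using sm_mul_left[of "\<^bold>0" a 0] assms by simp

lemma mul_sm_left [simp]: "\<lbrakk>a \<in> car A; b \<in> car A\<rbrakk> \<Longrightarrow> (c \<bullet> a) \<boxdot> b = c \<bullet> (a \<boxdot> b)"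
  by (simp add: sm_mul_left)

lemma mul_sm_right [simp]: "\<lbrakk>a \<in> car A; b \<in> car A\<rbrakk> \<Longrightarrow> a \<boxdot> (c \<bullet> b) = c \<bullet> (a \<boxdot> b)"
  by (simp add: sm_mul_right)

lemma pl_sm_same [simp]: "a \<in> car A \<Longrightarrow> c \<bullet> a \<boxplus> d \<bullet> a = (c + d) \<bullet> a"
  by (simp add: sm_add)

lemma pl_sm_same1 [simp]: "a \<in> car A \<Longrightarrow> a \<boxplus> d \<bullet> a = (1 + d) \<bullet> a"
  by (simp add: sm_add)

lemma pl_sm_same2 [simp]: "a \<in> car A \<Longrightarrow> d \<bullet> a \<boxplus> a = (d + 1) \<bullet> a"
  by (simp add: sm_add)

lemma pl_same [simp]: "a \<in> car A \<Longrightarrow> a \<boxplus> a = 2 \<bullet> a"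
  using sm_add[of a 1 1] by simp

lemma pl_sm_same_left [simp]:
  "\<lbrakk>a \<in> car A; b \<in> car A\<rbrakk> \<Longrightarrow> c \<bullet> a \<boxplus> (d \<bullet> a \<boxplus> b) = (c + d) \<bullet> a \<boxplus> b"
  "\<lbrakk>a \<in> car A; b \<in> car A\<rbrakk> \<Longrightarrow> a \<boxplus> (d \<bullet> a \<boxplus> b) = (1 + d) \<bullet> a \<boxplus> b"
  "\<lbrakk>a \<in> car A; b \<in> car A\<rbrakk> \<Longrightarrow> d \<bullet> a \<boxplus> (a \<boxplus> b) = (d + 1) \<bullet> a \<boxplus> b"
  "\<lbrakk>a \<in> car A; b \<in> car A\<rbrakk> \<Longrightarrow> a \<boxplus> (a \<boxplus> b) = 2 \<bullet> a \<boxplus> b"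
  by (simp_all flip: pl_assoc)

lemma minus_closed [simp]: "\<lbrakk>a \<in> car A; b \<in> car A\<rbrakk> \<Longrightarrow> a \<boxminus> b \<in> car A"
  by (simp add: minus_def)

lemma minus_self [simp]: "a \<in> car A \<Longrightarrow> a \<boxminus> a = \<^bold>0"
  by (simp add: minus_def)

lemma minus_zer [simp]: "a \<in> car A \<Longrightarrow> a \<boxminus> \<^bold>0 = a"
  by (simp add: minus_def)

lemma minus_pl_cancel [simp]: "\<lbrakk>a \<in> car A; b \<in> car A\<rbrakk> \<Longrightarrow> (a \<boxminus> b) \<boxplus> b = a"
  by (simp add: minus_def pl_assoc)

lemma minus_eq_zer_iff: "\<lbrakk>a \<in> car A; b \<in> car A\<rbrakk> \<Longrightarrow> a \<boxminus> b = \<^bold>0 \<longleftrightarrow> a = b"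
  by (metis minus_pl_cancel minus_self zer_pl)

lemma st_zer [simp]: "\<^bold>0\<^sup>\<star> = \<^bold>0"
  using st_sm[of "\<^bold>0" 0] by simp

lemma st_un [simp]: "\<^bold>1\<^sup>\<star> = \<^bold>1"
  by (metis mul_un st_closed st_mul st_st un_closed un_mul)

lemmas alg = minus_def pl_ac mul_assoc mul_pl pl_mul sm_pl st_pl st_mul st_sm

lemma st_minus: "\<lbrakk>a \<in> car A; b \<in> car A\<rbrakk> \<Longrightarrow> (a \<boxminus> b)\<^sup>\<star> = a\<^sup>\<star> \<boxminus> b\<^sup>\<star>"
  by (simp add: alg)

lemma mul_minus: "\<lbrakk>a \<in> car A; b \<in> car A; d \<in> car A\<rbrakk> \<Longrightarrow> a \<boxdot> (b \<boxminus> d) = a \<boxdot> b \<boxminus> a \<boxdot> d"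
  by (simp add: alg)

lemma minus_mul: "\<lbrakk>a \<in> car A; b \<in> car A; d \<in> car A\<rbrakk> \<Longrightarrow> (a \<boxminus> b) \<boxdot> d = a \<boxdot> d \<boxminus> b \<boxdot> d"
  by (simp add: alg)

lemma sm_minus: "\<lbrakk>a \<in> car A; b \<in> car A\<rbrakk> \<Longrightarrow> c \<bullet> (a \<boxminus> b) = c \<bullet> a \<boxminus> c \<bullet> b"
  by (simp add: alg)

lemma minus_telescope:
  "\<lbrakk>a \<in> car A; b \<in> car A; d \<in> car A\<rbrakk> \<Longrightarrow> (a \<boxminus> b) \<boxplus> (b \<boxminus> d) = a \<boxminus> d"
  by (metis minus_def minus_pl_cancel minus_closed pl_assoc sm_closed)

lemma minus_pl_minus:
  "\<lbrakk>a \<in> car A; b \<in> car A; d \<in> car A; e \<in> car A\<rbrakk> \<Longrightarrow> (a \<boxplus> b) \<boxminus> (d \<boxplus> e) = (a \<boxminus> d) \<boxplus> (b \<boxminus> e)"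
  by (simp add: alg)

lemma minus_swap: "\<lbrakk>a \<in> car A; b \<in> car A\<rbrakk> \<Longrightarrow> b \<boxminus> a = (-1) \<bullet> (a \<boxminus> b)"
  by (simp add: alg)

lemma mul_minus_mul:
  "\<lbrakk>a \<in> car A; b \<in> car A; d \<in> car A; e \<in> car A\<rbrakk>
    \<Longrightarrow> a \<boxdot> b \<boxminus> d \<boxdot> e = (a \<boxminus> d) \<boxdot> b \<boxplus> d \<boxdot> (b \<boxminus> e)"
  by (simp add: minus_mul mul_minus minus_telescope)

end

text \<open>Definiteness and completeness are split off because operators on the module, Cauchy
  sequences and generated subalgebras come with a C*-seminorm only.\<close>

locale pre_cstar = star_alg A for A :: "'a calg" +
  assumes nm_ge_0 [simp]: "a \<in> car A \<Longrightarrow> 0 \<le> nm A a"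
    and nm_triangle: "\<lbrakk>a \<in> car A; b \<in> car A\<rbrakk> \<Longrightarrow> nm A (pl A a b) \<le> nm A a + nm A b"
    and nm_sm [simp]: "a \<in> car A \<Longrightarrow> nm A (sm A c a) = cmod c * nm A a"
    and nm_mul: "\<lbrakk>a \<in> car A; b \<in> car A\<rbrakk> \<Longrightarrow> nm A (mul A a b) \<le> nm A a * nm A b"
    and nm_cstar: "a \<in> car A \<Longrightarrow> nm A (mul A (st A a) a) = (nm A a)\<^sup>2"
begin

lemma nm_zer [simp]: "\<parallel>\<^bold>0\<parallel> = 0"
  using nm_sm[of "\<^bold>0" 0] by simp

lemma nm_st [simp]:
  assumes "a \<in> car A" shows "\<parallel>a\<^sup>\<star>\<parallel> = \<parallel>a\<parallel>"
proof -
  have le: "\<parallel>b\<parallel> \<le> \<parallel>b\<^sup>\<star>\<parallel>" if b: "b \<in> car A" for b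
  proof (cases "\<parallel>b\<parallel> = 0")
    case False
    have "\<parallel>b\<parallel> * \<parallel>b\<parallel> \<le> \<parallel>b\<^sup>\<star>\<parallel> * \<parallel>b\<parallel>"
      using nm_cstar[OF b] nm_mul[of "b\<^sup>\<star>" b] b by (simp add: power2_eq_square)
    then show ?thesis using False nm_ge_0[OF b] by (simp add: mult_le_cancel_right)
  qed (use b in auto)
  show ?thesis using le[of a] le[of "a\<^sup>\<star>"] assms by simp
qed

lemma nm_minus_commute: "\<lbrakk>a \<in> car A; b \<in> car A\<rbrakk> \<Longrightarrow> \<parallel>a \<boxminus> b\<parallel> = \<parallel>b \<boxminus> a\<parallel>"
  using minus_swap[of a b] by simp

lemma nm_minus_triangle:
  "\<lbrakk>a \<in> car A; b \<in> car A; d \<in> car A\<rbrakk> \<Longrightarrow> \<parallel>a \<boxminus> d\<parallel> \<le> \<parallel>a \<boxminus> b\<parallel> + \<parallel>b \<boxminus> d\<parallel>"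
  using nm_triangle[of "a \<boxminus> b" "b \<boxminus> d"] by (simp add: minus_telescope)

lemma nm_diff_le:
  assumes "a \<in> car A" "b \<in> car A" shows "\<bar>\<parallel>a\<parallel> - \<parallel>b\<parallel>\<bar> \<le> \<parallel>a \<boxminus> b\<parallel>"
  using nm_minus_triangle[of a b "\<^bold>0"] nm_minus_triangle[of b a "\<^bold>0"] nm_minus_commute[of a b] assms
  by simp

end

locale cstar = pre_cstar A for A :: "'a calg" +
  assumes nm_eq_0_iff [simp]: "a \<in> car A \<Longrightarrow> nm A a = 0 \<longleftrightarrow> a = zer A"
    and complete: "\<lbrakk>\<And>n::nat. f n \<in> car A; \<And>e::real. e > 0 \<Longrightarrow> \<exists>N. \<forall>m\<ge>N. \<forall>n\<ge>N. nm A (minus A (f m) (f n)) < e\<rbrakk>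
      \<Longrightarrow> \<exists>l\<in>car A. \<forall>e::real>0. \<exists>N. \<forall>n\<ge>N. nm A (minus A (f n) l) < e"

lemma unital_cstar_algebra_iff_cstar: "unital_cstar_algebra A \<longleftrightarrow> cstar A"
proof
  assume "unital_cstar_algebra A"
  then show "cstar A"
    unfolding unital_cstar_algebra_def
    apply (elim conjE)
    apply unfold_locales
    \<comment> \<open>The definition splits into 26 conjuncts, \<open>p(1)\<close> to
      \<open>p(26)\<close>; the premises \<open>p(27)\<close> to \<open>p(29)\<close> are the
      assumptions of the locale axiom being proved.\<close>
    subgoal premises p using p(1) by blast
    subgoal premises p using p(2) by blast
    subgoal premises p using p(3,27,28) by blast
    subgoal premises p using p(3,27,28) by blast
    subgoal premises p using p(4,27) by blast
    subgoal premises p using p(4,27) by blast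
    subgoal premises p using p(5,27,28,29) by blast
    subgoal premises p using p(6,27,28) by blast
    subgoal premises p using p(7,27) by blast
    subgoal premises p using p(8,27) by blast
    subgoal premises p using p(9,27,28) by blast
    subgoal premises p using p(10,27) by blast
    subgoal premises p using p(11,27) by blast
    subgoal premises p using p(12,27) by blast
    subgoal premises p using p(13,27,28,29) by blast
    subgoal premises p using p(14,27,28,29) by blast
    subgoal premises p using p(14,27,28,29) by blast
    subgoal premises p using p(15,27,28) by blast
    subgoal premises p using p(15,27,28) by blast
    subgoal premises p using p(16,27) by blast
    subgoal premises p using p(16,27) by blast
    subgoal premises p using p(17,27) by blast
    subgoal premises p using p(18,27,28) by blast
    subgoal premises p using p(19,27,28) by blast
    subgoal premises p using p(20,27) by blast
    subgoal premises p using p(21,27) by blast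
    subgoal premises p using p(22,27,28) by blast
    subgoal premises p using p(23,27) by blast
    subgoal premises p using p(24,27,28) by blast
    subgoal premises p using p(25,27) by blast
    subgoal premises p using p(21,27) by blast
    subgoal premises p using p(26,27,28) by blast
    done
next
  assume "cstar A"
  then interpret cstar A .
  show "unital_cstar_algebra A"
    unfolding unital_cstar_algebra_def
    by (intro conjI ballI allI impI pl_inverse complete)
      (simp_all add: pl_ac mul_assoc mul_pl pl_mul sm_pl st_pl st_mul st_sm sm_add sm_mult
        nm_triangle nm_mul nm_cstar del: sm_sm pl_sm_same)
qed

section \<open>Positive elements\<close>

context pre_cstar
begin

definition tends :: "(nat \<Rightarrow> 'a) \<Rightarrow> 'a \<Rightarrow> bool" where
  "tends f l \<longleftrightarrow> (\<forall>n. f n \<in> car A) \<and> l \<in> car A \<and> (\<lambda>n. \<parallel>f n \<boxminus> l\<parallel>) \<longlonglongrightarrow> 0"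

lemma tends_const: "a \<in> car A \<Longrightarrow> tends (\<lambda>n. a) a"
  by (simp add: tends_def)

lemma tends_car: "tends f l \<Longrightarrow> f n \<in> car A" "tends f l \<Longrightarrow> l \<in> car A"
  by (simp_all add: tends_def)

lemma tendsto_nm_minusI:
  assumes "\<And>n. \<parallel>f n \<boxminus> l\<parallel> \<le> g n" "g \<longlonglongrightarrow> 0" "\<And>n. f n \<in> car A" "l \<in> car A"
  shows "tends f l"
  unfolding tends_def using assms
  by (auto intro!: tendsto_sandwich[OF _ _ tendsto_const[of 0] assms(2)])

lemma tends_pl:
  assumes "tends f l" "tends g k"
  shows "tends (\<lambda>n. f n \<boxplus> g n) (l \<boxplus> k)"
proof (rule tendsto_nm_minusI)
  show "\<parallel>(f n \<boxplus> g n) \<boxminus> (l \<boxplus> k)\<parallel> \<le> \<parallel>f n \<boxminus> l\<parallel> + \<parallel>g n \<boxminus> k\<parallel>" for n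
    using nm_triangle[of "f n \<boxminus> l" "g n \<boxminus> k"] tends_car[OF assms(1)] tends_car[OF assms(2)]
    by (simp add: minus_pl_minus)
  show "(\<lambda>n. \<parallel>f n \<boxminus> l\<parallel> + \<parallel>g n \<boxminus> k\<parallel>) \<longlonglongrightarrow> 0"
    using assms unfolding tends_def by (auto intro: tendsto_eq_intros)
qed (use tends_car[OF assms(1)] tends_car[OF assms(2)] in auto)

lemma tends_sm:
  assumes "tends f l"
  shows "tends (\<lambda>n. c \<bullet> f n) (c \<bullet> l)"
proof (rule tendsto_nm_minusI)
  show "\<parallel>c \<bullet> f n \<boxminus> c \<bullet> l\<parallel> \<le> cmod c * \<parallel>f n \<boxminus> l\<parallel>" for n
    using tends_car[OF assms] by (simp flip: sm_minus)
  show "(\<lambda>n. cmod c * \<parallel>f n \<boxminus> l\<parallel>) \<longlonglongrightarrow> 0"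
    using assms unfolding tends_def by (auto intro: tendsto_eq_intros)
qed (use tends_car[OF assms(1)] in auto)

lemma tends_st:
  assumes "tends f l"
  shows "tends (\<lambda>n. (f n)\<^sup>\<star>) (l\<^sup>\<star>)"
  using assms tends_car[OF assms] unfolding tends_def by (simp flip: st_minus)

lemma tends_nm:
  assumes "tends f l"
  shows "(\<lambda>n. \<parallel>f n\<parallel>) \<longlonglongrightarrow> \<parallel>l\<parallel>"
proof -
  have "(\<lambda>n. \<parallel>f n\<parallel> - \<parallel>l\<parallel>) \<longlonglongrightarrow> 0"
  proof (rule tendsto_rabs_zero_cancel,
      rule tendsto_sandwich[where f = "\<lambda>_. 0" and h = "\<lambda>n. \<parallel>f n \<boxminus> l\<parallel>"])
    show "\<forall>\<^sub>F n in sequentially. \<bar>\<parallel>f n\<parallel> - \<parallel>l\<parallel>\<bar> \<le> \<parallel>f n \<boxminus> l\<parallel>"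
      using tends_car[OF assms] nm_diff_le by simp
  qed (use assms in \<open>auto simp: tends_def\<close>)
  then show ?thesis by (simp add: LIM_zero_iff)
qed

lemma tends_mul:
  assumes "tends f l" "tends g k"
  shows "tends (\<lambda>n. f n \<boxdot> g n) (l \<boxdot> k)"
proof (rule tendsto_nm_minusI)
  note cl = tends_car[OF assms(1)] tends_car[OF assms(2)]
  show "\<parallel>(f n \<boxdot> g n) \<boxminus> (l \<boxdot> k)\<parallel> \<le> \<parallel>f n \<boxminus> l\<parallel> * \<parallel>g n\<parallel> + \<parallel>l\<parallel> * \<parallel>g n \<boxminus> k\<parallel>" for n
  proof -
    have "\<parallel>(f n \<boxdot> g n) \<boxminus> (l \<boxdot> k)\<parallel> \<le> \<parallel>(f n \<boxminus> l) \<boxdot> g n\<parallel> + \<parallel>l \<boxdot> (g n \<boxminus> k)\<parallel>"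
      using cl by (simp add: mul_minus_mul nm_triangle)
    then show ?thesis
      using nm_mul[of "f n \<boxminus> l" "g n"] nm_mul[of l "g n \<boxminus> k"] cl by fastforce
  qed
  show "(\<lambda>n. \<parallel>f n \<boxminus> l\<parallel> * \<parallel>g n\<parallel> + \<parallel>l\<parallel> * \<parallel>g n \<boxminus> k\<parallel>) \<longlonglongrightarrow> 0"
    using assms tends_nm[OF assms(2)] unfolding tends_def by (auto intro!: tendsto_eq_intros)
qed (use tends_car[OF assms(1)] tends_car[OF assms(2)] in auto)

end

context cstar
begin

lemma tends_unique:
  assumes "tends f l" "tends f k"
  shows "l = k"
proof -
  have "(\<lambda>n. \<parallel>f n \<boxminus> l\<parallel> + \<parallel>f n \<boxminus> k\<parallel>) \<longlonglongrightarrow> 0 + 0"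
    using assms unfolding tends_def by (intro tendsto_intros) auto
  moreover have "\<parallel>l \<boxminus> k\<parallel> \<le> \<parallel>f n \<boxminus> l\<parallel> + \<parallel>f n \<boxminus> k\<parallel>" for n
    using nm_minus_triangle[of l "f n" k] nm_minus_commute[of l "f n"]
      tends_car[OF assms(1)] tends_car[OF assms(2)] by simp
  ultimately have "\<parallel>l \<boxminus> k\<parallel> \<le> 0"
    by (intro LIMSEQ_le_const[where X = "\<lambda>n. \<parallel>f n \<boxminus> l\<parallel> + \<parallel>f n \<boxminus> k\<parallel>"]) auto
  then have "\<parallel>l \<boxminus> k\<parallel> = 0"
    by (rule antisym) (use tends_car[OF assms(1)] tends_car[OF assms(2)] in simp)
  then show ?thesis
    using tends_car[OF assms(1)] tends_car[OF assms(2)] by (simp add: minus_eq_zer_iff)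
qed

section \<open>Self-adjoint elements and square roots by iteration\<close>

definition sa :: "'a \<Rightarrow> bool" where "sa a \<longleftrightarrow> a \<in> car A \<and> a\<^sup>\<star> = a"

abbreviation real_un :: "real \<Rightarrow> 'a" where "real_un t \<equiv> complex_of_real t \<bullet> \<^bold>1"

text \<open>This norm condition makes the positive elements visibly a convex cone; that it
  describes the elements of the form \<open>b\<^sup>\<star> b\<close> is \<open>pos_star_mul\<close> and \<open>pos_sqrt\<close>.\<close>

definition pos :: "'a \<Rightarrow> bool" where
  "pos a \<longleftrightarrow> sa a \<and> (\<exists>t\<ge>0. \<parallel>real_un t \<boxminus> a\<parallel> \<le> t)"

lemma sa_car [simp]: "sa a \<Longrightarrow> a \<in> car A" and sa_st: "sa a \<Longrightarrow> a\<^sup>\<star> = a"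
  by (simp_all add: sa_def)

lemma pos_sa: "pos a \<Longrightarrow> sa a" by (simp add: pos_def)

lemma pos_car [simp]: "pos a \<Longrightarrow> a \<in> car A" by (simp add: pos_def)

lemma sa_pl: "sa a \<Longrightarrow> sa b \<Longrightarrow> sa (a \<boxplus> b)"
  by (simp add: sa_def st_pl)

lemma sa_sm: "sa a \<Longrightarrow> sa (complex_of_real r \<bullet> a)"
  by (simp add: sa_def st_sm)

lemma sa_real_un [simp]: "sa (real_un t)"
  by (simp add: sa_def st_sm)

lemma sa_un [simp]: "sa \<^bold>1"
  by (simp add: sa_def)

lemma sa_minus: "sa a \<Longrightarrow> sa b \<Longrightarrow> sa (a \<boxminus> b)"
  by (simp add: sa_def st_minus)

lemma sa_mul: "sa a \<Longrightarrow> sa b \<Longrightarrow> a \<boxdot> b = b \<boxdot> a \<Longrightarrow> sa (a \<boxdot> b)"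
  by (simp add: sa_def st_mul)

lemma nm_sa_sq: "sa a \<Longrightarrow> \<parallel>a \<boxdot> a\<parallel> = \<parallel>a\<parallel>\<^sup>2"
  using nm_cstar[of a] by (simp add: sa_def)

text \<open>The C*-identity leaves the values 0 and 1 for the norm of the unit; the value 0 occurs
  in the zero algebra, hence the inequality.\<close>

lemma nm_un_le: "\<parallel>\<^bold>1\<parallel> \<le> 1"
proof -
  have "\<parallel>\<^bold>1\<parallel>\<^sup>2 = \<parallel>\<^bold>1\<parallel>" using nm_cstar[of "\<^bold>1"] by simp
  then have "\<parallel>\<^bold>1\<parallel> = 0 \<or> \<parallel>\<^bold>1\<parallel> = 1" by (simp add: power2_eq_square)
  then show ?thesis by auto
qed

lemma nm_real_un_le: "0 \<le> t \<Longrightarrow> \<parallel>real_un t\<parallel> \<le> t"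
  using mult_left_mono[OF nm_un_le, of t] by simp

text \<open>A limit \<open>l\<close> of this iteration satisfies \<open>2 l = x + l l\<close>, which
  is the equation \<open>(1 - l)(1 - l) = 1 - x\<close>.\<close>

fun sqrt_iter :: "'a \<Rightarrow> nat \<Rightarrow> 'a" where
  "sqrt_iter x 0 = \<^bold>0"
| "sqrt_iter x (Suc n) = (1/2) \<bullet> (x \<boxplus> sqrt_iter x n \<boxdot> sqrt_iter x n)"

text \<open>The same iteration at the scalar \<open>x = 1\<close>. It dominates
  \<open>sqrt_iter\<close> and its increments in norm, so monotone convergence of reals delivers the
  Cauchy property.\<close>

fun sqrt_bd :: "nat \<Rightarrow> real" where
  "sqrt_bd 0 = 0"
| "sqrt_bd (Suc n) = (1 + (sqrt_bd n)\<^sup>2) / 2"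

lemma sqrt_bd: "0 \<le> sqrt_bd n \<and> sqrt_bd n \<le> 1"
proof (induction n)
  case (Suc n)
  then have "(sqrt_bd n)\<^sup>2 \<le> 1" by (simp add: power_le_one)
  then show ?case by simp
qed simp

lemma sqrt_bd_mono: "sqrt_bd n \<le> sqrt_bd (Suc n)"
proof -
  have "0 \<le> (1 - sqrt_bd n)\<^sup>2" by simp
  then show ?thesis by (simp add: power2_diff)
qed

lemma sqrt_iter_car: "x \<in> car A \<Longrightarrow> sqrt_iter x n \<in> car A"
  by (induction n) auto

text \<open>Every iterate is a polynomial in \<open>x\<close>. Passed to the limit, this makes
  square roots commute with all that commutes with the given element, which later permits
  multiplying the roots of commuting elements.\<close>

lemma sqrt_iter_commute:
  "x \<in> car A \<Longrightarrow> z \<in> car A \<Longrightarrow> z \<boxdot> x = x \<boxdot> z \<Longrightarrow> z \<boxdot> sqrt_iter x n = sqrt_iter x n \<boxdot> z"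
proof (induction n)
  case (Suc n)
  note c = sqrt_iter_car[OF Suc.prems(1), of n]
  have "z \<boxdot> (sqrt_iter x n \<boxdot> sqrt_iter x n) = sqrt_iter x n \<boxdot> (sqrt_iter x n \<boxdot> z)"
    using Suc c by (metis mul_assoc)
  then show ?case using Suc c by (simp add: mul_pl pl_mul mul_assoc)
qed simp

lemma sqrt_iter_sa: "sa x \<Longrightarrow> sa (sqrt_iter x n)"
  by (induction n) (auto simp: sa_def st_sm st_pl st_mul)

text \<open>Consecutive iterates \<open>y\<close>, \<open>z\<close> commute, so the next increment
  is half of \<open>(z - y)(z + y)\<close>. The scalar sequence satisfies the same identity, hence
  bounds for iterates and increments propagate together.\<close>

lemma sqrt_iter_bound:
  assumes "x \<in> car A" "\<parallel>x\<parallel> \<le> 1"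
  shows "\<parallel>sqrt_iter x n\<parallel> \<le> sqrt_bd n
    \<and> \<parallel>sqrt_iter x (Suc n) \<boxminus> sqrt_iter x n\<parallel> \<le> sqrt_bd (Suc n) - sqrt_bd n"
proof (induction n)
  case 0
  show ?case using assms by simp
next
  case (Suc n)
  define y where "y = sqrt_iter x n"
  define z where "z = sqrt_iter x (Suc n)"
  have c: "y \<in> car A" "z \<in> car A"
    unfolding y_def z_def by (rule sqrt_iter_car, fact)+
  have zb: "\<parallel>z\<parallel> \<le> sqrt_bd (Suc n)"
  proof -
    have "\<parallel>x \<boxplus> y \<boxdot> y\<parallel> \<le> 1 + (sqrt_bd n)\<^sup>2"
      using nm_triangle[of x "y \<boxdot> y"] nm_mul[of y y] assms c Suc sqrt_bd[of n]
        mult_mono[of "\<parallel>y\<parallel>" "sqrt_bd n" "\<parallel>y\<parallel>" "sqrt_bd n"]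
      by (simp add: y_def power2_eq_square)
    moreover have "z = (1/2) \<bullet> (x \<boxplus> y \<boxdot> y)" by (simp add: z_def y_def)
    ultimately show ?thesis using assms c by simp
  qed
  have comm: "y \<boxdot> z = z \<boxdot> y"
    unfolding z_def
    by (rule sqrt_iter_commute, use assms c in \<open>simp_all\<close>)
      (unfold y_def, rule sqrt_iter_commute[symmetric], use assms in simp_all)
  have "sqrt_iter x (Suc (Suc n)) \<boxminus> z = (1/2) \<bullet> ((z \<boxminus> y) \<boxdot> (z \<boxplus> y))"
  proof -
    have "(z \<boxminus> y) \<boxdot> (z \<boxplus> y) = z \<boxdot> z \<boxminus> y \<boxdot> y"
    proof -
      have "(z \<boxminus> y) \<boxdot> (z \<boxplus> y) = (z \<boxdot> z \<boxminus> y \<boxdot> z) \<boxplus> (z \<boxdot> y \<boxminus> y \<boxdot> y)"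
        using c by (simp add: mul_pl minus_mul)
      also have "\<dots> = (z \<boxdot> z \<boxminus> y \<boxdot> z) \<boxplus> (y \<boxdot> z \<boxminus> y \<boxdot> y)" using comm by simp
      finally show ?thesis using c by (simp add: minus_telescope)
    qed
    moreover have "sqrt_iter x (Suc (Suc n)) \<boxminus> z = (1/2) \<bullet> ((x \<boxplus> z \<boxdot> z) \<boxminus> (x \<boxplus> y \<boxdot> y))"
      using c assms by (simp add: z_def[symmetric] sm_minus) (simp add: z_def y_def)
    moreover have "(x \<boxplus> z \<boxdot> z) \<boxminus> (x \<boxplus> y \<boxdot> y) = z \<boxdot> z \<boxminus> y \<boxdot> y"
      using c assms by (simp add: minus_pl_minus)
    ultimately show ?thesis by simp
  qed
  moreover have "\<parallel>(z \<boxminus> y) \<boxdot> (z \<boxplus> y)\<parallel>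
      \<le> (sqrt_bd (Suc n) - sqrt_bd n) * (sqrt_bd (Suc n) + sqrt_bd n)"
  proof -
    have "\<parallel>z \<boxplus> y\<parallel> \<le> sqrt_bd (Suc n) + sqrt_bd n"
      using nm_triangle[of z y] c zb Suc by (simp add: y_def del: sqrt_iter.simps sqrt_bd.simps)
    moreover have "\<parallel>z \<boxminus> y\<parallel> \<le> sqrt_bd (Suc n) - sqrt_bd n"
      using Suc by (simp add: z_def y_def)
    ultimately show ?thesis
      using nm_mul[of "z \<boxminus> y" "z \<boxplus> y"] c sqrt_bd_mono[of n]
      by (meson diff_ge_0_iff_ge dual_order.trans minus_closed mult_mono nm_ge_0 pl_closed)
  qed
  moreover have "(sqrt_bd (Suc n) - sqrt_bd n) * (sqrt_bd (Suc n) + sqrt_bd n)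
      = 2 * (sqrt_bd (Suc (Suc n)) - sqrt_bd (Suc n))"
    by (simp add: field_simps power2_eq_square)
  ultimately show ?case using zb c by (simp add: z_def del: sqrt_iter.simps sqrt_bd.simps)
qed

lemma sqrt_iter_dist:
  assumes "x \<in> car A" "\<parallel>x\<parallel> \<le> 1" "n \<le> m"
  shows "\<parallel>sqrt_iter x m \<boxminus> sqrt_iter x n\<parallel> \<le> sqrt_bd m - sqrt_bd n"
  using assms(3)
proof (induction m rule: dec_induct)
  case base
  then show ?case using assms by (simp add: sqrt_iter_car)
next
  case (step m)
  then show ?case
    using nm_minus_triangle[OF sqrt_iter_car sqrt_iter_car sqrt_iter_car, OF assms(1) assms(1) assms(1), of "Suc m" n m]
      sqrt_iter_bound[OF assms(1,2), of m] by linarith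
qed

text \<open>The root is \<open>y = 1 - l\<close> for the limit \<open>l\<close> of the iteration.
  Positivity comes for free: \<open>l\<close> has norm at most 1, and \<open>1 - y = l\<close> is
  then the norm condition of \<open>pos\<close> with \<open>t = 1\<close>.\<close>

lemma sqrt_one_minus:
  assumes "sa x" "\<parallel>x\<parallel> \<le> 1"
  obtains y where "sa y" "pos y" "y \<boxdot> y = \<^bold>1 \<boxminus> x"
    "\<And>z. z \<in> car A \<Longrightarrow> z \<boxdot> x = x \<boxdot> z \<Longrightarrow> z \<boxdot> y = y \<boxdot> z"
proof -
  have x: "x \<in> car A" using assms by simp
  define f where "f = sqrt_iter x"
  have fc: "f n \<in> car A" for n unfolding f_def by (rule sqrt_iter_car[OF x])
  have "convergent sqrt_bd"
    by (intro Bseq_mono_convergent BseqI'[of _ 1] allI impI)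
      (use sqrt_bd sqrt_bd_mono in \<open>auto simp: lift_Suc_mono_le\<close>)
  then have cau: "Cauchy sqrt_bd" by (simp add: convergent_Cauchy)
  have "\<exists>l\<in>car A. \<forall>e::real>0. \<exists>N. \<forall>n\<ge>N. \<parallel>f n \<boxminus> l\<parallel> < e"
  proof (rule complete)
    fix e :: real assume "e > 0"
    then obtain N where N: "\<And>m n. m \<ge> N \<Longrightarrow> n \<ge> N \<Longrightarrow> \<bar>sqrt_bd m - sqrt_bd n\<bar> < e"
      using cau by (auto simp: Cauchy_def dist_real_def) metis
    have "\<parallel>f m \<boxminus> f n\<parallel> < e" if "m \<ge> N" "n \<ge> N" for m n
      using sqrt_iter_dist[OF x assms(2), of m n] sqrt_iter_dist[OF x assms(2), of n m]
        N[OF that] nm_minus_commute[OF fc fc, of m n]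
      by (cases "m \<le> n") (auto simp: f_def)
    then show "\<exists>N. \<forall>m\<ge>N. \<forall>n\<ge>N. \<parallel>f m \<boxminus> f n\<parallel> < e" by blast
  qed (rule fc)
  then obtain l where l: "l \<in> car A" "\<And>e::real. e > 0 \<Longrightarrow> \<exists>N. \<forall>n\<ge>N. \<parallel>f n \<boxminus> l\<parallel> < e"
    by blast
  have tl: "tends f l"
    unfolding tends_def using l fc by (auto simp: LIMSEQ_def dist_real_def)
  have "tends (\<lambda>n. (1/2) \<bullet> (x \<boxplus> f n \<boxdot> f n)) ((1/2) \<bullet> (x \<boxplus> l \<boxdot> l))"
    by (intro tends_sm tends_pl tends_mul tends_const tl x)
  moreover have "tends (\<lambda>n. f (Suc n)) l"
    using tl LIMSEQ_Suc[of "\<lambda>n. \<parallel>f n \<boxminus> l\<parallel>" 0] by (simp add: tends_def)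
  ultimately have leq: "(1/2) \<bullet> (x \<boxplus> l \<boxdot> l) = l"
    using tends_unique by (simp add: f_def)
  have lsa: "sa l"
    using tends_unique[OF tends_st[OF tl]] tl sqrt_iter_sa[OF assms(1)] l
    by (simp add: f_def sa_def)
  have lcomm: "z \<boxdot> l = l \<boxdot> z" if z: "z \<in> car A" "z \<boxdot> x = x \<boxdot> z" for z
  proof -
    have "tends (\<lambda>n. z \<boxdot> f n) (z \<boxdot> l)" "tends (\<lambda>n. f n \<boxdot> z) (l \<boxdot> z)"
      by (intro tends_mul tends_const tl z)+
    then show ?thesis
      using tends_unique sqrt_iter_commute[OF x z] by (simp add: f_def)
  qed
  have lb: "\<parallel>l\<parallel> \<le> 1"
  proof (rule LIMSEQ_le_const2[OF tends_nm[OF tl]])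
    show "\<exists>N. \<forall>n\<ge>N. \<parallel>f n\<parallel> \<le> 1"
      using sqrt_iter_bound[OF x assms(2)] sqrt_bd by (metis f_def order_trans)
  qed
  define y where "y = \<^bold>1 \<boxminus> l"
  have ysa: "sa y" unfolding y_def using lsa by (simp add: sa_minus)
  have "\<^bold>1 \<boxminus> y = l" using l by (simp add: y_def alg)
  then have ypos: "pos y"
    unfolding pos_def using ysa lb by (intro conjI exI[of _ 1]) simp_all
  have "l \<boxdot> l \<boxplus> x = 2 \<bullet> l"
  proof -
    have "2 \<bullet> l = 2 \<bullet> ((1/2) \<bullet> (x \<boxplus> l \<boxdot> l))" using leq by simp
    then show ?thesis using l x by (simp add: pl_comm)
  qed
  then have "\<^bold>1 \<boxplus> (-2) \<bullet> l \<boxplus> l \<boxdot> l \<boxplus> x = \<^bold>1"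
    using l x by (simp add: pl_assoc)
  moreover have "y \<boxdot> y = \<^bold>1 \<boxplus> (-2) \<bullet> l \<boxplus> l \<boxdot> l"
    using l by (simp add: y_def alg)
  ultimately have "y \<boxdot> y \<boxplus> x = \<^bold>1" by simp
  then have yy: "y \<boxdot> y = \<^bold>1 \<boxminus> x"
    using x ysa pl_left_cancel[of x "y \<boxdot> y" "\<^bold>1 \<boxminus> x"]
    by (metis minus_closed minus_pl_cancel mul_closed pl_comm sa_car un_closed)
  have "z \<boxdot> y = y \<boxdot> z" if "z \<in> car A" "z \<boxdot> x = x \<boxdot> z" for z
    using lcomm[OF that] that l by (simp add: y_def minus_mul mul_minus)
  then show thesis using that[OF ysa ypos yy] by blast
qed

end

context star_alg
begin

text \<open>Linear identities are normalised by rewriting the vectors involved as \<open>L\<close> of unit coordinates.\<close>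

lemma linear_coordinates:
  assumes "p \<in> car A" "q \<in> car A" "r \<in> car A" "s \<in> car A"
  obtains L where "p = L 1 0 0 0" "q = L 0 1 0 0" "r = L 0 0 1 0" "s = L 0 0 0 1"
    "\<And>a b c d a' b' c' d'. L a b c d \<boxplus> L a' b' c' d' = L (a + a') (b + b') (c + c') (d + d')"
    "\<And>k a b c d. k \<bullet> L a b c d = L (k * a) (k * b) (k * c) (k * d)"
    "\<^bold>0 = L 0 0 0 0"
proof -
  define L where "L = (\<lambda>a b c d. (a \<bullet> p \<boxplus> b \<bullet> q) \<boxplus> (c \<bullet> r \<boxplus> d \<bullet> s))"
  have swap: "(w \<boxplus> x) \<boxplus> (y \<boxplus> z) = (w \<boxplus> y) \<boxplus> (x \<boxplus> z)"
    if "w \<in> car A" "x \<in> car A" "y \<in> car A" "z \<in> car A" for w x y z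
    using that by (metis pl_assoc pl_closed pl_left_comm)
  have "L a b c d \<boxplus> L a' b' c' d' = L (a + a') (b + b') (c + c') (d + d')" for a b c d a' b' c' d'
    unfolding L_def using assms by (simp add: swap[of "_ \<boxplus> _"] swap sm_add del: pl_sm_same)
  then show thesis
    using assms by (intro that[of L]) (simp_all add: L_def sm_pl)
qed

end

section \<open>The positive cone and its compatibility with the norm\<close>

context cstar
begin

lemma pos_zer [simp]: "pos \<^bold>0"
  unfolding pos_def sa_def by (intro conjI exI[of _ 0]) simp_all

lemma pos_pl:
  assumes "pos a" "pos b" shows "pos (a \<boxplus> b)"
proof -
  obtain s t where st: "s \<ge> 0" "t \<ge> 0" "\<parallel>real_un s \<boxminus> a\<parallel> \<le> s" "\<parallel>real_un t \<boxminus> b\<parallel> \<le> t"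
    using assms unfolding pos_def by blast
  have "real_un (s + t) \<boxminus> (a \<boxplus> b) = (real_un s \<boxminus> a) \<boxplus> (real_un t \<boxminus> b)"
    using assms by (simp add: sm_add minus_pl_minus del: pl_sm_same)
  then have "\<parallel>real_un (s + t) \<boxminus> (a \<boxplus> b)\<parallel> \<le> s + t"
    using nm_triangle[of "real_un s \<boxminus> a" "real_un t \<boxminus> b"] assms st by simp
  then show ?thesis
    unfolding pos_def using st assms sa_pl pos_sa by (intro conjI exI[of _ "s + t"]) simp_all
qed

lemma pos_sm:
  assumes "pos a" "r \<ge> 0" shows "pos (complex_of_real r \<bullet> a)"
proof -
  obtain t where t: "t \<ge> 0" "\<parallel>real_un t \<boxminus> a\<parallel> \<le> t"
    using assms unfolding pos_def by blast
  have "real_un (r * t) \<boxminus> complex_of_real r \<bullet> a = complex_of_real r \<bullet> (real_un t \<boxminus> a)"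
    using assms by (simp add: sm_minus)
  then have "\<parallel>real_un (r * t) \<boxminus> complex_of_real r \<bullet> a\<parallel> \<le> r * t"
    using t assms by (simp add: mult_left_mono)
  then show ?thesis
    unfolding pos_def using t assms sa_sm pos_sa by (intro conjI exI[of _ "r * t"]) simp_all
qed

lemma minus_minus_cancel [simp]: "\<lbrakk>a \<in> car A; b \<in> car A\<rbrakk> \<Longrightarrow> a \<boxminus> (a \<boxminus> b) = b"
  by (rule linear_coordinates[of a b a b]) (auto simp: minus_def)

lemma pos_nm_minus:
  assumes "sa a" "\<parallel>a\<parallel> \<le> t" shows "pos (real_un t \<boxminus> a)"
  unfolding pos_def using assms order_trans[OF nm_ge_0 assms(2)]
  by (intro conjI exI[of _ t]) (simp_all add: sa_minus)

lemma sqrt_real_minus: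
  assumes "sa x" "\<parallel>x\<parallel> \<le> t"
  obtains y where "pos y" "y \<boxdot> y = real_un t \<boxminus> x"
    "\<And>z. z \<in> car A \<Longrightarrow> z \<boxdot> x = x \<boxdot> z \<Longrightarrow> z \<boxdot> y = y \<boxdot> z"
proof (cases "t = 0")
  case True
  then have "\<parallel>x\<parallel> = 0" using assms by (intro antisym) simp_all
  then have "x = \<^bold>0" using assms by simp
  then show thesis using that[of "\<^bold>0"] True by simp
next
  case False
  then have t: "t > 0" using assms order_trans[OF nm_ge_0 assms(2)] by simp
  define x' where "x' = complex_of_real (1/t) \<bullet> x"
  have "sa x'" "\<parallel>x'\<parallel> \<le> 1"
    using assms t sa_sm[OF assms(1), of "1/t"] by (simp_all add: x'_def norm_divide)
  then obtain y where y: "sa y" "pos y" "y \<boxdot> y = \<^bold>1 \<boxminus> x'"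
    "\<And>z. z \<in> car A \<Longrightarrow> z \<boxdot> x' = x' \<boxdot> z \<Longrightarrow> z \<boxdot> y = y \<boxdot> z"
    using sqrt_one_minus[of x'] by metis
  have "complex_of_real (sqrt t) * complex_of_real (sqrt t) = complex_of_real t"
    using t by (simp flip: of_real_mult)
  then have "(complex_of_real (sqrt t) \<bullet> y) \<boxdot> (complex_of_real (sqrt t) \<bullet> y) = real_un t \<boxminus> x"
    using y(1,3) t assms by (simp add: sm_minus x'_def)
  moreover have "z \<boxdot> (complex_of_real (sqrt t) \<bullet> y) = (complex_of_real (sqrt t) \<bullet> y) \<boxdot> z"
    if "z \<in> car A" "z \<boxdot> x = x \<boxdot> z" for z
    using y(4)[OF that(1)] that assms(1) y(1) by (simp add: x'_def)
  ultimately show thesis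
    using that pos_sm[OF y(2), of "sqrt t"] t by simp
qed

text \<open>The norm condition in \<open>pos\<close> is exactly the hypothesis of
  \<open>sqrt_real_minus\<close> for \<open>t - a\<close>, and
  \<open>t - (t - a) = a\<close>.\<close>

lemma pos_sqrt:
  assumes "pos a"
  obtains b where "pos b" "b \<boxdot> b = a"
    "\<And>z. z \<in> car A \<Longrightarrow> z \<boxdot> a = a \<boxdot> z \<Longrightarrow> z \<boxdot> b = b \<boxdot> z"
proof -
  obtain t where t: "t \<ge> 0" "\<parallel>real_un t \<boxminus> a\<parallel> \<le> t"
    using assms unfolding pos_def by blast
  have "sa (real_un t \<boxminus> a)" using assms pos_sa sa_minus by simp
  then obtain b where b: "pos b" "b \<boxdot> b = real_un t \<boxminus> (real_un t \<boxminus> a)"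
    "\<And>z. z \<in> car A \<Longrightarrow> z \<boxdot> (real_un t \<boxminus> a) = (real_un t \<boxminus> a) \<boxdot> z \<Longrightarrow> z \<boxdot> b = b \<boxdot> z"
    using sqrt_real_minus t by metis
  have comm: "z \<boxdot> b = b \<boxdot> z" if "z \<in> car A" "z \<boxdot> a = a \<boxdot> z" for z
    using b(3)[OF that(1)] that assms by (simp add: mul_minus minus_mul)
  have "b \<boxdot> b = a" using b(2) assms by simp
  then show thesis by (rule that[OF b(1) _ comm])
qed

text \<open>The element \<open>u = b + ic\<close> is \<open>\<surd>r\<close> times a unitary, and \<open>b\<close> is its real part.\<close>

lemma sa_sq_sum_bound:
  assumes "sa b" "sa c" "b \<boxdot> c = c \<boxdot> b" "b \<boxdot> b \<boxplus> c \<boxdot> c = real_un r" "r \<ge> 0"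
  shows "\<parallel>b\<parallel>\<^sup>2 \<le> r"
proof -
  have car: "b \<in> car A" "c \<in> car A" using assms by auto
  define u where "u = b \<boxplus> \<i> \<bullet> c"
  have u: "u \<in> car A" "u\<^sup>\<star> = b \<boxplus> (-\<i>) \<bullet> c"
    using car assms by (simp_all add: u_def st_pl st_sm sa_st)
  have "u\<^sup>\<star> \<boxdot> u = b \<boxdot> b \<boxplus> c \<boxdot> c"
    unfolding u(2) unfolding u_def
    by (rule linear_coordinates[of "b \<boxdot> b" "c \<boxdot> c" "c \<boxdot> b" "c \<boxdot> b"])
      (use car assms(3) in \<open>simp_all add: mul_pl pl_mul\<close>)
  then have ur: "\<parallel>u\<parallel>\<^sup>2 \<le> r"
    using nm_cstar[OF u(1)] nm_real_un_le[OF assms(5)] assms(4) by (simp del: nm_sm)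
  have "b = (1/2) \<bullet> (u \<boxplus> u\<^sup>\<star>)"
    unfolding u(2) unfolding u_def
    by (rule linear_coordinates[of b c b c]) (use car in simp_all)
  then have "\<parallel>b\<parallel> = (1/2) * \<parallel>u \<boxplus> u\<^sup>\<star>\<parallel>" using u nm_sm[of "u \<boxplus> u\<^sup>\<star>" "1/2"] by (metis norm_divide norm_numeral norm_one pl_closed st_closed)
  then have "\<parallel>b\<parallel> \<le> \<parallel>u\<parallel>" using nm_triangle[of u "u\<^sup>\<star>"] u(1) by simp
  then show ?thesis using ur power_mono[of "\<parallel>b\<parallel>" "\<parallel>u\<parallel>" 2] car by simp
qed

text \<open>Choose \<open>c\<close> with \<open>c c = |b|\<^sup>2 - b b\<close>. Then
  \<open>sa_sq_sum_bound\<close>, applied with the roles of the two squares exchanged, bounds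
  \<open>c c\<close> by \<open>|b|\<^sup>2\<close>, and this is the norm condition for
  \<open>b b\<close> with \<open>t = |b|\<^sup>2\<close>.\<close>

lemma pos_sq:
  assumes "sa b" shows "pos (b \<boxdot> b)"
proof -
  have b: "b \<in> car A" "sa (b \<boxdot> b)" "\<parallel>b \<boxdot> b\<parallel> \<le> \<parallel>b\<parallel>\<^sup>2"
    using assms by (auto simp: sa_mul nm_sa_sq)
  obtain c where c: "pos c" "c \<boxdot> c = real_un (\<parallel>b\<parallel>\<^sup>2) \<boxminus> b \<boxdot> b"
    "\<And>z. z \<in> car A \<Longrightarrow> z \<boxdot> (b \<boxdot> b) = (b \<boxdot> b) \<boxdot> z \<Longrightarrow> z \<boxdot> c = c \<boxdot> z"
    using sqrt_real_minus[OF b(2,3)] by metis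
  have "b \<boxdot> c = c \<boxdot> b" using c(3)[of b] b by (simp add: mul_assoc)
  moreover have "c \<boxdot> c \<boxplus> b \<boxdot> b = real_un (\<parallel>b\<parallel>\<^sup>2)" using c(1,2) b by simp
  ultimately have "\<parallel>c\<parallel>\<^sup>2 \<le> \<parallel>b\<parallel>\<^sup>2"
    using sa_sq_sum_bound[of c b "\<parallel>b\<parallel>\<^sup>2"] assms c(1) pos_sa by simp
  then have "\<parallel>real_un (\<parallel>b\<parallel>\<^sup>2) \<boxminus> b \<boxdot> b\<parallel> \<le> \<parallel>b\<parallel>\<^sup>2"
    using c(2) nm_sa_sq[OF pos_sa[OF c(1)]] by simp
  then show ?thesis unfolding pos_def using b by (intro conjI exI[of _ "\<parallel>b\<parallel>\<^sup>2"]) simp_all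
qed

text \<open>Square roots of commuting elements commute, so the product is the square of the
  self-adjoint element \<open>s \<boxdot> t\<close>.\<close>

lemma pos_mul:
  assumes "pos a" "pos b" "a \<boxdot> b = b \<boxdot> a"
  shows "pos (a \<boxdot> b)"
proof -
  obtain s where s: "pos s" "s \<boxdot> s = a"
    "\<And>z. z \<in> car A \<Longrightarrow> z \<boxdot> a = a \<boxdot> z \<Longrightarrow> z \<boxdot> s = s \<boxdot> z"
    using pos_sqrt[OF assms(1)] by metis
  obtain t where t: "pos t" "t \<boxdot> t = b"
    "\<And>z. z \<in> car A \<Longrightarrow> z \<boxdot> b = b \<boxdot> z \<Longrightarrow> z \<boxdot> t = t \<boxdot> z"
    using pos_sqrt[OF assms(2)] by metis
  have "b \<boxdot> s = s \<boxdot> b" using s(3)[of b] assms by simp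
  then have st: "s \<boxdot> t = t \<boxdot> s" using t(3)[of s] s(1) by simp
  have "(s \<boxdot> t) \<boxdot> (s \<boxdot> t) = a \<boxdot> b"
    unfolding s(2)[symmetric] t(2)[symmetric] using st s(1) t(1) by (metis mul_assoc mul_closed pos_car)
  then show ?thesis using pos_sq[OF sa_mul[OF pos_sa pos_sa st]] s(1) t(1) by simp
qed

text \<open>Substitute for the spectral argument: the roots of \<open>a\<close> and of
  \<open>r - a\<close> commute and their squares add up to \<open>r\<close>, so
  \<open>sa_sq_sum_bound\<close> controls the root of \<open>a\<close>.\<close>

lemma pos_nm_le:
  assumes "pos a" "pos (real_un r \<boxminus> a)" "r \<ge> 0"
  shows "\<parallel>a\<parallel> \<le> r"
proof -
  obtain s where s: "pos s" "s \<boxdot> s = a"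
    "\<And>z. z \<in> car A \<Longrightarrow> z \<boxdot> a = a \<boxdot> z \<Longrightarrow> z \<boxdot> s = s \<boxdot> z"
    using pos_sqrt[OF assms(1)] by metis
  obtain t where t: "pos t" "t \<boxdot> t = real_un r \<boxminus> a"
    "\<And>z. z \<in> car A \<Longrightarrow> z \<boxdot> (real_un r \<boxminus> a) = (real_un r \<boxminus> a) \<boxdot> z \<Longrightarrow> z \<boxdot> t = t \<boxdot> z"
    using pos_sqrt[OF assms(2)] by metis
  have "a \<boxdot> s = s \<boxdot> a" using s(3)[of a] assms by simp
  then have "s \<boxdot> t = t \<boxdot> s" using t(3)[of s] s(1) assms by (simp add: mul_minus minus_mul)
  moreover have "s \<boxdot> s \<boxplus> t \<boxdot> t = real_un r"
    using s(1,2) t(1,2) assms by (simp add: pl_comm[of a])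
  ultimately have "\<parallel>s\<parallel>\<^sup>2 \<le> r" using sa_sq_sum_bound[of s t r] s(1) t(1) assms pos_sa by simp
  then show ?thesis using nm_sa_sq[OF pos_sa[OF s(1)]] s(2) by simp
qed

text \<open>Add the positive elements \<open>|b| - b\<close> and \<open>b - a\<close>, then apply
  \<open>pos_nm_le\<close>.\<close>

lemma pos_nm_mono:
  assumes "pos a" "pos (b \<boxminus> a)" "sa b"
  shows "\<parallel>a\<parallel> \<le> \<parallel>b\<parallel>"
proof -
  have "pos ((real_un \<parallel>b\<parallel> \<boxminus> b) \<boxplus> (b \<boxminus> a))"
    using pos_pl[OF pos_nm_minus[OF assms(3)] assms(2)] by simp
  then have "pos (real_un \<parallel>b\<parallel> \<boxminus> a)" using assms by (simp add: minus_telescope)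
  then show ?thesis using pos_nm_le assms by simp
qed

text \<open>In place of a comparison of the spectra of \<open>c\<^sup>\<star> c\<close> and
  \<open>c c\<^sup>\<star>\<close>, the sum of the two products is written as twice a sum of two
  squares. This makes \<open>c c\<^sup>\<star>\<close> positive, so a suitable
  \<open>1 - c c\<^sup>\<star>/t\<close> is a contraction. Multiplying \<open>c\<close> by it cannot
  raise the norm, yet it enlarges \<open>k\<close>; comparing the two norms forces \<open>k\<close>
  to vanish.\<close>

lemma star_mul_neg_imp_zer:
  assumes c: "c \<in> car A" and k: "pos k" and ck: "c\<^sup>\<star> \<boxdot> c = (-1) \<bullet> k"
  shows "k = \<^bold>0"
proof -
  have kc: "k \<in> car A" "sa k" using k pos_sa by auto
  \<comment> \<open>\<open>x\<close> and \<open>y\<close> are the real and imaginary parts of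
    \<open>c\<close>.\<close>
  define x where "x = (1/2) \<bullet> (c \<boxplus> c\<^sup>\<star>)"
  define y where "y = (1/2) \<bullet> ((-\<i>) \<bullet> c \<boxplus> \<i> \<bullet> c\<^sup>\<star>)"
  have sxy: "sa x" "sa y"
  proof -
    have "x\<^sup>\<star> = (1/2) \<bullet> (c\<^sup>\<star> \<boxplus> c)" using c by (simp add: x_def st_sm st_pl)
    then have "x\<^sup>\<star> = x" using c pl_comm[of c "c\<^sup>\<star>"] unfolding x_def by (metis st_closed)
    moreover have "y\<^sup>\<star> = (1/2) \<bullet> (\<i> \<bullet> c\<^sup>\<star> \<boxplus> (-\<i>) \<bullet> c)" using c by (simp add: y_def st_sm st_pl)
    then have "y\<^sup>\<star> = y" using c pl_comm[of "\<i> \<bullet> c\<^sup>\<star>" "(-\<i>) \<bullet> c"] unfolding y_def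
      by (metis sm_closed st_closed)
    ultimately show "sa x" "sa y" using c by (auto simp: sa_def x_def y_def)
  qed
  have "x \<boxdot> x \<boxplus> y \<boxdot> y = (1/2) \<bullet> (c \<boxdot> c\<^sup>\<star> \<boxplus> c\<^sup>\<star> \<boxdot> c)"
    by (rule linear_coordinates[of "c \<boxdot> c" "c \<boxdot> c\<^sup>\<star>" "c\<^sup>\<star> \<boxdot> c" "c\<^sup>\<star> \<boxdot> c\<^sup>\<star>"])
      (use c in \<open>simp_all add: x_def y_def minus_def mul_pl pl_mul sm_pl\<close>)
  then have "2 \<bullet> (x \<boxdot> x \<boxplus> y \<boxdot> y) = c \<boxdot> c\<^sup>\<star> \<boxplus> (-1) \<bullet> k" using c kc by (simp add: ck)
  then have "c \<boxdot> c\<^sup>\<star> = complex_of_real 2 \<bullet> (x \<boxdot> x \<boxplus> y \<boxdot> y) \<boxplus> k"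
    using c kc by (simp add: pl_assoc)
  moreover have "pos (complex_of_real 2 \<bullet> (x \<boxdot> x \<boxplus> y \<boxdot> y) \<boxplus> k)"
    by (intro pos_pl pos_sm pos_sq sxy k) simp
  ultimately have "pos (c \<boxdot> c\<^sup>\<star>)" by simp
  then obtain t0 where t0: "t0 \<ge> 0" "\<parallel>real_un t0 \<boxminus> c \<boxdot> c\<^sup>\<star>\<parallel> \<le> t0" unfolding pos_def by blast
  \<comment> \<open>The summand 1 makes \<open>t\<close> invertible, and enlarging \<open>t0\<close>
    preserves the norm bound.\<close>
  define t where "t = t0 + 1"
  have t: "t > 0" using t0 by (simp add: t_def)
  have tb: "\<parallel>real_un t \<boxminus> c \<boxdot> c\<^sup>\<star>\<parallel> \<le> t"
  proof -
    have "real_un t \<boxminus> c \<boxdot> c\<^sup>\<star> = \<^bold>1 \<boxplus> (real_un t0 \<boxminus> c \<boxdot> c\<^sup>\<star>)"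
      by (rule linear_coordinates[of "\<^bold>1" "c \<boxdot> c\<^sup>\<star>" "\<^bold>1" "\<^bold>1"])
        (use c in \<open>simp_all add: t_def minus_def add.commute\<close>)
    then show ?thesis
      using nm_triangle[of "\<^bold>1" "real_un t0 \<boxminus> c \<boxdot> c\<^sup>\<star>"] t0 nm_un_le c by (simp add: t_def)
  qed
  \<comment> \<open>Multiplying \<open>c\<close> by the contraction \<open>q = 1 - c c\<^sup>\<star>/t\<close> enlarges \<open>k\<close>, since \<open>q c = c (1 + k/t)\<close>.\<close>
  define T where "T = complex_of_real (1/t)"
  define w where "w = \<^bold>1 \<boxplus> T \<bullet> k"
  define e where "e = c \<boxdot> w"
  have wc: "w \<in> car A" "w\<^sup>\<star> = w" using kc by (simp_all add: w_def T_def st_pl st_sm sa_st)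
  have "e = T \<bullet> ((real_un t \<boxminus> c \<boxdot> c\<^sup>\<star>) \<boxdot> c)"
    using c t kc by (simp add: e_def w_def T_def minus_mul mul_assoc ck mul_pl)
      (simp add: minus_def sm_pl)
  then have "\<parallel>e\<parallel> = (1/t) * \<parallel>(real_un t \<boxminus> c \<boxdot> c\<^sup>\<star>) \<boxdot> c\<parallel>"
    using c t by (simp add: T_def norm_divide)
  also have "\<dots> \<le> (1/t) * (t * \<parallel>c\<parallel>)"
    using nm_mul[of "real_un t \<boxminus> c \<boxdot> c\<^sup>\<star>" c] tb t c mult_right_mono[OF tb, of "\<parallel>c\<parallel>"]
    by (intro mult_left_mono) auto
  finally have ec: "\<parallel>e\<parallel> \<le> \<parallel>c\<parallel>" using t by simp
  define \<kappa> where "\<kappa> = \<parallel>k\<parallel>"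
  have kap: "\<parallel>c\<parallel>\<^sup>2 = \<kappa>" "\<kappa> \<ge> 0" using nm_cstar[OF c] ck kc by (simp_all add: \<kappa>_def)
  define k2 where "k2 = k \<boxdot> k"
  define k3 where "k3 = k \<boxdot> k2"
  have k23: "k2 \<in> car A" "k3 \<in> car A" "k \<boxdot> k = k2" "k \<boxdot> k2 = k3"
    using kc by (simp_all add: k2_def k3_def)
  define k' where "k' = k \<boxplus> (2 * T) \<bullet> k2 \<boxplus> (T * T) \<bullet> k3"
  have "e\<^sup>\<star> \<boxdot> e = w \<boxdot> ((c\<^sup>\<star> \<boxdot> c) \<boxdot> w)"
    using c wc by (simp add: e_def st_mul mul_assoc)
  also have "\<dots> = (-1) \<bullet> k'"
    using kc k23 by (simp add: ck w_def k'_def mul_pl pl_mul sm_pl)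
      (rule linear_coordinates[of k k2 k3 k]; simp)
  finally have "\<parallel>k'\<parallel> = \<parallel>e\<parallel>\<^sup>2" using nm_cstar[of e] c wc kc k23(1,2) by (simp add: e_def k'_def)
  then have k'b: "\<parallel>k'\<parallel> \<le> \<kappa>"
    using power_mono[OF ec, of 2] kap c wc by (simp add: e_def)
  have kk: "pos k2" using kc pos_sq by (simp add: k2_def)
  have kkk: "pos k3" unfolding k3_def using pos_mul[OF k kk] kc by (simp add: k2_def mul_assoc)
  have TT: "2 * T = complex_of_real (2/t)" "T * T = complex_of_real (1/t^2)"
    by (simp_all add: T_def power2_eq_square)
  have k1: "pos (k \<boxplus> (2 * T) \<bullet> k2)"
    unfolding TT using t k kk by (intro pos_pl pos_sm) auto
  have Tk3: "pos ((T * T) \<bullet> k3)"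
    unfolding TT using t kkk by (intro pos_sm) auto
  have "sa k'" unfolding k'_def using pos_pl[OF k1 Tk3] pos_sa by blast
  then have "pos (real_un \<kappa> \<boxminus> k')" using pos_nm_minus k'b by blast
  \<comment> \<open>Adding back the positive cubic term of \<open>k'\<close> leaves the quadratic
    inequality \<open>k + 2 k k / t \<le> \<kappa>\<close>.\<close>
  then have "pos ((real_un \<kappa> \<boxminus> k') \<boxplus> (T * T) \<bullet> k3)" using Tk3 pos_pl by blast
  also have "(real_un \<kappa> \<boxminus> k') \<boxplus> (T * T) \<bullet> k3 = real_un \<kappa> \<boxminus> (k \<boxplus> (2 * T) \<bullet> k2)"
    unfolding k'_def minus_def
    by (rule linear_coordinates[of "\<^bold>1" k k2 k3]) (use kc k23 in simp_all)
  finally have "pos (complex_of_real (t/2) \<bullet> (real_un \<kappa> \<boxminus> (k \<boxplus> (2 * T) \<bullet> k2)))"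
    by (rule pos_sm) (use t in simp)
  \<comment> \<open>\<open>s\<close> and \<open>v\<close> complete the square:
    \<open>(t/2)(\<kappa> - k - 2 k k / t) = s\<^sup>2 - v v\<close> with
    \<open>v = k + t/4\<close>.\<close>
  moreover define s where "s = sqrt (t*\<kappa>/2 + t\<^sup>2/16)"
  have ss: "s\<^sup>2 = t*\<kappa>/2 + t\<^sup>2/16" "s \<ge> t/4"
  proof -
    show "s\<^sup>2 = t*\<kappa>/2 + t\<^sup>2/16" using t kap by (simp add: s_def)
    show "s \<ge> t/4" unfolding s_def using t kap by (intro real_le_rsqrt) (simp add: power_divide)
  qed
  define v where "v = k \<boxplus> real_un (t/4)"
  have v: "sa v" unfolding v_def using kc by (intro sa_pl sa_real_un)
  have "complex_of_real (t/2) \<bullet> (real_un \<kappa> \<boxminus> (k \<boxplus> (2 * T) \<bullet> k2)) = real_un (s\<^sup>2) \<boxminus> v \<boxdot> v"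
    unfolding ss v_def T_def minus_def
    using kc k23 t by (simp add: mul_pl pl_mul sm_pl)
      (rule linear_coordinates[of "\<^bold>1" k k2 k]; simp add: field_simps power2_eq_square)
  ultimately have "pos (real_un (s\<^sup>2) \<boxminus> v \<boxdot> v)" by simp
  then have "\<parallel>v \<boxdot> v\<parallel> \<le> s\<^sup>2" using pos_nm_le[OF pos_sq[OF v]] by simp
  then have "\<parallel>v\<parallel>\<^sup>2 \<le> s\<^sup>2" using nm_sa_sq[OF v] by simp
  then have "\<parallel>v\<parallel> \<le> s" by (rule power2_le_imp_le) (use ss(2) t in simp)
  then have "pos (real_un s \<boxminus> v)" using pos_nm_minus v by blast
  also have "real_un s \<boxminus> v = real_un (s - t/4) \<boxminus> k"
    unfolding v_def
    by (rule linear_coordinates[of "\<^bold>1" k k k]) (use kc in \<open>simp_all add: minus_def\<close>)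
  finally have "\<kappa> \<le> s - t/4" using pos_nm_le k ss by (simp add: \<kappa>_def)
  then have "(\<kappa> + t/4)\<^sup>2 \<le> s\<^sup>2" using kap t by (intro power_mono) auto
  \<comment> \<open>Expanding both sides, the terms \<open>t \<kappa> / 2\<close> and
    \<open>t\<^sup>2 / 16\<close> cancel.\<close>
  then have "\<kappa>\<^sup>2 \<le> 0" unfolding ss(1) by (simp add: field_simps power2_eq_square)
  then show ?thesis using kc by (simp add: \<kappa>_def)
qed

text \<open>With \<open>h = a\<^sup>\<star> a\<close> and \<open>r = |h|\<close>, the element \<open>c = a (r - h)\<close> satisfies
  \<open>c\<^sup>\<star> c = - r (r - h)\<^sup>2\<close>, so it vanishes and \<open>h = r\<close>.\<close>

theorem pos_star_mul:
  assumes a: "a \<in> car A" shows "pos (a\<^sup>\<star> \<boxdot> a)"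
proof -
  define h where "h = a\<^sup>\<star> \<boxdot> a"
  have h: "sa h" "h \<in> car A" using a by (simp_all add: h_def sa_def st_mul)
  obtain r where r: "pos r" "r \<boxdot> r = h \<boxdot> h"
    "\<And>z. z \<in> car A \<Longrightarrow> z \<boxdot> (h \<boxdot> h) = (h \<boxdot> h) \<boxdot> z \<Longrightarrow> z \<boxdot> r = r \<boxdot> z"
    using pos_sqrt[OF pos_sq[OF h(1)]] by metis
  have rc: "r \<in> car A" "sa r" using r(1) pos_sa by auto
  have hr: "h \<boxdot> r = r \<boxdot> h" using r(3)[of h] h by (simp add: mul_assoc)
  \<comment> \<open>\<open>d\<close> is twice the negative part of \<open>h\<close>. From
    \<open>h h = r r\<close> follow \<open>h d = - r d\<close> and \<open>d d = 2 r d\<close>; the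
    latter turns \<open>r d = 0\<close> into \<open>d = 0\<close> at the end.\<close>
  define d where "d = r \<boxminus> h"
  have d: "sa d" "d \<in> car A" using h rc by (simp_all add: d_def sa_minus)
  have rd: "r \<boxdot> d = d \<boxdot> r" using h rc hr by (simp add: d_def mul_minus minus_mul)
  have hd: "h \<boxdot> d = (-1) \<bullet> (r \<boxdot> d)"
    using h rc hr r(2) by (simp add: d_def mul_minus minus_swap[of "h \<boxdot> h" "r \<boxdot> h"])
  have dd: "d \<boxdot> d = 2 \<bullet> (r \<boxdot> d)"
  proof -
    have "d \<boxdot> d = r \<boxdot> d \<boxminus> h \<boxdot> d" using d h rc by (metis d_def minus_mul)
    then show ?thesis using d rc by (simp add: hd minus_def)
  qed
  obtain s where s: "pos s" "s \<boxdot> s = r"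
    "\<And>z. z \<in> car A \<Longrightarrow> z \<boxdot> r = r \<boxdot> z \<Longrightarrow> z \<boxdot> s = s \<boxdot> z"
    using pos_sqrt[OF r(1)] by metis
  have sc: "s \<in> car A" "sa s" using s(1) pos_sa by auto
  have sd: "s \<boxdot> d = d \<boxdot> s" using s(3)[of d] rd d by simp
  define k where "k = (s \<boxdot> d) \<boxdot> (s \<boxdot> d)"
  have kr: "k = d \<boxdot> (r \<boxdot> d)"
    unfolding k_def s(2)[symmetric] using sd sc d by (simp add: mul_assoc)
  have "(a \<boxdot> d)\<^sup>\<star> \<boxdot> (a \<boxdot> d) = d \<boxdot> (h \<boxdot> d)"
    using a d by (simp add: h_def st_mul sa_st mul_assoc)
  also have "\<dots> = (-1) \<bullet> k" using d rc by (simp add: hd kr)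
  finally have "k = \<^bold>0"
    using star_mul_neg_imp_zer[of "a \<boxdot> d" k] a d pos_sq[OF sa_mul[OF sc(2) d(1) sd]]
    by (simp add: k_def)
  then have "\<parallel>s \<boxdot> d\<parallel>\<^sup>2 = 0"
    using nm_sa_sq[OF sa_mul[OF sc(2) d(1) sd]] by (simp add: k_def)
  then have "s \<boxdot> d = \<^bold>0" using sc d by simp
  then have "r \<boxdot> d = \<^bold>0" using sc d unfolding s(2)[symmetric] by (simp add: mul_assoc)
  then have "\<parallel>d\<parallel>\<^sup>2 = 0" using nm_sa_sq[OF d(1)] dd by simp
  then have "d = \<^bold>0" using d by simp
  then have "r = h" using rc h by (simp add: d_def minus_eq_zer_iff)
  then show ?thesis using r(1) by (simp add: h_def)
qed

lemma pos_conj: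
  assumes "pos a" "x \<in> car A" shows "pos (x\<^sup>\<star> \<boxdot> (a \<boxdot> x))"
proof -
  obtain b where b: "pos b" "b \<boxdot> b = a" using pos_sqrt[OF assms(1)] by metis
  have "(b \<boxdot> x)\<^sup>\<star> \<boxdot> (b \<boxdot> x) = x\<^sup>\<star> \<boxdot> (a \<boxdot> x)"
    using assms(2) b(1) sa_st[OF pos_sa[OF b(1)]] by (simp add: st_mul mul_assoc flip: b(2))
  then show ?thesis using pos_star_mul[of "b \<boxdot> x"] assms(2) b(1) by simp
qed

end

section \<open>Pre-Hilbert modules and their adjointable operators\<close>

text \<open>The form is positive but possibly degenerate and the module need not be complete, so
  lengths of vectors and norms of operators are seminorms.\<close>

locale prehilb = cstar A for A :: "'a calg" +
  fixes M :: "'m set" and madd :: "'m \<Rightarrow> 'm \<Rightarrow> 'm" and mzero :: 'm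
    and msm :: "complex \<Rightarrow> 'm \<Rightarrow> 'm" and act :: "'m \<Rightarrow> 'a \<Rightarrow> 'm" and ip :: "'m \<Rightarrow> 'm \<Rightarrow> 'a"
  assumes mzero_closed [simp]: "mzero \<in> M"
    and madd_closed [simp]: "\<lbrakk>x \<in> M; y \<in> M\<rbrakk> \<Longrightarrow> madd x y \<in> M"
    and msm_closed [simp]: "x \<in> M \<Longrightarrow> msm c x \<in> M"
    and act_closed [simp]: "\<lbrakk>x \<in> M; a \<in> car A\<rbrakk> \<Longrightarrow> act x a \<in> M"
    and madd_assoc: "\<lbrakk>x \<in> M; y \<in> M; z \<in> M\<rbrakk> \<Longrightarrow> madd (madd x y) z = madd x (madd y z)"
    and madd_comm: "\<lbrakk>x \<in> M; y \<in> M\<rbrakk> \<Longrightarrow> madd x y = madd y x"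
    and madd_zero [simp]: "x \<in> M \<Longrightarrow> madd x mzero = x"
    and madd_neg: "x \<in> M \<Longrightarrow> madd x (msm (-1) x) = mzero"
    and msm_madd: "\<lbrakk>x \<in> M; y \<in> M\<rbrakk> \<Longrightarrow> msm c (madd x y) = madd (msm c x) (msm c y)"
    and msm_add: "x \<in> M \<Longrightarrow> msm (c + d) x = madd (msm c x) (msm d x)"
    and msm_mult: "x \<in> M \<Longrightarrow> msm (c * d) x = msm c (msm d x)"
    and msm_one [simp]: "x \<in> M \<Longrightarrow> msm 1 x = x"
    and msm_zero [simp]: "msm c mzero = mzero"
    and ip_closed [simp]: "\<lbrakk>x \<in> M; y \<in> M\<rbrakk> \<Longrightarrow> ip x y \<in> car A"
    and ip_madd: "\<lbrakk>x \<in> M; y \<in> M; z \<in> M\<rbrakk> \<Longrightarrow> ip x (madd y z) = pl A (ip x y) (ip x z)"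
    and ip_msm: "\<lbrakk>x \<in> M; y \<in> M\<rbrakk> \<Longrightarrow> ip x (msm c y) = sm A c (ip x y)"
    and ip_act: "\<lbrakk>x \<in> M; y \<in> M; a \<in> car A\<rbrakk> \<Longrightarrow> ip x (act y a) = mul A (ip x y) a"
    and ip_st: "\<lbrakk>x \<in> M; y \<in> M\<rbrakk> \<Longrightarrow> st A (ip x y) = ip y x"
    and ip_pos: "x \<in> M \<Longrightarrow> pos (ip x x)"
begin

lemma ip_madd_left: "\<lbrakk>x \<in> M; y \<in> M; z \<in> M\<rbrakk> \<Longrightarrow> ip (madd y z) x = ip y x \<boxplus> ip z x"
  by (metis ip_closed ip_madd ip_st madd_closed st_pl)

lemma ip_msm_left: "\<lbrakk>x \<in> M; y \<in> M\<rbrakk> \<Longrightarrow> ip (msm c y) x = cnj c \<bullet> ip y x"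
  by (metis ip_closed ip_msm ip_st msm_closed st_sm)

lemma ip_act_left: "\<lbrakk>x \<in> M; y \<in> M; a \<in> car A\<rbrakk> \<Longrightarrow> ip (act y a) x = a\<^sup>\<star> \<boxdot> ip y x"
  by (metis act_closed ip_act ip_closed ip_st st_mul)

definition mn :: "'m \<Rightarrow> real" where "mn x = sqrt \<parallel>ip x x\<parallel>"

lemma mn_ge_0 [simp]: "x \<in> M \<Longrightarrow> 0 \<le> mn x" by (simp add: mn_def)

lemma mn_sq: "x \<in> M \<Longrightarrow> (mn x)\<^sup>2 = \<parallel>ip x x\<parallel>" by (simp add: mn_def)

text \<open>Expand \<open>ip z z\<close> for \<open>z = x a / s - y\<close> with
  \<open>a = ip x y\<close>. The quadratic term \<open>a\<^sup>\<star> (ip x x) a\<close> is at most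
  \<open>s a\<^sup>\<star> a\<close>, which leaves
  \<open>a\<^sup>\<star> a / s \<le> ip y y\<close>; monotonicity of the norm on the cone
  finishes.\<close>

lemma cauchy_schwarz_aux:
  assumes x: "x \<in> M" and y: "y \<in> M" and s: "s > 0" "\<parallel>ip x x\<parallel> \<le> s"
  shows "\<parallel>ip x y\<parallel>\<^sup>2 \<le> s * \<parallel>ip y y\<parallel>"
proof -
  define a where "a = ip x y"
  have a: "a \<in> car A" "ip y x = a\<^sup>\<star>" using x y by (simp_all add: a_def ip_st)
  define S where "S = complex_of_real (1/s)"
  have cS: "cnj S = S" by (simp add: S_def)
  define z where "z = madd (act x (S \<bullet> a)) (msm (-1) y)"
  define p q where "p = a\<^sup>\<star> \<boxdot> (ip x x \<boxdot> a)" and "q = a\<^sup>\<star> \<boxdot> a"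
  have pq: "p \<in> car A" "q \<in> car A" "ip y y \<in> car A" using a x y by (simp_all add: p_def q_def)
  have "pos (a\<^sup>\<star> \<boxdot> ((real_un s \<boxminus> ip x x) \<boxdot> a))"
    using pos_nm_minus[OF pos_sa[OF ip_pos[OF x]] s(2)] a by (intro pos_conj)
  moreover have "a\<^sup>\<star> \<boxdot> ((real_un s \<boxminus> ip x x) \<boxdot> a) = complex_of_real s \<bullet> q \<boxminus> p"
    using a x by (simp add: minus_mul mul_minus p_def q_def)
  ultimately have "pos (complex_of_real s \<bullet> q \<boxminus> p)" by simp
  then have "pos (complex_of_real (1/s^2) \<bullet> (complex_of_real s \<bullet> q \<boxminus> p))"
    by (rule pos_sm) simp
  moreover have "pos (ip z z)" using ip_pos a x y by (simp add: z_def)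
  moreover have "ip z z = ((S * S) \<bullet> p \<boxplus> (-S) \<bullet> q) \<boxplus> ((-S) \<bullet> q \<boxplus> ip y y)"
  proof -
    have "ip z z = (ip (act x (S \<bullet> a)) (act x (S \<bullet> a)) \<boxplus> (-1) \<bullet> ip (act x (S \<bullet> a)) y)
        \<boxplus> ((-1) \<bullet> ip y (act x (S \<bullet> a)) \<boxplus> ip y y)"
      using a x y pq by (simp add: z_def ip_madd ip_madd_left ip_msm ip_msm_left sm_pl)
         (simp add: pl_ac)
    then show ?thesis
      using a x y pq by (simp add: ip_act ip_act_left st_sm cS p_def q_def mul_assoc)
        (simp add: a_def)
  qed
  ultimately have "pos (complex_of_real (1/s^2) \<bullet> (complex_of_real s \<bullet> q \<boxminus> p) \<boxplus>
     (((S * S) \<bullet> p \<boxplus> (-S) \<bullet> q) \<boxplus> ((-S) \<bullet> q \<boxplus> ip y y)))"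
    using pos_pl by simp
  also have "complex_of_real (1/s^2) \<bullet> (complex_of_real s \<bullet> q \<boxminus> p) \<boxplus>
     (((S * S) \<bullet> p \<boxplus> (-S) \<bullet> q) \<boxplus> ((-S) \<bullet> q \<boxplus> ip y y)) = ip y y \<boxminus> complex_of_real (1/s) \<bullet> q"
    unfolding minus_def
    by (rule linear_coordinates[of p q "ip y y" p])
      (use pq s in \<open>simp_all add: S_def power2_eq_square\<close>)
  finally have le: "pos (ip y y \<boxminus> complex_of_real (1/s) \<bullet> q)" .
  have "pos (complex_of_real (1/s) \<bullet> q)"
    using pos_star_mul[OF a(1)] s by (intro pos_sm) (auto simp: q_def)
  from pos_nm_mono[OF this le pos_sa[OF ip_pos[OF y]]]
  have "(1/s) * \<parallel>a\<parallel>\<^sup>2 \<le> \<parallel>ip y y\<parallel>"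
    using nm_cstar[OF a(1)] pq s by (simp add: q_def norm_divide)
  then show ?thesis using s by (simp add: a_def field_simps)
qed

lemma cauchy_schwarz:
  assumes x: "x \<in> M" and y: "y \<in> M"
  shows "\<parallel>ip x y\<parallel> \<le> mn x * mn y"
proof -
  have "\<parallel>ip x y\<parallel>\<^sup>2 \<le> \<parallel>ip x x\<parallel> * \<parallel>ip y y\<parallel>"
  proof (rule field_le_epsilon)
    fix e :: real assume e: "e > 0"
    \<comment> \<open>The extra summand keeps \<open>s\<close> positive when \<open>x\<close> is a
      null vector, and its product with the norm of \<open>ip y y\<close> stays below
      \<open>e\<close>.\<close>
    define s where "s = \<parallel>ip x x\<parallel> + e / (\<parallel>ip y y\<parallel> + 1)"
    have y0: "\<parallel>ip y y\<parallel> \<ge> 0" and x0: "\<parallel>ip x x\<parallel> \<ge> 0" using x y by simp_all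
    have d: "e / (\<parallel>ip y y\<parallel> + 1) > 0" using e y0 by simp
    have "\<parallel>ip x y\<parallel>\<^sup>2 \<le> s * \<parallel>ip y y\<parallel>"
      using d x0 by (intro cauchy_schwarz_aux x y) (simp_all add: s_def)
    also have "\<dots> \<le> \<parallel>ip x x\<parallel> * \<parallel>ip y y\<parallel> + e"
      using e y0 by (simp add: s_def field_simps)
    finally show "\<parallel>ip x y\<parallel>\<^sup>2 \<le> \<parallel>ip x x\<parallel> * \<parallel>ip y y\<parallel> + e" .
  qed
  also have "\<dots> = (mn x * mn y)\<^sup>2" using x y by (simp add: power_mult_distrib mn_sq)
  finally show ?thesis by (rule power2_le_imp_le) (use x y in simp)
qed

lemma mn_madd:
  assumes x: "x \<in> M" and y: "y \<in> M"
  shows "mn (madd x y) \<le> mn x + mn y"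
proof -
  have "(mn (madd x y))\<^sup>2 = \<parallel>(ip x x \<boxplus> ip x y) \<boxplus> (ip y x \<boxplus> ip y y)\<parallel>"
    using x y by (simp add: mn_sq ip_madd ip_madd_left) (simp add: pl_ac)
  also have "\<dots> \<le> (\<parallel>ip x x\<parallel> + \<parallel>ip x y\<parallel>) + (\<parallel>ip y x\<parallel> + \<parallel>ip y y\<parallel>)"
    using x y by (intro order_trans[OF nm_triangle] add_mono nm_triangle) simp_all
  also have "\<dots> \<le> (mn x + mn y)\<^sup>2"
    using cauchy_schwarz[OF x y] cauchy_schwarz[OF y x] mn_sq[OF x] mn_sq[OF y]
    unfolding power2_sum mult.commute[of "mn y" "mn x"] by linarith
  finally show ?thesis by (rule power2_le_imp_le) (use x y in simp)
qed

lemma mn_msm: "x \<in> M \<Longrightarrow> mn (msm c x) = cmod c * mn x"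
  by (simp add: mn_def ip_msm ip_msm_left norm_mult real_sqrt_mult)

lemma mn_mzero [simp]: "mn mzero = 0"
  using mn_msm[of mzero 0] by simp

lemma madd_mzero_left [simp]: "x \<in> M \<Longrightarrow> madd mzero x = x"
  by (metis madd_comm madd_zero mzero_closed)

section \<open>Adjointable operators and the operator seminorm\<close>

definition lin :: "('m \<Rightarrow> 'm) \<Rightarrow> bool" where
  "lin T \<longleftrightarrow> (\<forall>x\<in>M. T x \<in> M) \<and> (\<forall>x\<in>M. \<forall>y\<in>M. T (madd x y) = madd (T x) (T y)) \<and>
    (\<forall>x\<in>M. \<forall>c. T (msm c x) = msm c (T x)) \<and> (\<forall>x. x \<notin> M \<longrightarrow> T x = mzero)"

lemma lin_mzero:
  assumes "lin T" shows "T mzero = mzero"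
proof -
  have "T (msm 0 mzero) = msm 0 (T mzero)" using assms mzero_closed unfolding lin_def by metis
  moreover have "msm 0 y = mzero" if "y \<in> M" for y
    using msm_add[OF that, of 1 "-1"] that by (simp add: madd_neg)
  ultimately show ?thesis using assms by (simp add: lin_def)
qed

lemma lin_closed: "lin T \<Longrightarrow> T x \<in> M"
  unfolding lin_def by (cases "x \<in> M") auto

definition adj :: "('m \<Rightarrow> 'm) \<Rightarrow> ('m \<Rightarrow> 'm) \<Rightarrow> bool" where
  "adj T S \<longleftrightarrow> (\<forall>x\<in>M. \<forall>y\<in>M. ip (T x) y = ip x (S y))"

definition bdd :: "('m \<Rightarrow> 'm) \<Rightarrow> bool" where
  "bdd T \<longleftrightarrow> (\<exists>K\<ge>0. \<forall>x\<in>M. mn (T x) \<le> K * mn x)"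

definition opn :: "('m \<Rightarrow> 'm) \<Rightarrow> real" where
  "opn T = Inf {K. K \<ge> 0 \<and> (\<forall>x\<in>M. mn (T x) \<le> K * mn x)}"

lemma opn_le: "\<lbrakk>K \<ge> 0; \<And>x. x \<in> M \<Longrightarrow> mn (T x) \<le> K * mn x\<rbrakk> \<Longrightarrow> opn T \<le> K"
  unfolding opn_def by (intro cInf_lower bdd_belowI[of _ 0]) auto

lemma opn_bound:
  assumes "bdd T" "x \<in> M" shows "mn (T x) \<le> opn T * mn x"
proof (cases "mn x = 0")
  case True
  then show ?thesis using assms unfolding bdd_def by auto
next
  case False
  then have pos: "mn x > 0" using assms by (simp add: less_le)
  have "mn (T x) / mn x \<le> opn T"
    unfolding opn_def
  proof (rule cInf_greatest)
    show "{K. K \<ge> 0 \<and> (\<forall>x\<in>M. mn (T x) \<le> K * mn x)} \<noteq> {}" using assms unfolding bdd_def by auto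
  qed (use pos assms in \<open>auto simp: field_simps\<close>)
  then show ?thesis using pos by (simp add: field_simps)
qed

lemma opn_ge_0: "bdd T \<Longrightarrow> 0 \<le> opn T"
  unfolding opn_def bdd_def by (intro cInf_greatest) auto

text \<open>Cauchy-Schwarz for \<open>ip (T (S y)) y\<close>, which equals
  \<open>ip (S y) (S y)\<close>. Therefore the carrier of \<open>opalg\<close> can demand
  boundedness of the first component alone and still be closed under the star.\<close>

lemma bdd_adj:
  assumes "bdd T" "lin T" "lin S" "adj T S" shows "bdd S"
proof -
  obtain K where K: "K \<ge> 0" "\<And>x. x \<in> M \<Longrightarrow> mn (T x) \<le> K * mn x"
    using assms(1) unfolding bdd_def by blast
  have "mn (S y) \<le> K * mn y" if y: "y \<in> M" for y
  proof (cases "mn (S y) = 0")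
    case False
    have Sy: "S y \<in> M" using lin_closed[OF assms(3)] .
    have "mn (S y) * mn (S y) = \<parallel>ip (T (S y)) y\<parallel>"
      using assms(4) y Sy mn_sq[OF Sy] by (simp add: adj_def power2_eq_square)
    also have "\<dots> \<le> mn (T (S y)) * mn y"
      using cauchy_schwarz y lin_closed[OF assms(2)] by blast
    also have "\<dots> \<le> (K * mn (S y)) * mn y"
      using K(2)[OF Sy] y by (simp add: mult_right_mono)
    finally have "mn (S y) * mn (S y) \<le> (K * mn y) * mn (S y)" by (simp add: algebra_simps)
    then show ?thesis using False Sy by (simp add: mult_le_cancel_right less_le)
  qed (use y K in simp)
  then show ?thesis unfolding bdd_def using K(1) by blast
qed

lemma adj_sym:
  assumes "adj T S" "lin T" "lin S" shows "adj S T"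
  unfolding adj_def
proof (intro ballI)
  fix x y assume xy: "x \<in> M" "y \<in> M"
  have "ip (S x) y = (ip y (S x))\<^sup>\<star>" using xy lin_closed[OF assms(3)] by (simp add: ip_st)
  also have "\<dots> = (ip (T y) x)\<^sup>\<star>" using assms(1) xy by (simp add: adj_def)
  finally show "ip (S x) y = ip x (T y)" using xy lin_closed[OF assms(2)] by (simp add: ip_st)
qed

text \<open>Adjoints are unique only up to vectors of norm zero, so operators are paired with a
  chosen adjoint; they vanish outside \<open>M\<close> to make the algebra laws hold on the nose.\<close>

definition opalg :: "(('m \<Rightarrow> 'm) \<times> ('m \<Rightarrow> 'm)) calg" where
  "opalg = \<lparr>car = {(T, S). lin T \<and> lin S \<and> adj T S \<and> bdd T},
     zer = (\<lambda>_. mzero, \<lambda>_. mzero),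
     un = (\<lambda>x. if x \<in> M then x else mzero, \<lambda>x. if x \<in> M then x else mzero),
     pl = (\<lambda>(T, S) (T', S'). (\<lambda>x. madd (T x) (T' x), \<lambda>x. madd (S x) (S' x))),
     mul = (\<lambda>(T, S) (T', S'). (\<lambda>x. T (T' x), \<lambda>x. S' (S x))),
     sm = (\<lambda>c (T, S). (\<lambda>x. msm c (T x), \<lambda>x. msm (cnj c) (S x))),
     st = (\<lambda>(T, S). (S, T)),
     nm = (\<lambda>(T, S). opn T)\<rparr>"

lemma lin_madd: "lin T \<Longrightarrow> x \<in> M \<Longrightarrow> y \<in> M \<Longrightarrow> T (madd x y) = madd (T x) (T y)"
  and lin_msm: "lin T \<Longrightarrow> x \<in> M \<Longrightarrow> T (msm c x) = msm c (T x)"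
  and lin_outside: "lin T \<Longrightarrow> x \<notin> M \<Longrightarrow> T x = mzero"
  by (simp_all add: lin_def)

lemma lin_id: "lin (\<lambda>x. if x \<in> M then x else mzero)"
  by (simp add: lin_def)

lemma lin_zero: "lin (\<lambda>x. mzero)"
  by (simp add: lin_def)

lemma lin_add: "lin T \<Longrightarrow> lin S \<Longrightarrow> lin (\<lambda>x. madd (T x) (S x))"
  using madd_assoc madd_comm by (auto simp: lin_def msm_madd)

lemma lin_comp: "lin T \<Longrightarrow> lin S \<Longrightarrow> lin (\<lambda>x. T (S x))"
  by (auto simp: lin_def lin_mzero)

lemma lin_scale: "lin T \<Longrightarrow> lin (\<lambda>x. msm c (T x))"
  by (auto simp: lin_def msm_madd msm_mult[symmetric] mult.commute)

lemma bdd_add: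
  assumes "bdd T" "bdd S" "lin T" "lin S"
  shows "bdd (\<lambda>x. madd (T x) (S x))" "opn (\<lambda>x. madd (T x) (S x)) \<le> opn T + opn S"
proof -
  have le: "mn (madd (T x) (S x)) \<le> (opn T + opn S) * mn x" if "x \<in> M" for x
    using mn_madd[OF lin_closed[OF assms(3)] lin_closed[OF assms(4)], of x x]
      opn_bound[OF assms(1) that] opn_bound[OF assms(2) that] by (simp add: algebra_simps)
  show "bdd (\<lambda>x. madd (T x) (S x))" unfolding bdd_def
    using le opn_ge_0 assms by (intro exI[of _ "opn T + opn S"]) auto
  show "opn (\<lambda>x. madd (T x) (S x)) \<le> opn T + opn S"
    using le opn_ge_0 assms by (intro opn_le) auto
qed

lemma bdd_comp:
  assumes "bdd T" "bdd S" "lin T" "lin S"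
  shows "bdd (\<lambda>x. T (S x))" "opn (\<lambda>x. T (S x)) \<le> opn T * opn S"
proof -
  have le: "mn (T (S x)) \<le> (opn T * opn S) * mn x" if "x \<in> M" for x
    using opn_bound[OF assms(1) lin_closed[OF assms(4)], of x]
      mult_left_mono[OF opn_bound[OF assms(2) that] opn_ge_0[OF assms(1)]] by (simp add: algebra_simps)
  show "bdd (\<lambda>x. T (S x))" unfolding bdd_def
    using le opn_ge_0 assms by (intro exI[of _ "opn T * opn S"]) auto
  show "opn (\<lambda>x. T (S x)) \<le> opn T * opn S"
    using le opn_ge_0 assms by (intro opn_le) auto
qed

lemma bdd_scale:
  assumes "bdd T" "lin T"
  shows "bdd (\<lambda>x. msm c (T x))" "opn (\<lambda>x. msm c (T x)) = cmod c * opn T"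
proof -
  have le: "bdd (\<lambda>x. msm c (T x)) \<and> opn (\<lambda>x. msm c (T x)) \<le> cmod c * opn T" if "bdd T" "lin T" for c T
  proof -
    have le: "mn (msm c (T x)) \<le> (cmod c * opn T) * mn x" if "x \<in> M" for x
      using mult_left_mono[OF opn_bound[OF \<open>bdd T\<close> that], of "cmod c"] lin_closed[OF \<open>lin T\<close>]
      by (simp add: mn_msm algebra_simps)
    then show ?thesis unfolding bdd_def
      using opn_ge_0[OF \<open>bdd T\<close>] opn_le[of "cmod c * opn T" "\<lambda>x. msm c (T x)"]
      by (intro conjI exI[of _ "cmod c * opn T"]) auto
  qed
  show "bdd (\<lambda>x. msm c (T x))" using le assms by blast
  show "opn (\<lambda>x. msm c (T x)) = cmod c * opn T"
  proof (cases "c = 0")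
    case True
    then show ?thesis using le[OF assms, of c] opn_ge_0[of "\<lambda>x. msm c (T x)"] by auto
  next
    case False
    \<comment> \<open>The reverse inequality is the first one for the scalar \<open>1/c\<close> and
      the operator \<open>c T\<close>.\<close>
    have "opn (\<lambda>x. msm (1/c) (msm c (T x))) \<le> cmod (1/c) * opn (\<lambda>x. msm c (T x))"
      using le[of "\<lambda>x. msm c (T x)"] le assms lin_scale by blast
    moreover have "(\<lambda>x. msm (1/c) (msm c (T x))) = T"
      using False lin_closed[OF assms(2)] by (simp add: fun_eq_iff flip: msm_mult)
    ultimately show ?thesis
      using le[OF assms, of c] False by (simp add: norm_divide field_simps)
  qed
qed

text \<open>The lower bound comes from \<open>ip (T x) (T x) = ip x (S (T x))\<close> and
  Cauchy-Schwarz. Applied to both \<open>T\<close> and \<open>S\<close> it also gives equal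
  seminorms for an operator and its adjoint, and submultiplicativity then yields the upper
  bound.\<close>

lemma opn_adj:
  assumes "lin T" "lin S" "adj T S" "bdd T"
  shows "opn (\<lambda>x. S (T x)) = (opn T)\<^sup>2"
proof -
  have sq: "(opn T)\<^sup>2 \<le> opn (\<lambda>x. S (T x))"
    if *: "lin T" "lin S" "adj T S" "bdd T" for T S
  proof -
    have bST: "bdd (\<lambda>x. S (T x))" using bdd_comp bdd_adj * by blast
    have "mn (T x) \<le> sqrt (opn (\<lambda>x. S (T x))) * mn x" if x: "x \<in> M" for x
    proof -
      have c: "T x \<in> M" "S (T x) \<in> M" using * lin_closed by blast+
      have "(mn (T x))\<^sup>2 = \<parallel>ip x (S (T x))\<parallel>"
        using c x *(3) by (simp add: mn_sq adj_def)
      also have "\<dots> \<le> mn x * (opn (\<lambda>x. S (T x)) * mn x)"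
        using cauchy_schwarz[OF x c(2)] mult_left_mono[OF opn_bound[OF bST x], of "mn x"] x by simp
      also have "\<dots> = (sqrt (opn (\<lambda>x. S (T x))) * mn x)\<^sup>2"
        using opn_ge_0[OF bST] by (simp add: power_mult_distrib) (simp add: power2_eq_square)
      finally show ?thesis by (rule power2_le_imp_le) (use x opn_ge_0[OF bST] in simp)
    qed
    then have "opn T \<le> sqrt (opn (\<lambda>x. S (T x)))"
      using opn_ge_0[OF bST] by (intro opn_le) auto
    then show ?thesis using opn_ge_0[OF bST] opn_ge_0[OF *(4)] by (metis real_sqrt_pow2 power_mono)
  qed
  have le: "opn T \<le> opn S" if *: "lin T" "lin S" "adj T S" "bdd T" for T S
  proof (cases "opn T = 0")
    case False
    have "(opn T)\<^sup>2 \<le> opn S * opn T"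
      using sq[OF *] bdd_comp(2)[of S T] bdd_adj * by fastforce
    then show ?thesis using False opn_ge_0[OF *(4)] by (simp add: power2_eq_square mult_le_cancel_right)
  qed (use opn_ge_0 bdd_adj * in auto)
  have "opn S = opn T"
    using le[OF assms] le[OF assms(2,1) adj_sym] bdd_adj assms by fastforce
  then have "opn (\<lambda>x. S (T x)) \<le> (opn T)\<^sup>2"
    using bdd_comp(2)[of S T] bdd_adj assms by (simp add: power2_eq_square)
  then show ?thesis using sq[OF assms] by simp
qed

lemma opalg_pre_cstar: "pre_cstar opalg"
proof
  have bd: "bdd S" if "lin T" "lin S" "adj T S" "bdd T" for T S using bdd_adj that by blast
  have id: "adj (\<lambda>x. if x \<in> M then x else mzero) (\<lambda>x. if x \<in> M then x else mzero)"
    "bdd (\<lambda>x. if x \<in> M then x else mzero)"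
    by (auto simp: adj_def bdd_def intro!: exI[of _ 1])
  have z: "adj (\<lambda>x. mzero) (\<lambda>x. mzero)"
    using ip_msm[of _ mzero 0] ip_msm_left[of _ mzero 0] by (auto simp: adj_def)
  have z': "bdd (\<lambda>x. mzero)" by (auto simp: bdd_def)
  show "zer opalg \<in> car opalg" by (simp add: opalg_def lin_zero z z')
  show "un opalg \<in> car opalg" by (simp add: opalg_def lin_id id)
  fix a b d c k
  show "a \<in> car opalg \<Longrightarrow> b \<in> car opalg \<Longrightarrow> pl opalg a b \<in> car opalg"
    by (auto simp: opalg_def lin_add bdd_add adj_def ip_madd ip_madd_left lin_closed)
  show "a \<in> car opalg \<Longrightarrow> b \<in> car opalg \<Longrightarrow> mul opalg a b \<in> car opalg"
    by (auto simp: opalg_def lin_comp bdd_comp adj_def lin_closed)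
  show "a \<in> car opalg \<Longrightarrow> st opalg a \<in> car opalg"
    by (auto simp: opalg_def adj_sym bd)
  show "a \<in> car opalg \<Longrightarrow> sm opalg c a \<in> car opalg"
    by (auto simp: opalg_def lin_scale bdd_scale adj_def ip_msm ip_msm_left lin_closed)
  show "a \<in> car opalg \<Longrightarrow> b \<in> car opalg \<Longrightarrow> d \<in> car opalg \<Longrightarrow>
      pl opalg (pl opalg a b) d = pl opalg a (pl opalg b d)"
    by (auto simp: opalg_def lin_closed madd_assoc)
  show "a \<in> car opalg \<Longrightarrow> b \<in> car opalg \<Longrightarrow> pl opalg a b = pl opalg b a"
    using madd_comm by (auto simp: opalg_def lin_closed fun_eq_iff)
  show "a \<in> car opalg \<Longrightarrow> pl opalg a (zer opalg) = a"
    by (auto simp: opalg_def lin_closed)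
  show "a \<in> car opalg \<Longrightarrow> \<exists>b\<in>car opalg. pl opalg a b = zer opalg"
  proof -
    assume a: "a \<in> car opalg"
    then have "sm opalg (-1) a \<in> car opalg"
      by (auto simp: opalg_def lin_scale bdd_scale adj_def ip_msm ip_msm_left lin_closed)
    moreover have "pl opalg a (sm opalg (-1) a) = zer opalg"
      using a by (auto simp: opalg_def lin_closed madd_neg)
    ultimately show ?thesis by blast
  qed
  show "a \<in> car opalg \<Longrightarrow> b \<in> car opalg \<Longrightarrow>
      sm opalg c (pl opalg a b) = pl opalg (sm opalg c a) (sm opalg c b)"
    by (auto simp: opalg_def lin_closed msm_madd)
  show "a \<in> car opalg \<Longrightarrow> sm opalg (c + k) a = pl opalg (sm opalg c a) (sm opalg k a)"
    by (auto simp: opalg_def lin_closed msm_add)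
  show "a \<in> car opalg \<Longrightarrow> sm opalg (c * k) a = sm opalg c (sm opalg k a)"
    by (auto simp: opalg_def lin_closed msm_mult)
  show "a \<in> car opalg \<Longrightarrow> sm opalg 1 a = a"
    by (auto simp: opalg_def lin_closed)
  show "a \<in> car opalg \<Longrightarrow> b \<in> car opalg \<Longrightarrow> d \<in> car opalg \<Longrightarrow>
      mul opalg (mul opalg a b) d = mul opalg a (mul opalg b d)"
    by (auto simp: opalg_def)
  show "a \<in> car opalg \<Longrightarrow> b \<in> car opalg \<Longrightarrow> d \<in> car opalg \<Longrightarrow>
      mul opalg a (pl opalg b d) = pl opalg (mul opalg a b) (mul opalg a d)"
    by (auto simp: opalg_def lin_closed lin_madd)
  show "a \<in> car opalg \<Longrightarrow> b \<in> car opalg \<Longrightarrow> d \<in> car opalg \<Longrightarrow>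
      mul opalg (pl opalg a b) d = pl opalg (mul opalg a d) (mul opalg b d)"
    by (auto simp: opalg_def lin_closed lin_madd)
  show "a \<in> car opalg \<Longrightarrow> b \<in> car opalg \<Longrightarrow>
      sm opalg c (mul opalg a b) = mul opalg (sm opalg c a) b"
    by (auto simp: opalg_def lin_closed lin_msm)
  show "a \<in> car opalg \<Longrightarrow> b \<in> car opalg \<Longrightarrow>
      sm opalg c (mul opalg a b) = mul opalg a (sm opalg c b)"
    by (auto simp: opalg_def lin_closed lin_msm)
  show "a \<in> car opalg \<Longrightarrow> mul opalg (un opalg) a = a"
    by (auto simp: opalg_def lin_closed lin_outside lin_mzero fun_eq_iff)
  show "a \<in> car opalg \<Longrightarrow> mul opalg a (un opalg) = a"
    by (auto simp: opalg_def lin_closed lin_outside lin_mzero fun_eq_iff)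
  show "a \<in> car opalg \<Longrightarrow> st opalg (st opalg a) = a"
    by (auto simp: opalg_def)
  show "a \<in> car opalg \<Longrightarrow> b \<in> car opalg \<Longrightarrow>
      st opalg (pl opalg a b) = pl opalg (st opalg a) (st opalg b)"
    by (auto simp: opalg_def)
  show "a \<in> car opalg \<Longrightarrow> b \<in> car opalg \<Longrightarrow>
      st opalg (mul opalg a b) = mul opalg (st opalg b) (st opalg a)"
    by (auto simp: opalg_def)
  show "a \<in> car opalg \<Longrightarrow> st opalg (sm opalg c a) = sm opalg (cnj c) (st opalg a)"
    by (auto simp: opalg_def)
  show "a \<in> car opalg \<Longrightarrow> 0 \<le> nm opalg a"
    by (auto simp: opalg_def opn_ge_0)
  show "a \<in> car opalg \<Longrightarrow> b \<in> car opalg \<Longrightarrow> nm opalg (pl opalg a b) \<le> nm opalg a + nm opalg b"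
    by (auto simp: opalg_def bdd_add)
  show "a \<in> car opalg \<Longrightarrow> nm opalg (sm opalg c a) = cmod c * nm opalg a"
    by (auto simp: opalg_def bdd_scale)
  show "a \<in> car opalg \<Longrightarrow> b \<in> car opalg \<Longrightarrow> nm opalg (mul opalg a b) \<le> nm opalg a * nm opalg b"
    by (auto simp: opalg_def bdd_comp)
  show "a \<in> car opalg \<Longrightarrow> nm opalg (mul opalg (st opalg a) a) = (nm opalg a)\<^sup>2"
    by (auto simp: opalg_def opn_adj)
qed

end

section \<open>Completion of a pre-C*-algebra\<close>

context pre_cstar
begin

definition cau :: "(nat \<Rightarrow> 'a) set" where
  "cau = {s. (\<forall>n. s n \<in> car A) \<and> (\<forall>e>0. \<exists>N. \<forall>m\<ge>N. \<forall>n\<ge>N. \<parallel>s m \<boxminus> s n\<parallel> < e)}"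

lemma cau_car: "s \<in> cau \<Longrightarrow> s n \<in> car A" by (simp add: cau_def)

lemma cauD: "s \<in> cau \<Longrightarrow> e > 0 \<Longrightarrow> \<exists>N. \<forall>m\<ge>N. \<forall>n\<ge>N. \<parallel>s m \<boxminus> s n\<parallel> < e"
  unfolding cau_def by blast

lemma cau_const: "a \<in> car A \<Longrightarrow> (\<lambda>_. a) \<in> cau" by (simp add: cau_def)

text \<open>The common estimate behind the closure of Cauchy sequences under the algebra operations;
  for products the constant \<open>C\<close> is a bound for the factors.\<close>

lemma cau_dominated:
  assumes "\<And>n. u n \<in> car A" "s \<in> cau" "t \<in> cau"
    and dom: "\<And>m n. \<parallel>u m \<boxminus> u n\<parallel> \<le> C * (\<parallel>s m \<boxminus> s n\<parallel> + \<parallel>t m \<boxminus> t n\<parallel>)"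
  shows "u \<in> cau"
  unfolding cau_def
proof (intro CollectI conjI allI impI)
  fix e :: real assume e: "e > 0"
  define K where "K = \<bar>C\<bar> + 1"
  have K: "K > 0" "C \<le> K" by (simp_all add: K_def)
  define d where "d = e / (2 * K)"
  have d: "d > 0" using e K by (simp add: d_def)
  obtain N where N: "\<And>m n. m \<ge> N \<Longrightarrow> n \<ge> N \<Longrightarrow> \<parallel>s m \<boxminus> s n\<parallel> < d"
    using cauD[OF assms(2) d] by blast
  obtain N' where N': "\<And>m n. m \<ge> N' \<Longrightarrow> n \<ge> N' \<Longrightarrow> \<parallel>t m \<boxminus> t n\<parallel> < d"
    using cauD[OF assms(3) d] by blast
  have "\<parallel>u m \<boxminus> u n\<parallel> < e" if "m \<ge> max N N'" "n \<ge> max N N'" for m n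
  proof -
    let ?r = "\<parallel>s m \<boxminus> s n\<parallel> + \<parallel>t m \<boxminus> t n\<parallel>"
    have r: "?r < 2 * d" "0 \<le> ?r" using N[of m n] N'[of m n] that cau_car[OF assms(2)] cau_car[OF assms(3)] by auto
    have "C * ?r \<le> K * ?r" using r K by (intro mult_right_mono) auto
    also have "\<dots> < K * (2 * d)" using r K by (intro mult_strict_left_mono) auto
    also have "\<dots> = e" using K by (simp add: d_def)
    finally show ?thesis using dom[of m n] by simp
  qed
  then show "\<exists>N. \<forall>m\<ge>N. \<forall>n\<ge>N. \<parallel>u m \<boxminus> u n\<parallel> < e" by blast
qed (fact assms(1))

lemma cau_pl: "s \<in> cau \<Longrightarrow> t \<in> cau \<Longrightarrow> (\<lambda>n. s n \<boxplus> t n) \<in> cau"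
  by (rule cau_dominated[of _ s t 1])
    (use cau_car[of s] cau_car[of t] in \<open>simp_all add: minus_pl_minus nm_triangle\<close>)

lemma cau_sm: "s \<in> cau \<Longrightarrow> (\<lambda>n. c \<bullet> s n) \<in> cau"
  by (rule cau_dominated[of _ s s "cmod c"])
    (use cau_car[of s] in \<open>simp_all flip: sm_minus add: mult_left_mono\<close>)

lemma cau_st: "s \<in> cau \<Longrightarrow> (\<lambda>n. (s n)\<^sup>\<star>) \<in> cau"
  by (rule cau_dominated[of _ s s 1]) (use cau_car[of s] in \<open>simp_all flip: st_minus\<close>)

lemma cau_minus: "s \<in> cau \<Longrightarrow> t \<in> cau \<Longrightarrow> (\<lambda>n. s n \<boxminus> t n) \<in> cau"
  unfolding minus_def by (intro cau_pl cau_sm)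

lemma cau_nm_tendsto:
  assumes "s \<in> cau" shows "(\<lambda>n. \<parallel>s n\<parallel>) \<longlonglongrightarrow> lim (\<lambda>n. \<parallel>s n\<parallel>)"
proof -
  have "Cauchy (\<lambda>n. \<parallel>s n\<parallel>)"
    unfolding Cauchy_def dist_real_def
  proof (intro allI impI)
    fix e :: real assume "e > 0"
    then obtain N where "\<And>m n. m \<ge> N \<Longrightarrow> n \<ge> N \<Longrightarrow> \<parallel>s m \<boxminus> s n\<parallel> < e"
      using cauD[OF assms] by blast
    then show "\<exists>M. \<forall>m\<ge>M. \<forall>n\<ge>M. \<bar>\<parallel>s m\<parallel> - \<parallel>s n\<parallel>\<bar> < e"
      using nm_diff_le cau_car[OF assms] by (meson le_less_trans)
  qed
  then show ?thesis by (simp add: Cauchy_convergent_iff convergent_LIMSEQ_iff)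
qed

lemma cau_bounded:
  assumes "s \<in> cau" obtains K where "K \<ge> 0" "\<And>n. \<parallel>s n\<parallel> \<le> K"
proof -
  have "Bseq (\<lambda>n. \<parallel>s n\<parallel>)"
    using cau_nm_tendsto[OF assms] convergent_imp_Bseq convergentI by blast
  then obtain K where "K > 0" "\<And>n. norm \<parallel>s n\<parallel> \<le> K" unfolding Bseq_def by blast
  then show thesis using that[of K] by (simp add: abs_le_iff)
qed

lemma cau_mul:
  assumes "s \<in> cau" "t \<in> cau" shows "(\<lambda>n. s n \<boxdot> t n) \<in> cau"
proof -
  note c = cau_car[OF assms(1)] cau_car[OF assms(2)]
  obtain K where K: "K \<ge> 0" "\<And>n. \<parallel>s n\<parallel> \<le> K" using cau_bounded[OF assms(1)] by blast
  obtain L where L: "L \<ge> 0" "\<And>n. \<parallel>t n\<parallel> \<le> L" using cau_bounded[OF assms(2)] by blast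
  show ?thesis
  proof (rule cau_dominated[OF _ assms, of _ "K + L"])
    fix m n
    have "\<parallel>s m \<boxdot> t m \<boxminus> s n \<boxdot> t n\<parallel> \<le> \<parallel>s m \<boxminus> s n\<parallel> * \<parallel>t m\<parallel> + \<parallel>s n\<parallel> * \<parallel>t m \<boxminus> t n\<parallel>"
      unfolding mul_minus_mul[OF c c]
      using c by (intro order_trans[OF nm_triangle] add_mono nm_mul) simp_all
    also have "\<dots> \<le> \<parallel>s m \<boxminus> s n\<parallel> * (K + L) + (K + L) * \<parallel>t m \<boxminus> t n\<parallel>"
      using K(1) L(1) K(2)[of n] L(2)[of m] c
      by (intro add_mono mult_left_mono mult_right_mono) simp_all
    finally show "\<parallel>s m \<boxdot> t m \<boxminus> s n \<boxdot> t n\<parallel> \<le> (K + L) * (\<parallel>s m \<boxminus> s n\<parallel> + \<parallel>t m \<boxminus> t n\<parallel>)"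
      by (simp add: algebra_simps)
  qed (use c in simp)
qed

definition seqalg :: "(nat \<Rightarrow> 'a) calg" where
  "seqalg = \<lparr>car = cau, zer = (\<lambda>_. \<^bold>0), un = (\<lambda>_. \<^bold>1), pl = (\<lambda>s t n. s n \<boxplus> t n),
     mul = (\<lambda>s t n. s n \<boxdot> t n), sm = (\<lambda>c s n. c \<bullet> s n), st = (\<lambda>s n. (s n)\<^sup>\<star>),
     nm = (\<lambda>s. lim (\<lambda>n. \<parallel>s n\<parallel>))\<rparr>"

lemma seqalg_simps [simp]:
  "car seqalg = cau" "zer seqalg = (\<lambda>_. \<^bold>0)" "un seqalg = (\<lambda>_. \<^bold>1)"
  "pl seqalg s t = (\<lambda>n. s n \<boxplus> t n)" "mul seqalg s t = (\<lambda>n. s n \<boxdot> t n)"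
  "sm seqalg c s = (\<lambda>n. c \<bullet> s n)" "st seqalg s = (\<lambda>n. (s n)\<^sup>\<star>)"
  by (simp_all add: seqalg_def)

lemma minus_seqalg [simp]: "minus seqalg s t = (\<lambda>n. s n \<boxminus> t n)"
  by (simp add: minus_def)

lemma seqalg_nm: "s \<in> cau \<Longrightarrow> (\<lambda>n. \<parallel>s n\<parallel>) \<longlonglongrightarrow> nm seqalg s"
  using cau_nm_tendsto by (simp add: seqalg_def)

lemma seqalg_nmI: "(\<lambda>n. \<parallel>s n\<parallel>) \<longlonglongrightarrow> l \<Longrightarrow> nm seqalg s = l"
  by (simp add: seqalg_def limI)

lemma seqalg_nm_le: "s \<in> cau \<Longrightarrow> (\<And>n. n \<ge> N \<Longrightarrow> \<parallel>s n\<parallel> \<le> e) \<Longrightarrow> nm seqalg s \<le> e"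
  using LIMSEQ_le_const2[OF seqalg_nm] by blast

lemma seqalg_pre_cstar: "pre_cstar seqalg"
proof
  show "zer seqalg \<in> car seqalg" "un seqalg \<in> car seqalg" by (simp_all add: cau_const)
  fix s t u :: "nat \<Rightarrow> 'a" and c d :: complex
  note c = cau_car[of s] cau_car[of t] cau_car[of u]
  show "s \<in> car seqalg \<Longrightarrow> t \<in> car seqalg \<Longrightarrow> pl seqalg s t \<in> car seqalg"
    by (simp add: cau_pl)
  show "s \<in> car seqalg \<Longrightarrow> t \<in> car seqalg \<Longrightarrow> mul seqalg s t \<in> car seqalg"
    by (simp add: cau_mul)
  show "s \<in> car seqalg \<Longrightarrow> st seqalg s \<in> car seqalg"
    by (simp add: cau_st)
  show "s \<in> car seqalg \<Longrightarrow> sm seqalg c s \<in> car seqalg"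
    by (simp add: cau_sm)
  show "s \<in> car seqalg \<Longrightarrow> t \<in> car seqalg \<Longrightarrow> u \<in> car seqalg \<Longrightarrow> pl seqalg (pl seqalg s t) u = pl seqalg s (pl seqalg t u)"
    using c by (simp add: pl_assoc)
  show "s \<in> car seqalg \<Longrightarrow> t \<in> car seqalg \<Longrightarrow> pl seqalg s t = pl seqalg t s"
    using c pl_comm by simp
  show "s \<in> car seqalg \<Longrightarrow> pl seqalg s (zer seqalg) = s"
    using c by simp
  show "s \<in> car seqalg \<Longrightarrow> t \<in> car seqalg \<Longrightarrow> sm seqalg c (pl seqalg s t) = pl seqalg (sm seqalg c s) (sm seqalg c t)"
    using c by (simp add: sm_pl)
  show "s \<in> car seqalg \<Longrightarrow> sm seqalg (c + d) s = pl seqalg (sm seqalg c s) (sm seqalg d s)"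
    using c by simp
  show "s \<in> car seqalg \<Longrightarrow> sm seqalg (c * d) s = sm seqalg c (sm seqalg d s)"
    using c by simp
  show "s \<in> car seqalg \<Longrightarrow> sm seqalg 1 s = s"
    using c by simp
  show "s \<in> car seqalg \<Longrightarrow> t \<in> car seqalg \<Longrightarrow> u \<in> car seqalg \<Longrightarrow> mul seqalg (mul seqalg s t) u = mul seqalg s (mul seqalg t u)"
    using c by (simp add: mul_assoc)
  show "s \<in> car seqalg \<Longrightarrow> t \<in> car seqalg \<Longrightarrow> u \<in> car seqalg \<Longrightarrow> mul seqalg s (pl seqalg t u) = pl seqalg (mul seqalg s t) (mul seqalg s u)"
    using c by (simp add: mul_pl)
  show "s \<in> car seqalg \<Longrightarrow> t \<in> car seqalg \<Longrightarrow> u \<in> car seqalg \<Longrightarrow> mul seqalg (pl seqalg s t) u = pl seqalg (mul seqalg s u) (mul seqalg t u)"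
    using c by (simp add: pl_mul)
  show "s \<in> car seqalg \<Longrightarrow> t \<in> car seqalg \<Longrightarrow> sm seqalg c (mul seqalg s t) = mul seqalg (sm seqalg c s) t"
    using c by simp
  show "s \<in> car seqalg \<Longrightarrow> t \<in> car seqalg \<Longrightarrow> sm seqalg c (mul seqalg s t) = mul seqalg s (sm seqalg c t)"
    using c by simp
  show "s \<in> car seqalg \<Longrightarrow> mul seqalg (un seqalg) s = s"
    using c by simp
  show "s \<in> car seqalg \<Longrightarrow> mul seqalg s (un seqalg) = s"
    using c by simp
  show "s \<in> car seqalg \<Longrightarrow> st seqalg (st seqalg s) = s"
    using c by simp
  show "s \<in> car seqalg \<Longrightarrow> t \<in> car seqalg \<Longrightarrow> st seqalg (pl seqalg s t) = pl seqalg (st seqalg s) (st seqalg t)"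
    using c by (simp add: st_pl)
  show "s \<in> car seqalg \<Longrightarrow> t \<in> car seqalg \<Longrightarrow> st seqalg (mul seqalg s t) = mul seqalg (st seqalg t) (st seqalg s)"
    using c by (simp add: st_mul)
  show "s \<in> car seqalg \<Longrightarrow> st seqalg (sm seqalg c s) = sm seqalg (cnj c) (st seqalg s)"
    using c by (simp add: st_sm)
  show "s \<in> car seqalg \<Longrightarrow> \<exists>t\<in>car seqalg. pl seqalg s t = zer seqalg"
    using cau_car[of s] by (intro bexI[of _ "\<lambda>n. (-1) \<bullet> s n"]) (simp_all add: cau_sm)
  show "s \<in> car seqalg \<Longrightarrow> 0 \<le> nm seqalg s"
    using LIMSEQ_le_const[OF seqalg_nm, of s 0] cau_car[of s] by simp
  show "nm seqalg (pl seqalg s t) \<le> nm seqalg s + nm seqalg t"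
    if "s \<in> car seqalg" "t \<in> car seqalg"
    using that LIMSEQ_le[OF seqalg_nm tendsto_add[OF seqalg_nm seqalg_nm], of "\<lambda>n. s n \<boxplus> t n" s t]
      cau_car[of s] cau_car[of t] by (simp add: cau_pl nm_triangle)
  show "nm seqalg (mul seqalg s t) \<le> nm seqalg s * nm seqalg t"
    if "s \<in> car seqalg" "t \<in> car seqalg"
    using that LIMSEQ_le[OF seqalg_nm tendsto_mult[OF seqalg_nm seqalg_nm], of "\<lambda>n. s n \<boxdot> t n" s t]
      cau_car[of s] cau_car[of t] by (simp add: cau_mul nm_mul)
  show "nm seqalg (sm seqalg c s) = cmod c * nm seqalg s" if "s \<in> car seqalg"
    using that tendsto_mult[OF tendsto_const seqalg_nm, of s "cmod c"] cau_car[of s]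
    by (intro seqalg_nmI) simp
  show "nm seqalg (mul seqalg (st seqalg s) s) = (nm seqalg s)\<^sup>2" if "s \<in> car seqalg"
    using that tendsto_power[OF seqalg_nm, of s 2] cau_car[of s] by (intro seqalg_nmI) (simp add: nm_cstar)
qed

text \<open>Diagonal argument: beyond \<open>N k\<close> the \<open>k\<close>-th sequence varies by
  less than \<open>1/(k+1)\<close>, and \<open>l k\<close> is its value there. In \<open>key\<close>
  the threshold \<open>n0\<close> may depend on \<open>j\<close> and \<open>k\<close>, which
  suffices because both are fixed whenever \<open>n\<close> is sent to infinity.\<close>

lemma seqalg_complete:
  fixes F :: "nat \<Rightarrow> nat \<Rightarrow> 'a"
  assumes "\<And>k. F k \<in> car seqalg"
    and "\<And>e::real. e > 0 \<Longrightarrow> \<exists>N. \<forall>m\<ge>N. \<forall>n\<ge>N. nm seqalg (minus seqalg (F m) (F n)) < e"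
  shows "\<exists>l\<in>car seqalg. \<forall>e::real>0. \<exists>N. \<forall>n\<ge>N. nm seqalg (minus seqalg (F n) l) < e"
proof -
  have F: "F k \<in> cau" for k using assms(1) by simp
  have "\<exists>N. \<forall>m\<ge>N. \<forall>n\<ge>N. \<parallel>F k m \<boxminus> F k n\<parallel> < 1 / real (Suc k)" for k
    using cauD[OF F, of "1 / real (Suc k)"] by simp
  then obtain N where N: "\<And>k m n. m \<ge> N k \<Longrightarrow> n \<ge> N k \<Longrightarrow> \<parallel>F k m \<boxminus> F k n\<parallel> < 1 / real (Suc k)"
    by metis
  define l where "l k = F k (N k)" for k
  have Fc: "F k n \<in> car A" for k n using cau_car[OF F] .
  have lc: "l k \<in> car A" for k using Fc by (simp add: l_def)
  have key: "\<exists>K. \<forall>j\<ge>K. \<forall>k\<ge>K. \<exists>n0. \<forall>n\<ge>n0. \<parallel>F j n \<boxminus> l k\<parallel> < e" if e: "e > 0" for e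
  proof -
    obtain K1 where K1: "\<And>m n. m \<ge> K1 \<Longrightarrow> n \<ge> K1 \<Longrightarrow> nm seqalg (minus seqalg (F m) (F n)) < e / 2"
      using assms(2)[of "e/2"] e by auto
    obtain K2 where K2: "1 / real (Suc K2) < e / 2"
      using reals_Archimedean[of "e/2"] e by (auto simp: inverse_eq_divide)
    have "\<exists>n0. \<forall>n\<ge>n0. \<parallel>F j n \<boxminus> l k\<parallel> < e" if "j \<ge> max K1 K2" "k \<ge> max K1 K2" for j k
    proof -
      have "(\<lambda>n. \<parallel>F j n \<boxminus> F k n\<parallel>) \<longlonglongrightarrow> nm seqalg (minus seqalg (F j) (F k))"
        using seqalg_nm[OF cau_minus[OF F F]] by simp
      then have "\<forall>\<^sub>F n in sequentially. \<parallel>F j n \<boxminus> F k n\<parallel> < e / 2"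
        using K1[of j k] that by (intro order_tendstoD(2)) auto
      then obtain n1 where n1: "\<And>n. n \<ge> n1 \<Longrightarrow> \<parallel>F j n \<boxminus> F k n\<parallel> < e / 2"
        by (auto simp: eventually_sequentially)
      have "\<parallel>F j n \<boxminus> l k\<parallel> < e" if n: "n \<ge> max n1 (N k)" for n
      proof -
        have "1 / real (Suc k) \<le> 1 / real (Suc K2)" using \<open>k \<ge> max K1 K2\<close> by (simp add: frac_le)
        then have "\<parallel>F k n \<boxminus> l k\<parallel> < e / 2" using N[of k n "N k"] n K2 by (simp add: l_def)
        then show ?thesis
          using nm_minus_triangle[of "F j n" "F k n" "l k"] n1[of n] n Fc lc by simp
      qed
      then show ?thesis by blast
    qed
    then show ?thesis by blast
  qed
  have "l \<in> cau"
    unfolding cau_def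
  proof (intro CollectI conjI allI impI)
    fix e :: real assume e: "e > 0"
    obtain K where K: "\<forall>j\<ge>K. \<forall>k\<ge>K. \<exists>n0. \<forall>n\<ge>n0. \<parallel>F j n \<boxminus> l k\<parallel> < e / 2"
      using key[of "e/2"] e by auto
    have "\<parallel>l j \<boxminus> l k\<parallel> < e" if jk: "j \<ge> K" "k \<ge> K" for j k
    proof -
      obtain a where a: "\<And>n. n \<ge> a \<Longrightarrow> \<parallel>F j n \<boxminus> l j\<parallel> < e / 2" using K jk(1) by blast
      obtain b where b: "\<And>n. n \<ge> b \<Longrightarrow> \<parallel>F j n \<boxminus> l k\<parallel> < e / 2" using K jk by blast
      show ?thesis
        using nm_minus_triangle[of "l j" "F j (max a b)" "l k"] nm_minus_commute[of "l j" "F j (max a b)"]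
          a[of "max a b"] b[of "max a b"] Fc lc by simp
    qed
    then show "\<exists>N. \<forall>m\<ge>N. \<forall>n\<ge>N. \<parallel>l m \<boxminus> l n\<parallel> < e" by blast
  qed (rule lc)
  moreover have "\<exists>N. \<forall>n\<ge>N. nm seqalg (minus seqalg (F n) l) < e" if e: "e > 0" for e :: real
  proof -
    obtain K where K: "\<forall>j\<ge>K. \<forall>k\<ge>K. \<exists>n0. \<forall>n\<ge>n0. \<parallel>F j n \<boxminus> l k\<parallel> < e / 4"
      using key[of "e/4"] e by auto
    obtain K' where K': "\<And>m n. m \<ge> K' \<Longrightarrow> n \<ge> K' \<Longrightarrow> \<parallel>l m \<boxminus> l n\<parallel> < e / 4"
      using cauD[OF \<open>l \<in> cau\<close>, of "e/4"] e by auto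
    have "nm seqalg (minus seqalg (F j) l) < e" if j: "j \<ge> max K K'" for j
    proof -
      obtain a where a: "\<And>n. n \<ge> a \<Longrightarrow> \<parallel>F j n \<boxminus> l j\<parallel> < e / 4" using K j by (meson max.bounded_iff)
      have "nm seqalg (minus seqalg (F j) l) \<le> e / 2"
      proof (simp only: minus_seqalg, rule seqalg_nm_le)
        show "\<parallel>F j n \<boxminus> l n\<parallel> \<le> e / 2" if "n \<ge> max a K'" for n
          using nm_minus_triangle[of "F j n" "l j" "l n"] a[of n] K'[of j n] that j Fc lc by simp
      qed (intro cau_minus F \<open>l \<in> cau\<close>)
      then show ?thesis using e by simp
    qed
    then show ?thesis by blast
  qed
  ultimately show ?thesis by auto
qed

text \<open>The quotient by the null elements, with every class named by a code \<open>w\<close>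
  whose value \<open>i w\<close> lies in the class.\<close>

definition code :: "('w \<Rightarrow> 'a) \<Rightarrow> 'a \<Rightarrow> 'w" where
  "code i x = (SOME w. i w \<in> car A \<and> \<parallel>i w \<boxminus> x\<parallel> = 0)"

definition quot :: "('w \<Rightarrow> 'a) \<Rightarrow> 'w calg" where
  "quot i = \<lparr>car = code i ` car A, zer = code i \<^bold>0, un = code i \<^bold>1,
     pl = (\<lambda>v w. code i (i v \<boxplus> i w)), mul = (\<lambda>v w. code i (i v \<boxdot> i w)),
     sm = (\<lambda>c w. code i (c \<bullet> i w)), st = (\<lambda>w. code i ((i w)\<^sup>\<star>)), nm = (\<lambda>w. \<parallel>i w\<parallel>)\<rparr>"

context
  fixes i :: "'w \<Rightarrow> 'a"
  assumes onto: "car A \<subseteq> range i"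
begin

lemma code_props:
  assumes "x \<in> car A" shows "i (code i x) \<in> car A" "\<parallel>i (code i x) \<boxminus> x\<parallel> = 0"
proof -
  have "\<exists>w. i w \<in> car A \<and> \<parallel>i w \<boxminus> x\<parallel> = 0" using onto assms by force
  from someI_ex[OF this] show "i (code i x) \<in> car A" "\<parallel>i (code i x) \<boxminus> x\<parallel> = 0"
    by (simp_all add: code_def)
qed

lemma null_trans:
  assumes "x \<in> car A" "y \<in> car A" "z \<in> car A" "\<parallel>x \<boxminus> y\<parallel> = 0" "\<parallel>y \<boxminus> z\<parallel> = 0"
  shows "\<parallel>x \<boxminus> z\<parallel> = 0"
proof -
  have "\<parallel>x \<boxminus> z\<parallel> \<le> 0" using nm_minus_triangle[of x y z] assms by simp
  then show ?thesis by (rule antisym) (use assms in simp)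
qed

lemma code_eq_iff:
  assumes "x \<in> car A" "y \<in> car A" shows "code i x = code i y \<longleftrightarrow> \<parallel>x \<boxminus> y\<parallel> = 0"
proof
  assume "code i x = code i y"
  then show "\<parallel>x \<boxminus> y\<parallel> = 0"
    using null_trans[of x "i (code i x)" y] code_props[OF assms(1)] code_props[OF assms(2)]
      nm_minus_commute[of x "i (code i x)"] assms by simp
next
  assume xy: "\<parallel>x \<boxminus> y\<parallel> = 0"
  then have "\<parallel>i w \<boxminus> x\<parallel> = 0 \<longleftrightarrow> \<parallel>i w \<boxminus> y\<parallel> = 0" if "i w \<in> car A" for w
    using null_trans[of "i w" x y] null_trans[of "i w" y x] nm_minus_commute[of x y] that assms by auto
  then have "(\<lambda>w. i w \<in> car A \<and> \<parallel>i w \<boxminus> x\<parallel> = 0) = (\<lambda>w. i w \<in> car A \<and> \<parallel>i w \<boxminus> y\<parallel> = 0)" by auto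
  then show "code i x = code i y" by (simp add: code_def)
qed

lemma null_bound: "\<lbrakk>u \<in> car A; v \<in> car A; \<parallel>u \<boxminus> v\<parallel> \<le> 0\<rbrakk> \<Longrightarrow> code i u = code i v"
  unfolding code_eq_iff by (rule antisym) simp_all

lemma quot_simps:
  shows "zer (quot i) = code i \<^bold>0" "un (quot i) = code i \<^bold>1" "car (quot i) = code i ` car A"
    and "\<lbrakk>x \<in> car A; y \<in> car A\<rbrakk> \<Longrightarrow> pl (quot i) (code i x) (code i y) = code i (x \<boxplus> y)"
    and "\<lbrakk>x \<in> car A; y \<in> car A\<rbrakk> \<Longrightarrow> mul (quot i) (code i x) (code i y) = code i (x \<boxdot> y)"
    and "x \<in> car A \<Longrightarrow> sm (quot i) c (code i x) = code i (c \<bullet> x)"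
    and "x \<in> car A \<Longrightarrow> st (quot i) (code i x) = code i (x\<^sup>\<star>)"
    and "x \<in> car A \<Longrightarrow> nm (quot i) (code i x) = \<parallel>x\<parallel>"
proof -
  show "zer (quot i) = code i \<^bold>0" "un (quot i) = code i \<^bold>1" "car (quot i) = code i ` car A"
    by (simp_all add: quot_def)
  show "pl (quot i) (code i x) (code i y) = code i (x \<boxplus> y)" if xy: "x \<in> car A" "y \<in> car A"
  proof -
    note p = code_props[OF xy(1)] code_props[OF xy(2)]
    have "\<parallel>(i (code i x) \<boxplus> i (code i y)) \<boxminus> (x \<boxplus> y)\<parallel> \<le> 0"
      using nm_triangle[of "i (code i x) \<boxminus> x" "i (code i y) \<boxminus> y"] p xy
      by (simp add: minus_pl_minus)
    with xy p(1,3) have "code i (i (code i x) \<boxplus> i (code i y)) = code i (x \<boxplus> y)"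
      by (intro null_bound) simp_all
    then show ?thesis by (simp add: quot_def)
  qed
  show "mul (quot i) (code i x) (code i y) = code i (x \<boxdot> y)" if xy: "x \<in> car A" "y \<in> car A"
  proof -
    note p = code_props[OF xy(1)] code_props[OF xy(2)]
    have "\<parallel>(i (code i x) \<boxdot> i (code i y)) \<boxminus> (x \<boxdot> y)\<parallel>
        \<le> \<parallel>(i (code i x) \<boxminus> x) \<boxdot> i (code i y)\<parallel> + \<parallel>x \<boxdot> (i (code i y) \<boxminus> y)\<parallel>"
      using p xy by (simp add: mul_minus_mul nm_triangle)
    also have "\<dots> \<le> \<parallel>i (code i x) \<boxminus> x\<parallel> * \<parallel>i (code i y)\<parallel> + \<parallel>x\<parallel> * \<parallel>i (code i y) \<boxminus> y\<parallel>"
      using p(1,3) xy by (intro add_mono nm_mul) simp_all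
    finally have "\<parallel>(i (code i x) \<boxdot> i (code i y)) \<boxminus> (x \<boxdot> y)\<parallel> \<le> 0" using p(2,4) by simp
    with xy p(1,3) have "code i (i (code i x) \<boxdot> i (code i y)) = code i (x \<boxdot> y)"
      by (intro null_bound) simp_all
    then show ?thesis by (simp add: quot_def)
  qed
  show "sm (quot i) c (code i x) = code i (c \<bullet> x)" if "x \<in> car A"
  proof -
    have "code i (c \<bullet> i (code i x)) = code i (c \<bullet> x)"
      using that code_props[OF that] by (intro null_bound) (simp_all flip: sm_minus)
    then show ?thesis by (simp add: quot_def)
  qed
  show "st (quot i) (code i x) = code i (x\<^sup>\<star>)" if "x \<in> car A"
  proof -
    have "code i ((i (code i x))\<^sup>\<star>) = code i (x\<^sup>\<star>)"
      using that code_props[OF that] by (intro null_bound) (simp_all flip: st_minus)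
    then show ?thesis by (simp add: quot_def)
  qed
  show "nm (quot i) (code i x) = \<parallel>x\<parallel>" if "x \<in> car A"
    using that code_props[OF that] nm_diff_le[of "i (code i x)" x] by (simp add: quot_def)
qed

lemma quot_minus:
  "\<lbrakk>x \<in> car A; y \<in> car A\<rbrakk> \<Longrightarrow> minus (quot i) (code i x) (code i y) = code i (x \<boxminus> y)"
  by (simp add: minus_def quot_simps)

lemma quot_pre_cstar: "pre_cstar (quot i)"
proof
  fix a assume "a \<in> car (quot i)"
  then obtain x where x: "x \<in> car A" "a = code i x" by (auto simp: quot_simps)
  show "\<exists>b\<in>car (quot i). pl (quot i) a b = zer (quot i)"
    using x by (intro bexI[of _ "code i ((-1) \<bullet> x)"]) (simp_all add: quot_simps)
qed (auto simp: quot_simps pl_ac mul_assoc mul_pl pl_mul sm_pl st_pl st_mul st_sm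
    nm_triangle nm_mul nm_cstar)

lemma quot_cstar:
  assumes complete: "\<And>f :: nat \<Rightarrow> 'a. \<lbrakk>\<And>n. f n \<in> car A;
      \<And>e::real. e > 0 \<Longrightarrow> \<exists>N. \<forall>m\<ge>N. \<forall>n\<ge>N. \<parallel>f m \<boxminus> f n\<parallel> < e\<rbrakk>
      \<Longrightarrow> \<exists>l\<in>car A. \<forall>e::real>0. \<exists>N. \<forall>n\<ge>N. \<parallel>f n \<boxminus> l\<parallel> < e"
  shows "cstar (quot i)"
proof (rule cstar.intro[OF quot_pre_cstar], unfold_locales)
  fix a assume "a \<in> car (quot i)"
  then show "nm (quot i) a = 0 \<longleftrightarrow> a = zer (quot i)"
    by (auto simp: quot_simps code_eq_iff)
next
  fix f :: "nat \<Rightarrow> 'w"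
  assume f: "\<And>n. f n \<in> car (quot i)"
    and c: "\<And>e::real. e > 0 \<Longrightarrow> \<exists>N. \<forall>m\<ge>N. \<forall>n\<ge>N. nm (quot i) (minus (quot i) (f m) (f n)) < e"
  have "\<forall>n. \<exists>x. x \<in> car A \<and> f n = code i x" using f by (auto simp: quot_simps)
  then obtain x where x: "\<And>n. x n \<in> car A" "\<And>n. f n = code i (x n)" by metis
  obtain l where l: "l \<in> car A" "\<forall>e::real>0. \<exists>N. \<forall>n\<ge>N. \<parallel>x n \<boxminus> l\<parallel> < e"
    using complete[of x] c x by (auto simp: quot_minus quot_simps)
  show "\<exists>l\<in>car (quot i). \<forall>e::real>0. \<exists>N. \<forall>n\<ge>N. nm (quot i) (minus (quot i) (f n) l) < e"
    using l x by (intro bexI[of _ "code i l"]) (auto simp: quot_minus quot_simps)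
qed

end

lemma subalgebra_pre_cstar:
  assumes "D \<subseteq> car A" "\<^bold>0 \<in> D" "\<^bold>1 \<in> D"
    and "\<And>a b. a \<in> D \<Longrightarrow> b \<in> D \<Longrightarrow> a \<boxplus> b \<in> D"
    and "\<And>a b. a \<in> D \<Longrightarrow> b \<in> D \<Longrightarrow> a \<boxdot> b \<in> D"
    and "\<And>a c. a \<in> D \<Longrightarrow> c \<bullet> a \<in> D"
    and "\<And>a. a \<in> D \<Longrightarrow> a\<^sup>\<star> \<in> D"
  shows "pre_cstar (A\<lparr>car := D\<rparr>)"
proof
  fix a assume a: "a \<in> car (A\<lparr>car := D\<rparr>)"
  then show "\<exists>b\<in>car (A\<lparr>car := D\<rparr>). pl (A\<lparr>car := D\<rparr>) a b = zer (A\<lparr>car := D\<rparr>)"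
    using assms by (intro bexI[of _ "(-1) \<bullet> a"]) (auto simp: subset_iff)
qed (insert assms, auto simp: subset_iff pl_ac mul_assoc mul_pl pl_mul sm_pl st_pl st_mul st_sm
    nm_triangle nm_mul nm_cstar)

end

text \<open>If every element of \<open>X\<close> has a name in \<open>'w\<close>, then sequences of
  names reach every Cauchy sequence, so the completion can live on
  \<open>nat \<Rightarrow> 'w\<close>. The map into it preserves the seminorm and kills precisely
  the null elements.\<close>

lemma completion_exists:
  fixes X :: "'c calg" and ev :: "'w \<Rightarrow> 'c"
  assumes X: "pre_cstar X" and ev: "car X \<subseteq> range ev"
  obtains C :: "(nat \<Rightarrow> 'w) calg" and \<iota> where
    "unital_cstar_algebra C" "star_hom X C \<iota>" "\<iota> (un X) = un C"
    "\<And>x. x \<in> car X \<Longrightarrow> nm C (\<iota> x) = nm X x"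
proof -
  interpret pre_cstar X by fact
  interpret S: pre_cstar seqalg by (rule seqalg_pre_cstar)
  define i where "i = (\<lambda>w :: nat \<Rightarrow> 'w. \<lambda>n. ev (w n))"
  have onto: "car seqalg \<subseteq> range i"
  proof
    fix s assume "s \<in> car seqalg"
    then have "\<forall>n. \<exists>w. ev w = s n" using ev by (metis cau_car imageE seqalg_simps(1) subsetD)
    then obtain w where "\<And>n. ev (w n) = s n" by metis
    then have "i w = s" by (simp add: i_def)
    then show "s \<in> range i" by blast
  qed
  define \<iota> where "\<iota> = (\<lambda>x. S.code i (\<lambda>_::nat. x))"
  note q = S.quot_simps[of i, OF onto]
  have "cstar (S.quot i)" using S.quot_cstar[of i, OF onto] seqalg_complete by blast
  moreover have "star_hom X (S.quot i) \<iota>"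
    unfolding star_hom_def linear_map_def \<iota>_def by (auto simp: q cau_const)
  moreover have "\<iota> (un X) = un (S.quot i)" by (simp add: \<iota>_def q)
  moreover have "nm (S.quot i) (\<iota> x) = nm X x" if "x \<in> car X" for x
    using that by (simp add: \<iota>_def q cau_const seqalg_nmI)
  ultimately show thesis using that unital_cstar_algebra_iff_cstar by blast
qed

section \<open>From covariant families in a pre-C*-algebra to covariant representations\<close>

text \<open>Scalar multiples of the unit count as letters, so scalar multiplication is absorbed into
  products; in the application they are images of scalars of \<open>A\<close>.\<close>

locale generators = pre_cstar X for X :: "'c calg" +
  fixes L :: "'c set"
  assumes L_car: "L \<subseteq> car X"
    and L_st: "l \<in> L \<Longrightarrow> st X l \<in> L"
    and L_scalar: "sm X c (un X) \<in> L"
begin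

text \<open>Prepending a letter to a monomial and adding a monomial to a sum are the two moves that
  \<open>read\<close> performs on a word.\<close>

inductive_set mon :: "'c set" where
  mon_un: "un X \<in> mon"
| mon_mul: "l \<in> L \<Longrightarrow> p \<in> mon \<Longrightarrow> mul X l p \<in> mon"

inductive_set gen :: "'c set" where
  gen_zer: "zer X \<in> gen"
| gen_pl: "s \<in> gen \<Longrightarrow> p \<in> mon \<Longrightarrow> pl X s p \<in> gen"

lemma mon_car: "p \<in> mon \<Longrightarrow> p \<in> car X"
  by (induction rule: mon.induct) (use L_car in auto)

lemma gen_car: "s \<in> gen \<Longrightarrow> s \<in> car X"
  by (induction rule: gen.induct) (auto simp: mon_car)

lemma mon_L: "l \<in> L \<Longrightarrow> l \<in> mon"
  using mon_mul[OF _ mon_un] L_car by fastforce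

lemma mon_closed:
  assumes "p \<in> mon" "q \<in> mon" shows "mul X p q \<in> mon"
  using assms(1)
proof (induction rule: mon.induct)
  case (mon_mul l p)
  then have "mul X (mul X l p) q = mul X l (mul X p q)"
    using L_car mon_car assms(2) by (intro mul_assoc) auto
  then show ?case using mon.mon_mul mon_mul by simp
qed (use assms(2) mon_car in simp)

lemma mon_st: "p \<in> mon \<Longrightarrow> st X p \<in> mon"
proof (induction rule: mon.induct)
  case (mon_mul l p)
  then have "st X (mul X l p) = mul X (st X p) (st X l)"
    using L_car mon_car by (intro st_mul) auto
  then show ?case using mon_mul mon_closed mon_L L_st by simp
qed (simp add: mon_un)

lemma gen_mon: "p \<in> mon \<Longrightarrow> p \<in> gen"
  using gen_pl[OF gen_zer] mon_car by fastforce

lemma gen_add: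
  assumes "s \<in> gen" "t \<in> gen" shows "pl X s t \<in> gen"
  using assms(2)
proof (induction rule: gen.induct)
  case (gen_pl t p)
  then have "pl X s (pl X t p) = pl X (pl X s t) p"
    using assms(1) gen_car mon_car by (simp add: pl_assoc)
  then show ?case using gen.gen_pl gen_pl by simp
qed (use assms(1) gen_car in simp)

lemma gen_mon_mul:
  assumes "p \<in> mon" "t \<in> gen" shows "mul X p t \<in> gen"
  using assms(2)
proof (induction rule: gen.induct)
  case (gen_pl t q)
  then have "mul X p (pl X t q) = pl X (mul X p t) (mul X p q)"
    using assms(1) gen_car mon_car by (simp add: mul_pl)
  then show ?case using gen.gen_pl gen_pl mon_closed assms(1) by simp
qed (use assms(1) mon_car gen_zer in simp)

lemma gen_mul:
  assumes "s \<in> gen" "t \<in> gen" shows "mul X s t \<in> gen"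
  using assms(1)
proof (induction rule: gen.induct)
  case (gen_pl s p)
  then have "mul X (pl X s p) t = pl X (mul X s t) (mul X p t)"
    using assms(2) gen_car mon_car by (simp add: pl_mul)
  then show ?case using gen_add gen_pl gen_mon_mul assms(2) by simp
qed (use assms(2) gen_car gen_zer in simp)

lemma gen_st: "s \<in> gen \<Longrightarrow> st X s \<in> gen"
proof (induction rule: gen.induct)
  case (gen_pl s p)
  then have "st X (pl X s p) = pl X (st X s) (st X p)" using gen_car mon_car by (simp add: st_pl)
  then show ?case using gen.gen_pl gen_pl mon_st by simp
qed (simp add: gen_zer)

lemma gen_sm:
  assumes "s \<in> gen" shows "sm X c s \<in> gen"
proof -
  have "mul X (sm X c (un X)) s \<in> gen"
    using gen_mul[OF gen_mon[OF mon_L[OF L_scalar]] assms] .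
  then show ?thesis using gen_car[OF assms] by simp
qed

lemma gen_pre_cstar: "pre_cstar (X\<lparr>car := gen\<rparr>)"
  by (rule subalgebra_pre_cstar)
    (auto simp: gen_car gen_zer gen_mon[OF mon_un] gen_add gen_mul gen_sm gen_st)

text \<open>Words name the elements of \<open>gen\<close>: reading from the right, the accumulator \<open>(s, p)\<close> holds
  the completed summands and the monomial under construction, which \<open>None\<close> completes.\<close>

definition read :: "('l \<Rightarrow> 'c option) \<Rightarrow> 'l \<Rightarrow> 'c \<times> 'c \<Rightarrow> 'c \<times> 'c" where
  "read \<phi> x = (\<lambda>(s, p). case \<phi> x of None \<Rightarrow> (pl X s p, un X) | Some l \<Rightarrow> (s, mul X l p))"

lemma gen_words:
  fixes \<phi> :: "'l \<Rightarrow> 'c option"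
  assumes L: "\<And>l. l \<in> L \<Longrightarrow> \<exists>x. \<phi> x = Some l" and sep: "\<phi> y = None"
  shows "gen \<subseteq> range (\<lambda>w. fst (foldr (read \<phi>) w (zer X, un X)))"
proof -
  let ?f = "\<lambda>w. foldr (read \<phi>) w (zer X, un X)"
  have m: "\<exists>w. ?f w = (s, p)" if "p \<in> mon" "\<exists>w. ?f w = (s, un X)" for s p
    using that
  proof (induction rule: mon.induct)
    case (mon_mul l p)
    then obtain w x where "?f w = (s, p)" "\<phi> x = Some l" using L by blast
    then have "?f (x # w) = (s, mul X l p)" by (simp add: read_def)
    then show ?case by blast
  qed simp
  have "\<exists>w. ?f w = (s, un X)" if "s \<in> gen" for s
    using that
  proof (induction rule: gen.induct)
    case gen_zer
    show ?case by (rule exI[of _ "[]"]) simp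
  next
    case (gen_pl s p)
    then obtain w where "?f w = (s, p)" using m by blast
    then have "?f (y # w) = (pl X s p, un X)" using sep by (simp add: read_def)
    then show ?case by blast
  qed
  then show ?thesis by (metis (no_types, lifting) fst_conv rangeI subsetI)
qed

end

text \<open>One family serves both actions: \<open>U\<close> implements \<open>V\<close>, its
  adjoints implement \<open>H\<close>, and each covariance relation supplies the range condition
  required for the other action. Faithfulness is phrased through the seminorm, since null elements
  of \<open>X\<close> vanish in the completion.\<close>

lemma finely_representableI:
  fixes A :: "'a calg" and X :: "'c calg" and V H :: "'g::linordered_ab_group_add \<Rightarrow> 'a \<Rightarrow> 'a"
  assumes A: "cstar A" and X: "pre_cstar X"
    and s: "star_hom A X s" "s (un A) = un X" "\<And>a. a \<in> car A \<Longrightarrow> nm X (s a) = 0 \<Longrightarrow> a = zer A"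
    and U: "\<And>x. 0 \<le> x \<Longrightarrow> partial_isometry X (U x)"
      "\<And>x y. 0 \<le> x \<Longrightarrow> 0 \<le> y \<Longrightarrow> U (x + y) = mul X (U x) (U y)"
    and V: "\<And>x a. 0 \<le> x \<Longrightarrow> a \<in> car A \<Longrightarrow> V x a \<in> car A"
      "\<And>x a. 0 \<le> x \<Longrightarrow> a \<in> car A \<Longrightarrow> s (V x a) = mul X (mul X (U x) (s a)) (st X (U x))"
    and H: "\<And>x a. 0 \<le> x \<Longrightarrow> a \<in> car A \<Longrightarrow> H x a \<in> car A"
      "\<And>x a. 0 \<le> x \<Longrightarrow> a \<in> car A \<Longrightarrow> s (H x a) = mul X (mul X (st X (U x)) (s a)) (U x)"
  shows "finely_representable A V \<and> finely_representable A H"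
proof -
  interpret A: cstar A by fact
  interpret X: pre_cstar X by fact
  note sh = s(1)[unfolded star_hom_def linear_map_def]
  have sc: "s a \<in> car X" if "a \<in> car A" for a using sh that by blast
  have Uc: "U x \<in> car X" if "0 \<le> x" for x using U(1)[OF that] by (simp add: partial_isometry_def)
  define L where "L = s ` car A \<union> U ` {0..} \<union> (\<lambda>x. st X (U x)) ` {0..}"
  interpret generators X L
  proof
    show "L \<subseteq> car X" using sc Uc by (auto simp: L_def)
    show "st X l \<in> L" if l: "l \<in> L" for l
    proof -
      consider a where "a \<in> car A" "l = s a" | g where "0 \<le> g" "l = U g"
        | g where "0 \<le> g" "l = st X (U g)"
        using l by (auto simp: L_def)
      then show ?thesis
      proof cases
        case (1 a)
        then have "st X l = s (st A a)" using sh by simp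
        then show ?thesis using 1 by (simp add: L_def)
      next
        case (2 g) then show ?thesis by (simp add: L_def)
      next
        case (3 g) then show ?thesis using Uc by (simp add: L_def)
      qed
    qed
    show "sm X c (un X) \<in> L" for c
    proof -
      have "s (sm A c (un A)) = sm X c (un X)" using sh s(2) by auto
      then show ?thesis unfolding L_def by (metis A.sm_closed A.un_closed UnI1 imageI)
    qed
  qed
  \<comment> \<open>The number is a tag: 0 separates summands, 1 is an element of \<open>A\<close>,
    2 is some \<open>U g\<close>, anything else an adjoint. The component that a tag ignores is
    filled with \<open>un A\<close> or \<open>0\<close>.\<close>
  define \<phi> :: "'a \<times> 'g \<times> nat \<Rightarrow> 'c option" where
    "\<phi> = (\<lambda>(a, g, n). if n = 0 then None else if n = 1 then Some (s a)
       else if n = 2 then Some (U g) else Some (st X (U g)))"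
  have "\<exists>x. \<phi> x = Some l" if l: "l \<in> L" for l
  proof -
    consider a where "l = s a" | g where "l = U g" | g where "l = st X (U g)"
      using l by (auto simp: L_def)
    then show ?thesis
    proof cases
      case (1 a) then show ?thesis by (intro exI[of _ "(a, 0, 1)"]) (simp add: \<phi>_def)
    next
      case (2 g) then show ?thesis by (intro exI[of _ "(un A, g, 2)"]) (simp add: \<phi>_def)
    next
      case (3 g) then show ?thesis by (intro exI[of _ "(un A, g, 3)"]) (simp add: \<phi>_def)
    qed
  qed
  moreover have "\<phi> (un A, 0, 0) = None" by (simp add: \<phi>_def)
  ultimately have "car (X\<lparr>car := gen\<rparr>) \<subseteq> range (\<lambda>w. fst (foldr (read \<phi>) w (zer X, un X)))"
    using gen_words[of \<phi>] by fastforce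
  from completion_exists[OF gen_pre_cstar this]
  obtain C :: "(nat \<Rightarrow> ('a \<times> 'g \<times> nat) list) calg" and \<iota> where
    C: "unital_cstar_algebra C" and \<iota>: "star_hom (X\<lparr>car := gen\<rparr>) C \<iota>" "\<iota> (un X) = un C"
      "\<And>x. x \<in> gen \<Longrightarrow> nm C (\<iota> x) = nm X x"
    by auto
  interpret C: cstar C using C unital_cstar_algebra_iff_cstar by blast
  have i: "\<iota> x \<in> car C" "\<iota> (st X x) = st C (\<iota> x)" "\<iota> (sm X c x) = sm C c (\<iota> x)" if "x \<in> gen" for x c
    using \<iota>(1) that by (simp_all add: star_hom_def linear_map_def)
  have i2: "\<iota> (pl X x y) = pl C (\<iota> x) (\<iota> y)" "\<iota> (mul X x y) = mul C (\<iota> x) (\<iota> y)"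
    if "x \<in> gen" "y \<in> gen" for x y
    using \<iota>(1) that by (simp_all add: star_hom_def linear_map_def)
  have gs: "s a \<in> gen" if "a \<in> car A" for a
    using that gen_mon mon_L by (simp add: L_def)
  have gU: "U x \<in> gen" if "0 \<le> x" for x
    using that gen_mon mon_L by (simp add: L_def)
  define \<sigma> where "\<sigma> = (\<lambda>a. \<iota> (s a))"
  define W where "W = (\<lambda>x. \<iota> (U x))"
  have hom: "star_hom A C \<sigma>"
    unfolding star_hom_def linear_map_def \<sigma>_def using sh gs i i2 by simp
  have inj: "inj_on \<sigma> (car A)"
  proof (rule inj_onI)
    fix a b assume ab: "a \<in> car A" "b \<in> car A" "\<sigma> a = \<sigma> b"
    have "\<sigma> (minus A a b) = minus C (\<sigma> a) (\<sigma> b)"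
      using hom ab by (simp add: minus_def star_hom_def linear_map_def)
    also have "\<dots> = zer C" using ab hom by (simp add: star_hom_def linear_map_def)
    finally have "nm X (s (minus A a b)) = 0"
      using \<iota>(3)[OF gs[of "minus A a b"]] ab by (simp add: \<sigma>_def)
    then have "minus A a b = zer A" using s(3) ab by simp
    then show "a = b" using ab by (simp add: A.minus_eq_zer_iff)
  qed
  have cov: "\<sigma> (V x a) = mul C (mul C (W x) (\<sigma> a)) (st C (W x))"
    "\<sigma> (H x a) = mul C (mul C (st C (W x)) (\<sigma> a)) (W x)" if "0 \<le> x" "a \<in> car A" for x a
    using that V H gs gU i i2 gen_mul gen_st by (simp_all add: \<sigma>_def W_def)
  have Wc: "W x \<in> car C" if "0 \<le> x" for x using gU[OF that] i by (simp add: W_def)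
  have pW: "partial_isometry C (W x)" if "0 \<le> x" for x
  proof -
    have "\<iota> (mul X (mul X (U x) (st X (U x))) (U x)) = \<iota> (U x)"
      using U(1)[OF that] by (simp add: partial_isometry_def)
    then show ?thesis
      using Wc[OF that] gU[OF that] i i2 gen_mul gen_st by (simp add: partial_isometry_def W_def)
  qed
  have pW': "partial_isometry C (st C (W x))" if "0 \<le> x" for x
  proof -
    have "st C (mul C (mul C (W x) (st C (W x))) (W x)) = st C (W x)"
      using pW[OF that] by (simp add: partial_isometry_def)
    then show ?thesis
      using Wc[OF that] by (simp add: partial_isometry_def C.st_mul C.mul_assoc)
  qed
  have W2: "W (x + y) = mul C (W x) (W y)" if "0 \<le> x" "0 \<le> y" for x y
    using U(2)[OF that] gU that i2 by (simp add: W_def)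
  \<comment> \<open>The star reverses products; commutativity of the group restores the
    order.\<close>
  have W2': "st C (W (x + y)) = mul C (st C (W x)) (st C (W y))" if "0 \<le> x" "0 \<le> y" for x y
    using W2[OF that(2,1)] Wc that by (simp add: add.commute[of x y] C.st_mul)
  have \<sigma>1: "\<sigma> (un A) = un C" using s(2) \<iota>(2) by (simp add: \<sigma>_def)
  have "covariant_rep A V C \<sigma> W"
    unfolding covariant_rep_def
    by (intro conjI allI impI ballI C hom \<sigma>1 inj pW W2 cov(1)) (simp_all add: H(1) flip: cov)
  moreover have "covariant_rep A H C \<sigma> (\<lambda>x. st C (W x))"
    unfolding covariant_rep_def
    by (intro conjI allI impI ballI C hom \<sigma>1 inj pW' W2') (simp_all add: V(1) Wc flip: cov)
  ultimately show ?thesis unfolding finely_representable_def by blast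
qed

section \<open>The Hilbert module of an interaction\<close>

context star_alg
begin

text \<open>Addition is a commutative monoid on the carrier only, so the sum is the finite product
  of that monoid written multiplicatively.\<close>

definition fs :: "('i \<Rightarrow> 'a) \<Rightarrow> 'i set \<Rightarrow> 'a" where
  "fs f F = finprod \<lparr>carrier = car A, monoid.mult = pl A, one = zer A\<rparr> f F"

lemma additive_comm_monoid: "comm_monoid \<lparr>carrier = car A, monoid.mult = pl A, one = zer A\<rparr>"
  by (rule comm_monoidI) (simp_all add: pl_ac)

interpretation additive: comm_monoid "\<lparr>carrier = car A, monoid.mult = pl A, one = zer A\<rparr>"
  by (rule additive_comm_monoid)

lemma fs_closed [simp]: "(\<And>g. g \<in> F \<Longrightarrow> f g \<in> car A) \<Longrightarrow> fs f F \<in> car A"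
  unfolding fs_def using additive.finprod_closed[of f F] by (simp add: Pi_iff)

lemma fs_empty [simp]: "fs f {} = \<^bold>0"
  unfolding fs_def by simp

lemma fs_insert:
  "\<lbrakk>finite F; a \<notin> F; f a \<in> car A; \<And>g. g \<in> F \<Longrightarrow> f g \<in> car A\<rbrakk> \<Longrightarrow> fs f (insert a F) = f a \<boxplus> fs f F"
  unfolding fs_def using additive.finprod_insert[of F a f] by (simp add: Pi_iff)

lemma fs_pl:
  "\<lbrakk>\<And>g. g \<in> F \<Longrightarrow> f g \<in> car A; \<And>g. g \<in> F \<Longrightarrow> h g \<in> car A\<rbrakk>
    \<Longrightarrow> fs (\<lambda>g. f g \<boxplus> h g) F = fs f F \<boxplus> fs h F"
  unfolding fs_def using additive.finprod_multf[of f F h] by (simp add: Pi_iff)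

lemma fs_cong:
  "\<lbrakk>\<And>g. g \<in> F \<Longrightarrow> f g = h g; \<And>g. g \<in> F \<Longrightarrow> h g \<in> car A\<rbrakk> \<Longrightarrow> fs f F = fs h F"
  unfolding fs_def by (rule additive.finprod_cong') (simp_all add: Pi_iff)

lemma fs_reindex:
  "\<lbrakk>\<And>g. g \<in> F \<Longrightarrow> f (r g) \<in> car A; inj_on r F\<rbrakk> \<Longrightarrow> fs f (r ` F) = fs (\<lambda>g. f (r g)) F"
  unfolding fs_def using additive.finprod_reindex[of f r F] by (simp add: Pi_iff)

lemma fs_superset:
  "\<lbrakk>finite F; S \<subseteq> F; \<And>g. g \<in> F - S \<Longrightarrow> f g = \<^bold>0; \<And>g. g \<in> F \<Longrightarrow> f g \<in> car A\<rbrakk> \<Longrightarrow> fs f S = fs f F"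
  unfolding fs_def by (rule additive.finprod_mono_neutral_cong_left) (simp_all add: Pi_iff)

lemma fs_hom:
  assumes "finite F" "\<And>g. g \<in> F \<Longrightarrow> f g \<in> car A"
    and "\<And>a. a \<in> car A \<Longrightarrow> \<phi> a \<in> car A" "\<phi> \<^bold>0 = \<^bold>0"
    and "\<And>a b. a \<in> car A \<Longrightarrow> b \<in> car A \<Longrightarrow> \<phi> (a \<boxplus> b) = \<phi> a \<boxplus> \<phi> b"
  shows "\<phi> (fs f F) = fs (\<lambda>g. \<phi> (f g)) F"
  using assms(1,2)
proof (induction F rule: finite_induct)
  case (insert x F)
  then have "fs f (insert x F) = f x \<boxplus> fs f F" by (intro fs_insert) auto
  moreover have "fs (\<lambda>g. \<phi> (f g)) (insert x F) = \<phi> (f x) \<boxplus> fs (\<lambda>g. \<phi> (f g)) F"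
    using insert assms(3) by (intro fs_insert) auto
  ultimately show ?case using insert assms(5)[of "f x" "fs f F"] by simp
qed (simp add: assms(4))

end

lemma (in cstar) fs_pos:
  assumes "finite F" "\<And>g. g \<in> F \<Longrightarrow> pos (f g)"
  shows "pos (fs f F)"
  using assms
proof (induction F rule: finite_induct)
  case (insert x F)
  then have "fs f (insert x F) = f x \<boxplus> fs f F" by (intro fs_insert) auto
  then show ?case using insert pos_pl by simp
qed simp

text \<open>The situation to which all four hypotheses reduce, possibly after exchanging the two
  actions: \<open>V\<close> acts by star-endomorphisms and \<open>H x\<close> is a transfer operator
  for \<open>V x\<close>.\<close>

locale transfer_pair = cstar A for A :: "'a calg" +
  fixes V H :: "'g::linordered_ab_group_add \<Rightarrow> 'a \<Rightarrow> 'a"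
  assumes V_closed [simp]: "\<lbrakk>0 \<le> x; a \<in> car A\<rbrakk> \<Longrightarrow> V x a \<in> car A"
    and V_pl: "\<lbrakk>0 \<le> x; a \<in> car A; b \<in> car A\<rbrakk> \<Longrightarrow> V x (pl A a b) = pl A (V x a) (V x b)"
    and V_sm: "\<lbrakk>0 \<le> x; a \<in> car A\<rbrakk> \<Longrightarrow> V x (sm A c a) = sm A c (V x a)"
    and V_mul: "\<lbrakk>0 \<le> x; a \<in> car A; b \<in> car A\<rbrakk> \<Longrightarrow> V x (mul A a b) = mul A (V x a) (V x b)"
    and V_st: "\<lbrakk>0 \<le> x; a \<in> car A\<rbrakk> \<Longrightarrow> V x (st A a) = st A (V x a)"
    and V_0 [simp]: "a \<in> car A \<Longrightarrow> V 0 a = a"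
    and V_V: "\<lbrakk>0 \<le> x; 0 \<le> y; a \<in> car A\<rbrakk> \<Longrightarrow> V x (V y a) = V (x + y) a"
    and H_closed [simp]: "\<lbrakk>0 \<le> x; a \<in> car A\<rbrakk> \<Longrightarrow> H x a \<in> car A"
    and H_pl: "\<lbrakk>0 \<le> x; a \<in> car A; b \<in> car A\<rbrakk> \<Longrightarrow> H x (pl A a b) = pl A (H x a) (H x b)"
    and H_sm: "\<lbrakk>0 \<le> x; a \<in> car A\<rbrakk> \<Longrightarrow> H x (sm A c a) = sm A c (H x a)"
    and H_st: "\<lbrakk>0 \<le> x; a \<in> car A\<rbrakk> \<Longrightarrow> H x (st A a) = st A (H x a)"
    and H_pos: "\<lbrakk>0 \<le> x; a \<in> car A\<rbrakk> \<Longrightarrow> pos (H x (mul A (st A a) a))"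
    and H_0 [simp]: "a \<in> car A \<Longrightarrow> H 0 a = a"
    and H_H: "\<lbrakk>0 \<le> x; 0 \<le> y; a \<in> car A\<rbrakk> \<Longrightarrow> H x (H y a) = H (x + y) a"
    and V_H: "\<lbrakk>0 \<le> x; a \<in> car A\<rbrakk> \<Longrightarrow> V x (H x a) = mul A (mul A (V x (un A)) a) (V x (un A))"
    and H_V_mul: "\<lbrakk>0 \<le> x; a \<in> car A; b \<in> car A\<rbrakk> \<Longrightarrow> H x (mul A (V x a) b) = mul A a (H x b)"
begin

definition q :: "'g \<Rightarrow> 'a" where "q x = V x \<^bold>1"

lemma q_closed [simp]: "0 \<le> x \<Longrightarrow> q x \<in> car A" by (simp add: q_def)

lemma q_0 [simp]: "q 0 = \<^bold>1" by (simp add: q_def)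

lemma q_st [simp]: "0 \<le> x \<Longrightarrow> (q x)\<^sup>\<star> = q x" by (simp add: q_def flip: V_st)

lemma V_zer [simp]: "0 \<le> x \<Longrightarrow> V x \<^bold>0 = \<^bold>0" using V_sm[of x "\<^bold>0" 0] by simp

lemma H_zer [simp]: "0 \<le> x \<Longrightarrow> H x \<^bold>0 = \<^bold>0" using H_sm[of x "\<^bold>0" 0] by simp

lemma q_V [simp]: "\<lbrakk>0 \<le> x; a \<in> car A\<rbrakk> \<Longrightarrow> q x \<boxdot> V x a = V x a"
  unfolding q_def by (simp flip: V_mul)

lemma V_q [simp]: "\<lbrakk>0 \<le> x; a \<in> car A\<rbrakk> \<Longrightarrow> V x a \<boxdot> q x = V x a"
  unfolding q_def by (simp flip: V_mul)

lemma V_of_q: "\<lbrakk>0 \<le> x; 0 \<le> y\<rbrakk> \<Longrightarrow> V x (q y) = q (x + y)"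
  by (simp add: q_def V_V)

text \<open>For \<open>x \<le> y\<close> the map \<open>V y\<close> factors through
  \<open>V x\<close>, so the projections \<open>q\<close> decrease along the order.\<close>

lemma V_q_le:
  assumes "0 \<le> x" "x \<le> y" "a \<in> car A"
  shows "q x \<boxdot> V y a = V y a" "V y a \<boxdot> q x = V y a"
  using V_V[of x "y - x" a] q_V[of x "V (y - x) a"] V_q[of x "V (y - x) a"] assms by simp_all

lemma q_q_le:
  assumes "0 \<le> x" "x \<le> y" shows "q x \<boxdot> q y = q y" "q y \<boxdot> q x = q y"
  using V_q_le[OF assms un_closed] by (simp_all add: q_def)

lemma H_mul_V: "\<lbrakk>0 \<le> x; a \<in> car A; b \<in> car A\<rbrakk> \<Longrightarrow> H x (b \<boxdot> V x a) = H x b \<boxdot> a"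
  using H_V_mul[of x "a\<^sup>\<star>" "b\<^sup>\<star>"] H_st[of x "b \<boxdot> V x a"] H_st[of x b]
  by (metis H_closed V_closed V_st mul_closed st_closed st_mul st_st)

lemma H_q_right: "\<lbrakk>0 \<le> x; b \<in> car A\<rbrakk> \<Longrightarrow> H x (b \<boxdot> q x) = H x b"
  using H_mul_V[of x "\<^bold>1" b] by (simp add: q_def)

definition gp :: "'g \<Rightarrow> 'g" where "gp g = max g 0"
definition gm :: "'g \<Rightarrow> 'g" where "gm g = max (- g) 0"

lemma gp_ge [simp]: "0 \<le> gp g" and gm_ge [simp]: "0 \<le> gm g"
  by (simp_all add: gp_def gm_def)

text \<open>With partial isometries \<open>U x\<close> implementing \<open>V\<close>, the vector \<open>f\<close> stands for the formal sum
  of the elements \<open>U(g\<^sup>-)\<^sup>\<star> f(g) U(g\<^sup>+)\<close>; the module structure and the operators below are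
  read off from the products of such elements.\<close>

definition M :: "('g \<Rightarrow> 'a) set" where
  "M = {f. finite {g. f g \<noteq> \<^bold>0} \<and>
    (\<forall>g. f g \<in> car A \<and> q (gm g) \<boxdot> f g = f g \<and> f g \<boxdot> q (gp g) = f g)}"

text \<open>The degree zero part of the product of the adjoint of one formal sum with another: in
  \<open>U(g\<^sup>+)\<^sup>\<star> f(g)\<^sup>\<star> U(g\<^sup>-) U(g\<^sup>-)\<^sup>\<star> h(g)
  U(g\<^sup>+)\<close> the middle factor is \<open>q(g\<^sup>-)\<close>, which \<open>h(g)\<close>
  absorbs, and the outer factors act as \<open>H(g\<^sup>+)\<close>.\<close>

definition ip :: "('g \<Rightarrow> 'a) \<Rightarrow> ('g \<Rightarrow> 'a) \<Rightarrow> 'a" where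
  "ip f h = fs (\<lambda>g. H (gp g) ((f g)\<^sup>\<star> \<boxdot> h g)) {g. f g \<noteq> \<^bold>0}"

lemma M_car: "f \<in> M \<Longrightarrow> f g \<in> car A"
  and M_left: "f \<in> M \<Longrightarrow> q (gm g) \<boxdot> f g = f g"
  and M_right: "f \<in> M \<Longrightarrow> f g \<boxdot> q (gp g) = f g"
  and M_finite: "f \<in> M \<Longrightarrow> finite {g. f g \<noteq> \<^bold>0}"
  by (simp_all add: M_def)

lemma M_I:
  assumes "finite F" "\<And>g. g \<notin> F \<Longrightarrow> f g = \<^bold>0" "\<And>g. f g \<in> car A"
    "\<And>g. q (gm g) \<boxdot> f g = f g" "\<And>g. f g \<boxdot> q (gp g) = f g"
  shows "f \<in> M"
proof -
  have "{g. f g \<noteq> \<^bold>0} \<subseteq> F" using assms(2) by blast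
  then show ?thesis unfolding M_def using assms finite_subset by blast
qed

text \<open>The definition sums over the support of the first vector. Symmetry and adjointness need
  one index set that serves two pairs of vectors with different supports.\<close>

lemma ip_eq:
  assumes "f \<in> M" "h \<in> M" "finite F" "{g. f g \<noteq> \<^bold>0} \<subseteq> F \<or> {g. h g \<noteq> \<^bold>0} \<subseteq> F"
  shows "ip f h = fs (\<lambda>g. H (gp g) ((f g)\<^sup>\<star> \<boxdot> h g)) F"
proof -
  note c = M_car[OF assms(1)] M_car[OF assms(2)]
  let ?t = "\<lambda>g. H (gp g) ((f g)\<^sup>\<star> \<boxdot> h g)"
  have z: "?t g = \<^bold>0" if "f g = \<^bold>0 \<or> h g = \<^bold>0" for g using that c by auto
  have "ip f h = fs ?t ({g. f g \<noteq> \<^bold>0} \<union> F)"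
    unfolding ip_def using z c assms(3) M_finite[OF assms(1)] by (intro fs_superset) auto
  also have "\<dots> = fs ?t F"
    using z c assms(3,4) M_finite[OF assms(1)] by (intro fs_superset[symmetric]) auto
  finally show ?thesis .
qed

definition madd where "madd f h = (\<lambda>g::'g. f g \<boxplus> h g)"
definition mzero where "mzero = (\<lambda>g::'g. \<^bold>0)"
definition msm where "msm c f = (\<lambda>g::'g. c \<bullet> f g)"
text \<open>Right multiplication by \<open>a\<close>, moved to the left of
  \<open>U(g\<^sup>+)\<close>, becomes \<open>V(g\<^sup>+) a\<close>.\<close>

definition act where "act f a = (\<lambda>g. f g \<boxdot> V (gp g) a)"

lemma mzero_M: "mzero \<in> M"
  by (rule M_I[of "{}"]) (simp_all add: mzero_def)

lemma madd_M:
  assumes "f \<in> M" "h \<in> M" shows "madd f h \<in> M"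
  by (rule M_I[of "{g. f g \<noteq> \<^bold>0} \<union> {g. h g \<noteq> \<^bold>0}"])
    (use M_car[OF assms(1)] M_car[OF assms(2)] M_left[OF assms(1)] M_left[OF assms(2)]
      M_right[OF assms(1)] M_right[OF assms(2)] M_finite[OF assms(1)] M_finite[OF assms(2)]
      in \<open>auto simp: madd_def mul_pl pl_mul\<close>)

lemma msm_M:
  assumes "f \<in> M" shows "msm c f \<in> M"
  by (rule M_I[of "{g. f g \<noteq> \<^bold>0}"])
    (use M_car[OF assms(1)] M_left[OF assms(1)] M_right[OF assms(1)] M_finite[OF assms(1)]
      in \<open>auto simp: msm_def\<close>)

lemma act_M:
  assumes "f \<in> M" "a \<in> car A" shows "act f a \<in> M"
proof (rule M_I[of "{g. f g \<noteq> \<^bold>0}"])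
  show "q (gm g) \<boxdot> act f a g = act f a g" for g
    using M_car[OF assms(1), of g] M_left[OF assms(1), of g] assms(2)
    by (simp add: act_def flip: mul_assoc)
qed (use M_car[OF assms(1)] M_right[OF assms(1)] M_finite[OF assms(1)] assms(2)
      in \<open>auto simp: act_def mul_assoc\<close>)

lemma ip_closed': "f \<in> M \<Longrightarrow> h \<in> M \<Longrightarrow> ip f h \<in> car A"
  unfolding ip_def using M_car[of f] M_car[of h] by (intro fs_closed) auto

text \<open>Covers scalar multiplication and right multiplication by an element of \<open>A\<close>
  at once.\<close>

lemma ip_hom:
  assumes "f \<in> M" "h \<in> M" "h' \<in> M"
    and "\<And>a. a \<in> car A \<Longrightarrow> \<phi> a \<in> car A" "\<phi> \<^bold>0 = \<^bold>0"
    and "\<And>a b. a \<in> car A \<Longrightarrow> b \<in> car A \<Longrightarrow> \<phi> (a \<boxplus> b) = \<phi> a \<boxplus> \<phi> b"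
    and "\<And>g. H (gp g) ((f g)\<^sup>\<star> \<boxdot> h' g) = \<phi> (H (gp g) ((f g)\<^sup>\<star> \<boxdot> h g))"
  shows "ip f h' = \<phi> (ip f h)"
proof -
  have "\<phi> (ip f h) = fs (\<lambda>g. \<phi> (H (gp g) ((f g)\<^sup>\<star> \<boxdot> h g))) {g. f g \<noteq> \<^bold>0}"
    unfolding ip_def
    using M_car[OF assms(1)] M_car[OF assms(2)] M_finite[OF assms(1)] assms(4,5,6) by (intro fs_hom) auto
  then show ?thesis unfolding ip_def by (simp add: assms(7))
qed

sublocale E: prehilb A M madd mzero msm act ip
proof
  fix x y z :: "'g \<Rightarrow> 'a" and a :: 'a and c d :: complex
  note cl = M_car[of x] M_car[of y] M_car[of z]
  show "mzero \<in> M" by (rule mzero_M)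
  show "x \<in> M \<Longrightarrow> y \<in> M \<Longrightarrow> madd x y \<in> M" by (rule madd_M)
  show "x \<in> M \<Longrightarrow> msm c x \<in> M" by (rule msm_M)
  show "x \<in> M \<Longrightarrow> a \<in> car A \<Longrightarrow> act x a \<in> M" by (rule act_M)
  show "x \<in> M \<Longrightarrow> y \<in> M \<Longrightarrow> z \<in> M \<Longrightarrow> madd (madd x y) z = madd x (madd y z)"
    using cl by (simp add: madd_def pl_assoc)
  show "x \<in> M \<Longrightarrow> y \<in> M \<Longrightarrow> madd x y = madd y x"
    using cl pl_comm by (simp add: madd_def)
  show "x \<in> M \<Longrightarrow> madd x mzero = x" using cl by (simp add: madd_def mzero_def)
  show "x \<in> M \<Longrightarrow> madd x (msm (-1) x) = mzero" using cl by (simp add: madd_def mzero_def msm_def)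
  show "x \<in> M \<Longrightarrow> y \<in> M \<Longrightarrow> msm c (madd x y) = madd (msm c x) (msm c y)"
    using cl by (simp add: madd_def msm_def sm_pl)
  show "x \<in> M \<Longrightarrow> msm (c + d) x = madd (msm c x) (msm d x)"
    using cl by (simp add: madd_def msm_def)
  show "x \<in> M \<Longrightarrow> msm (c * d) x = msm c (msm d x)" using cl by (simp add: msm_def)
  show "x \<in> M \<Longrightarrow> msm 1 x = x" using cl by (simp add: msm_def)
  show "msm c mzero = mzero" by (simp add: msm_def mzero_def)
  show "x \<in> M \<Longrightarrow> y \<in> M \<Longrightarrow> ip x y \<in> car A" by (rule ip_closed')
  show "ip x (madd y z) = ip x y \<boxplus> ip x z" if m: "x \<in> M" "y \<in> M" "z \<in> M"
  proof -
    have "fs (\<lambda>g. H (gp g) ((x g)\<^sup>\<star> \<boxdot> madd y z g)) {g. x g \<noteq> \<^bold>0}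
        = fs (\<lambda>g. H (gp g) ((x g)\<^sup>\<star> \<boxdot> y g) \<boxplus> H (gp g) ((x g)\<^sup>\<star> \<boxdot> z g)) {g. x g \<noteq> \<^bold>0}"
      using m cl by (simp add: madd_def mul_pl H_pl)
    also have "\<dots> = ip x y \<boxplus> ip x z" unfolding ip_def using m cl by (intro fs_pl) auto
    finally show ?thesis by (simp add: ip_def)
  qed
  show "ip x (msm c y) = c \<bullet> ip x y" if m: "x \<in> M" "y \<in> M"
    by (rule ip_hom) (use m cl msm_M in \<open>simp_all add: msm_def H_sm sm_pl\<close>)
  show "ip x (act y a) = ip x y \<boxdot> a" if m: "x \<in> M" "y \<in> M" "a \<in> car A"
    by (rule ip_hom[where \<phi> = "\<lambda>b. b \<boxdot> a"])
      (use m cl act_M in \<open>simp_all add: act_def pl_mul H_mul_V flip: mul_assoc\<close>)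
  show "(ip x y)\<^sup>\<star> = ip y x" if m: "x \<in> M" "y \<in> M"
  proof -
    let ?F = "{g. x g \<noteq> \<^bold>0} \<union> {g. y g \<noteq> \<^bold>0}"
    have F: "finite ?F" using M_finite m by blast
    have "ip x y = fs (\<lambda>g. H (gp g) ((x g)\<^sup>\<star> \<boxdot> y g)) ?F" using m F by (intro ip_eq) auto
    also have "\<dots>\<^sup>\<star> = fs (\<lambda>g. (H (gp g) ((x g)\<^sup>\<star> \<boxdot> y g))\<^sup>\<star>) ?F"
      using m cl F by (intro fs_hom) (auto simp: st_pl)
    also have "\<dots> = fs (\<lambda>g. H (gp g) ((y g)\<^sup>\<star> \<boxdot> x g)) ?F"
      using m cl by (intro fs_cong) (auto simp: st_mul simp flip: H_st)
    also have "\<dots> = ip y x" using m F by (intro ip_eq[symmetric]) auto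
    finally show ?thesis .
  qed
  show "pos (ip x x)" if "x \<in> M"
    unfolding ip_def using that cl M_finite H_pos by (intro fs_pos) auto
qed

section \<open>The operators of the regular representation\<close>

definition sig :: "'a \<Rightarrow> ('g \<Rightarrow> 'a) \<Rightarrow> 'g \<Rightarrow> 'a" where
  "sig a f = (if f \<in> M then (\<lambda>g. V (gm g) a \<boxdot> f g) else mzero)"

text \<open>Left multiplication by \<open>U(x)\<close>. With \<open>h = g - x\<close>, as much of
  \<open>U(x)\<close> as possible is absorbed by \<open>U(h\<^sup>-)\<^sup>\<star>\<close>; the
  remaining amount \<open>gp g - gp h\<close> passes the coefficient as a power of
  \<open>V\<close>.\<close>

definition up :: "'g \<Rightarrow> ('g \<Rightarrow> 'a) \<Rightarrow> 'g \<Rightarrow> 'a" where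
  "up x f = (if f \<in> M then (\<lambda>g. V (gp g - gp (g - x)) (f (g - x))) else mzero)"

text \<open>Left multiplication by \<open>U(x)\<^sup>\<star>\<close>. With \<open>h = g + x\<close>,
  the amount by which \<open>h\<^sup>+\<close> exceeds \<open>g\<^sup>+\<close> closes around the
  coefficient and acts as \<open>H\<close>. The factors \<open>q\<close> put the coefficient into
  the corner demanded by \<open>M\<close> without changing the formal element, since
  \<open>U(g\<^sup>-)\<^sup>\<star>\<close> and \<open>U(g\<^sup>+)\<close> absorb them.\<close>

definition dn :: "'g \<Rightarrow> ('g \<Rightarrow> 'a) \<Rightarrow> 'g \<Rightarrow> 'a" where
  "dn x f = (if f \<in> M then (\<lambda>g. q (gm g) \<boxdot> H (gp (g + x) - gp g) (f (g + x)) \<boxdot> q (gp g)) else mzero)"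

lemma gp_nonneg [simp]: "0 \<le> g \<Longrightarrow> gp g = g"
  and gp_nonpos [simp]: "g \<le> 0 \<Longrightarrow> gp g = 0"
  and gm_nonneg [simp]: "0 \<le> g \<Longrightarrow> gm g = 0"
  and gm_nonpos [simp]: "g \<le> 0 \<Longrightarrow> gm g = - g"
  by (simp_all add: gp_def gm_def max_absorb1 max_absorb2)

lemma gp_mono: "g \<le> h \<Longrightarrow> gp g \<le> gp h"
  and gm_antimono: "g \<le> h \<Longrightarrow> gm h \<le> gm g"
  unfolding gp_def gm_def by (intro max.mono; simp)+

lemma gp_diff_ge:
  assumes "0 \<le> x" shows "0 \<le> gp g - gp (g - x)" "0 \<le> gp (g + x) - gp g"
proof -
  have "gp (g - x) \<le> gp g" "gp g \<le> gp (g + x)" using assms by (simp_all add: gp_mono)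
  then show "0 \<le> gp g - gp (g - x)" "0 \<le> gp (g + x) - gp g" by simp_all
qed

lemma gp_minus_gm: "gp g - gm g = (g::'g)"
  using linear[of g 0] by auto

text \<open>Bookkeeping for all the relations below: the power of \<open>V\<close> or
  \<open>H\<close> applied to a coefficient and the change of the negative part together account for
  \<open>x\<close>.\<close>

lemma shift_eq: "(gp g - gp (g - x)) + gm (g - x) = gm g + (x::'g)"
proof -
  have "(p - p') + m' = m + x" if "p - m = g" "p' - m' = g - x" for p m p' m' :: 'g
  proof -
    have "(p - p') + m' = p - (p' - m')" by (simp add: algebra_simps)
    also have "\<dots> = (p - g) + x" unfolding that(2) by (simp add: algebra_simps)
    also have "p - g = m" unfolding that(1)[symmetric] by simp
    finally show ?thesis .
  qed
  then show ?thesis using gp_minus_gm[of g] gp_minus_gm[of "g - x"] by blast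
qed

lemma sig_M:
  assumes "f \<in> M" "a \<in> car A" shows "(\<lambda>g. V (gm g) a \<boxdot> f g) \<in> M"
proof (rule M_I[of "{g. f g \<noteq> \<^bold>0}"])
  fix g
  note f = M_car[OF assms(1), of g] M_left[OF assms(1), of g] M_right[OF assms(1), of g]
  show "q (gm g) \<boxdot> (V (gm g) a \<boxdot> f g) = V (gm g) a \<boxdot> f g"
    using f(1) assms(2) by (simp flip: mul_assoc)
  show "V (gm g) a \<boxdot> f g \<boxdot> q (gp g) = V (gm g) a \<boxdot> f g"
    using f assms(2) by (simp add: mul_assoc)
qed (use M_car[OF assms(1)] M_finite[OF assms(1)] assms(2) in auto)

lemma up_M:
  assumes "f \<in> M" "0 \<le> x" shows "(\<lambda>g. V (gp g - gp (g - x)) (f (g - x))) \<in> M"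
proof (rule M_I[of "(\<lambda>g. g + x) ` {g. f g \<noteq> \<^bold>0}"])
  fix g
  define k where "k = gp g - gp (g - x)"
  have k: "0 \<le> k" using gp_diff_ge(1)[OF assms(2)] by (simp add: k_def)
  define h where "h = f (g - x)"
  have h: "h \<in> car A" "q (gm (g - x)) \<boxdot> h = h" "h \<boxdot> q (gp (g - x)) = h"
    unfolding h_def using M_car M_left M_right assms(1) by blast+
  show "V (gp g - gp (g - x)) (f (g - x)) \<in> car A" using h k by (simp add: h_def k_def)
  have "q (gm g) \<boxdot> V k h = V k h"
  \<comment> \<open>For \<open>0 \<le> g\<close> the left projection is the unit. For
    \<open>g < 0\<close> no power of \<open>V\<close> acts, and the stronger projection at
    \<open>g - x\<close> implies the weaker one at \<open>g\<close>.\<close>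
  proof (cases "0 \<le> g")
    case True
    then show ?thesis using h k by simp
  next
    case False
    then have g: "g < 0" "g - x < 0" using assms(2) by (simp_all add: less_le_trans)
    then have k0: "k = 0" by (simp add: k_def)
    have "gm g \<le> gm (g - x)" using assms(2) by (simp add: gm_antimono)
    then have "q (gm g) \<boxdot> (q (gm (g - x)) \<boxdot> h) = q (gm (g - x)) \<boxdot> h"
      using q_q_le(1)[of "gm g" "gm (g - x)"] h(1) by (simp flip: mul_assoc)
    then show ?thesis using h k0 by simp
  qed
  then show "q (gm g) \<boxdot> V (gp g - gp (g - x)) (f (g - x)) = V (gp g - gp (g - x)) (f (g - x))"
    by (simp add: k_def h_def)
  have "V k h \<boxdot> q (gp g) = V k h"
    using V_mul[of k h "q (gp (g - x))"] V_of_q[of k "gp (g - x)"] h k by (simp add: k_def)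
  then show "V (gp g - gp (g - x)) (f (g - x)) \<boxdot> q (gp g) = V (gp g - gp (g - x)) (f (g - x))"
    by (simp add: k_def h_def)
next
  fix g assume "g \<notin> (\<lambda>g. g + x) ` {g. f g \<noteq> \<^bold>0}"
  then have "f (g - x) = \<^bold>0" by (metis (mono_tags, lifting) diff_add_cancel image_eqI mem_Collect_eq)
  then show "V (gp g - gp (g - x)) (f (g - x)) = \<^bold>0" using gp_diff_ge(1)[OF assms(2)] by simp
qed (use M_finite[OF assms(1)] in simp)

lemma dn_M:
  assumes "f \<in> M" "0 \<le> x"
  shows "(\<lambda>g. q (gm g) \<boxdot> H (gp (g + x) - gp g) (f (g + x)) \<boxdot> q (gp g)) \<in> M"
proof (rule M_I[of "(\<lambda>g. g - x) ` {g. f g \<noteq> \<^bold>0}"])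
  fix g
  define h where "h = H (gp (g + x) - gp g) (f (g + x))"
  have h: "h \<in> car A" unfolding h_def using M_car[OF assms(1)] gp_diff_ge(2)[OF assms(2)] by simp
  show "q (gm g) \<boxdot> H (gp (g + x) - gp g) (f (g + x)) \<boxdot> q (gp g) \<in> car A"
    using h by (simp add: h_def)
  show "q (gm g) \<boxdot> (q (gm g) \<boxdot> H (gp (g + x) - gp g) (f (g + x)) \<boxdot> q (gp g))
      = q (gm g) \<boxdot> H (gp (g + x) - gp g) (f (g + x)) \<boxdot> q (gp g)"
    unfolding h_def[symmetric] using h by (simp add: q_q_le flip: mul_assoc)
  show "q (gm g) \<boxdot> H (gp (g + x) - gp g) (f (g + x)) \<boxdot> q (gp g) \<boxdot> q (gp g)
      = q (gm g) \<boxdot> H (gp (g + x) - gp g) (f (g + x)) \<boxdot> q (gp g)"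
    unfolding h_def[symmetric] using h by (simp add: q_q_le mul_assoc)
next
  fix g assume "g \<notin> (\<lambda>g. g - x) ` {g. f g \<noteq> \<^bold>0}"
  then have "f (g + x) = \<^bold>0" by (metis (mono_tags, lifting) add_diff_cancel image_eqI mem_Collect_eq)
  then show "q (gm g) \<boxdot> H (gp (g + x) - gp g) (f (g + x)) \<boxdot> q (gp g) = \<^bold>0"
    using gp_diff_ge(2)[OF assms(2)] by simp
qed (use M_finite[OF assms(1)] in simp)

lemma lin_sig:
  assumes "a \<in> car A" shows "E.lin (sig a)"
  unfolding E.lin_def
proof (intro conjI ballI allI impI)
  fix f h c assume f: "f \<in> M"
  note cl = M_car[OF f]
  show "sig a f \<in> M" using sig_M[OF f assms] by (simp add: sig_def f)
  show "sig a (msm c f) = msm c (sig a f)"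
    using cl assms msm_M[OF f] by (simp add: sig_def f) (simp add: msm_def)
  assume h: "h \<in> M"
  show "sig a (madd f h) = madd (sig a f) (sig a h)"
    using cl M_car[OF h] assms madd_M[OF f h] by (simp add: sig_def f h) (simp add: madd_def mul_pl)
qed (simp add: sig_def)

lemma lin_up:
  assumes "0 \<le> x" shows "E.lin (up x)"
  unfolding E.lin_def
proof (intro conjI ballI allI impI)
  fix f h c assume f: "f \<in> M"
  note cl = M_car[OF f] gp_diff_ge[OF assms]
  show "up x f \<in> M" using up_M[OF f assms] by (simp add: up_def f)
  show "up x (msm c f) = msm c (up x f)"
    using cl assms msm_M[OF f] by (simp add: up_def f) (simp add: msm_def V_sm)
  assume h: "h \<in> M"
  show "up x (madd f h) = madd (up x f) (up x h)"
    using cl M_car[OF h] assms madd_M[OF f h] by (simp add: up_def f h) (simp add: madd_def V_pl)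
qed (simp add: up_def)

lemma lin_dn:
  assumes "0 \<le> x" shows "E.lin (dn x)"
  unfolding E.lin_def
proof (intro conjI ballI allI impI)
  fix f h c assume f: "f \<in> M"
  note cl = M_car[OF f] gp_diff_ge[OF assms]
  show "dn x f \<in> M" using dn_M[OF f assms] by (simp add: dn_def f)
  show "dn x (msm c f) = msm c (dn x f)"
    using cl assms msm_M[OF f] by (simp add: dn_def f) (simp add: msm_def H_sm)
  assume h: "h \<in> M"
  show "dn x (madd f h) = madd (dn x f) (dn x h)"
    using cl M_car[OF h] assms madd_M[OF f h]
    by (simp add: dn_def f h) (simp add: madd_def H_pl mul_pl pl_mul)
qed (simp add: dn_def)

lemma adj_sig:
  assumes "a \<in> car A" shows "E.adj (sig a) (sig (a\<^sup>\<star>))"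
  unfolding E.adj_def
proof (intro ballI)
  fix f h assume fh: "f \<in> M" "h \<in> M"
  let ?F = "{g. f g \<noteq> \<^bold>0} \<union> {g. h g \<noteq> \<^bold>0}"
  have F: "finite ?F" using M_finite fh by blast
  have m: "sig a f \<in> M" "sig (a\<^sup>\<star>) h \<in> M" using lin_sig assms fh E.lin_closed by simp_all
  have t: "(sig a f g)\<^sup>\<star> \<boxdot> h g = (f g)\<^sup>\<star> \<boxdot> sig (a\<^sup>\<star>) h g" for g
    using fh M_car[OF fh(1)] M_car[OF fh(2)] assms by (simp add: sig_def st_mul V_st mul_assoc)
  have "ip (sig a f) h = fs (\<lambda>g. H (gp g) ((sig a f g)\<^sup>\<star> \<boxdot> h g)) ?F"
    using m fh F by (intro ip_eq) auto
  also have "\<dots> = ip f (sig (a\<^sup>\<star>) h)"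
    unfolding t using m fh F by (intro ip_eq[symmetric]) auto
  finally show "ip (sig a f) h = ip f (sig (a\<^sup>\<star>) h)" .
qed

text \<open>After the shift of the index the claim holds term by term: \<open>H (gp (g + x))\<close>
  splits into \<open>H (gp g)\<close> and \<open>H k\<close>, the transfer identity carries
  \<open>V k\<close> out of \<open>H k\<close>, and the projections in \<open>dn\<close> are
  absorbed by \<open>f g\<close> on the left and by \<open>H (gp g)\<close> on the right.\<close>

lemma adj_up:
  assumes x: "0 \<le> x" shows "E.adj (up x) (dn x)"
  unfolding E.adj_def
proof (intro ballI)
  fix f h assume fh: "f \<in> M" "h \<in> M"
  let ?F = "{g. f g \<noteq> \<^bold>0}"
  have m: "up x f \<in> M" "dn x h \<in> M" using lin_up[OF x] lin_dn[OF x] E.lin_closed by simp_all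
  note cl = M_car[OF fh(1)] M_car[OF fh(2)] M_car[OF m(1)] M_car[OF m(2)]
  have sub: "{g. up x f g \<noteq> \<^bold>0} \<subseteq> (\<lambda>g. g + x) ` ?F"
  proof
    fix g assume "g \<in> {g. up x f g \<noteq> \<^bold>0}"
    then have "f (g - x) \<noteq> \<^bold>0" using fh gp_diff_ge[OF x, of g] by (auto simp: up_def)
    then show "g \<in> (\<lambda>g. g + x) ` ?F" by (intro image_eqI[of _ _ "g - x"]) simp_all
  qed
  have t: "H (gp (g + x)) ((up x f (g + x))\<^sup>\<star> \<boxdot> h (g + x)) = H (gp g) ((f g)\<^sup>\<star> \<boxdot> dn x h g)" for g
  proof -
    define k where "k = gp (g + x) - gp g"
    have k: "0 \<le> k" "gp g + k = gp (g + x)" using gp_diff_ge(2)[OF x] by (simp_all add: k_def)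
    have c: "f g \<in> car A" "h (g + x) \<in> car A" using cl by auto
    have fq: "(f g)\<^sup>\<star> \<boxdot> q (gm g) = (f g)\<^sup>\<star>"
      using M_left[OF fh(1), of g] c st_mul[of "q (gm g)" "f g"] by simp
    have "H (gp (g + x)) ((up x f (g + x))\<^sup>\<star> \<boxdot> h (g + x))
        = H (gp g) (H k (V k ((f g)\<^sup>\<star>) \<boxdot> h (g + x)))"
      using fh c k(1) by (simp add: up_def V_st H_H k(2)) (simp add: k_def)
    also have "\<dots> = H (gp g) ((f g)\<^sup>\<star> \<boxdot> H k (h (g + x)))" using c k by (simp add: H_V_mul)
    also have "\<dots> = H (gp g) (((f g)\<^sup>\<star> \<boxdot> q (gm g)) \<boxdot> H k (h (g + x)) \<boxdot> q (gp g))"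
      using c k(1) by (simp add: fq H_q_right)
    also have "\<dots> = H (gp g) ((f g)\<^sup>\<star> \<boxdot> dn x h g)"
      using c k(1) fh by (simp add: dn_def mul_assoc flip: k_def)
    finally show ?thesis .
  qed
  have "ip (up x f) h = fs (\<lambda>g. H (gp g) ((up x f g)\<^sup>\<star> \<boxdot> h g)) ((\<lambda>g. g + x) ` ?F)"
    using m fh sub M_finite[OF fh(1)] by (intro ip_eq) auto
  also have "\<dots> = fs (\<lambda>g. H (gp (g + x)) ((up x f (g + x))\<^sup>\<star> \<boxdot> h (g + x))) ?F"
    using cl by (intro fs_reindex) (auto simp: inj_on_def)
  finally show "ip (up x f) h = ip f (dn x h)" unfolding t by (simp add: ip_def)
qed

lemma sig_sig: "\<lbrakk>a \<in> car A; b \<in> car A\<rbrakk> \<Longrightarrow> sig a (sig b f) = sig (a \<boxdot> b) f"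
  using sig_M[of f b] M_car[of f] mzero_M
  by (auto simp: sig_def V_mul mul_assoc) (simp add: mzero_def)

lemma sig_un: "sig \<^bold>1 = (\<lambda>f. if f \<in> M then f else mzero)"
  using M_left by (auto simp: sig_def fun_eq_iff simp flip: q_def)

text \<open>Write \<open>|a|\<^sup>2 - a\<^sup>\<star> a\<close> as a square \<open>d d\<close>.
  Then \<open>|a|\<^sup>2 (ip f f)\<close> exceeds the inner square of \<open>sig a f\<close> by
  that of \<open>sig d f\<close>, which is positive.\<close>

lemma bdd_sig:
  assumes "a \<in> car A" shows "E.bdd (sig a)"
proof -
  have sa: "sa (a\<^sup>\<star> \<boxdot> a)" "\<parallel>a\<^sup>\<star> \<boxdot> a\<parallel> \<le> \<parallel>a\<parallel>\<^sup>2"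
    using pos_star_mul[OF assms] pos_sa nm_cstar[OF assms] by auto
  obtain d where d: "pos d" "d \<boxdot> d = real_un (\<parallel>a\<parallel>\<^sup>2) \<boxminus> a\<^sup>\<star> \<boxdot> a"
    using sqrt_real_minus[OF sa] by metis
  have dc: "d \<in> car A" "d\<^sup>\<star> = d" using d(1) pos_sa sa_st by auto
  have "E.mn (sig a f) \<le> \<parallel>a\<parallel> * E.mn f" if f: "f \<in> M" for f
  proof -
    let ?t = "complex_of_real (\<parallel>a\<parallel>\<^sup>2)"
    have ip1: "ip (sig b f) (sig b f) = ip f (sig (b\<^sup>\<star> \<boxdot> b) f)" if "b \<in> car A" for b
      using adj_sig[OF that] that f E.lin_closed[OF lin_sig[OF that]]
      by (simp add: E.adj_def sig_sig)
    have "sig (d \<boxdot> d) f = madd (msm ?t f) (msm (-1) (sig (a\<^sup>\<star> \<boxdot> a) f))"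
      unfolding d(2) using f M_car[OF f] M_left[OF f] assms
      by (simp add: sig_def madd_def msm_def minus_def V_pl V_sm pl_mul flip: q_def)
    then have "ip (sig d f) (sig d f) = ?t \<bullet> ip f f \<boxminus> ip (sig a f) (sig a f)"
      using ip1[OF dc(1)] ip1[OF assms] dc f E.lin_closed[OF lin_sig[of "a\<^sup>\<star> \<boxdot> a"]] assms
      by (simp add: E.ip_madd E.ip_msm minus_def)
    then have "pos (?t \<bullet> ip f f \<boxminus> ip (sig a f) (sig a f))"
      using E.ip_pos[OF E.lin_closed[OF lin_sig[OF dc(1)]], of f] by simp
    moreover have "pos (ip (sig a f) (sig a f))"
      using E.ip_pos[OF E.lin_closed[OF lin_sig[OF assms]]] .
    moreover have "sa (?t \<bullet> ip f f)" using sa_sm[OF pos_sa[OF E.ip_pos[OF f]]] .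
    ultimately have "\<parallel>ip (sig a f) (sig a f)\<parallel> \<le> \<parallel>?t \<bullet> ip f f\<parallel>" by (intro pos_nm_mono)
    then have "(E.mn (sig a f))\<^sup>2 \<le> (\<parallel>a\<parallel> * E.mn f)\<^sup>2"
      using E.mn_sq[OF f] E.mn_sq[OF E.lin_closed[OF lin_sig[OF assms]], of f] f
      by (simp add: power_mult_distrib norm_power assms)
    then show ?thesis by (rule power2_le_imp_le) (use assms f in simp)
  qed
  then show ?thesis unfolding E.bdd_def using assms by (intro exI[of _ "\<parallel>a\<parallel>"]) simp
qed

text \<open>The covariance relation \<open>U(x) a U(x)\<^sup>\<star> = V x a\<close>, exact on every
  coefficient.\<close>

lemma up_sig_dn:
  assumes x: "0 \<le> x" and a: "a \<in> car A" and h: "h \<in> M"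
  shows "up x (sig a (dn x h)) = sig (V x a) h"
proof
  fix g
  define k m n where "k = gp g - gp (g - x)" and "m = gm (g - x)" and "n = gp (g - x)"
  have k: "0 \<le> k" "0 \<le> m" "0 \<le> n" "k + n = gp g" "k + m = gm g + x"
    using gp_diff_ge(1)[OF x] shift_eq[of g x] by (simp_all add: k_def m_def n_def)
  have kg: "k \<le> gp g" using k by (simp add: k_def)
  have c: "h g \<in> car A" using M_car[OF h] .
  have M: "dn x h \<in> M" "sig a (dn x h) \<in> M"
    using E.lin_closed lin_dn[OF x] lin_sig[OF a] by blast+
  have "up x (sig a (dn x h)) g = V k (V m a \<boxdot> (q m \<boxdot> H k (h g) \<boxdot> q n))"
    using M h by (simp add: up_def sig_def) (simp add: dn_def k_def m_def n_def)
  also have "\<dots> = V k (V m a \<boxdot> H k (h g) \<boxdot> q n)"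
    using k(1-3) c a by (simp flip: mul_assoc)
  \<comment> \<open>\<open>V k\<close> undoes \<open>H k\<close> up to the two projections
    \<open>q k\<close>; the left one is absorbed by \<open>V (k + m) a\<close>, the right one by
    \<open>q (k + n)\<close>.\<close>
  also have "\<dots> = V (k + m) a \<boxdot> (q k \<boxdot> h g \<boxdot> q k) \<boxdot> q (k + n)"
    using k(1-3) c a by (simp add: V_mul V_V V_H V_of_q flip: q_def)
  also have "\<dots> = (V (k + m) a \<boxdot> q k) \<boxdot> h g \<boxdot> (q k \<boxdot> q (k + n))"
    using k(1-3) c a by (simp add: mul_assoc)
  also have "\<dots> = V (k + m) a \<boxdot> h g \<boxdot> q (gp g)"
  proof -
    have "V (k + m) a \<boxdot> q k = V (k + m) a" using V_q_le(2)[of k "k + m" a] k(1,2) a by simp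
    moreover have "q k \<boxdot> q (k + n) = q (gp g)" using q_q_le(1)[of k "k + n"] k(1,3) unfolding k(4)[symmetric] by simp
    ultimately show ?thesis by simp
  qed
  also have "\<dots> = V (gm g + x) a \<boxdot> h g"
    using M_right[OF h, of g] c a x k by (simp add: mul_assoc)
  also have "\<dots> = sig (V x a) h g" using h x a by (simp add: sig_def V_V)
  finally show "up x (sig a (dn x h)) g = sig (V x a) h g" .
qed

text \<open>The dual relation \<open>U(x)\<^sup>\<star> a U(x) = H x a\<close>. The transfer
  identity releases \<open>f g\<close> from \<open>H k\<close>, and since \<open>q m\<close> fixes
  \<open>f g\<close>, a second \<open>q m\<close> can be inserted in front of it.\<close>

lemma dn_sig_up:
  assumes x: "0 \<le> x" and a: "a \<in> car A" and f: "f \<in> M"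
  shows "dn x (sig a (up x f)) = sig (H x a) f"
proof
  fix g
  define k m n where "k = gp (g + x) - gp g" and "m = gm g" and "n = gp g"
  have k: "0 \<le> k" "0 \<le> m" "0 \<le> n"
    using gp_diff_ge(2)[OF x] by (simp_all add: k_def m_def n_def)
  have c: "f g \<in> car A" "q m \<boxdot> f g = f g" "f g \<boxdot> q n = f g"
    using M_car[OF f] M_left[OF f] M_right[OF f] by (simp_all add: m_def n_def)
  have M: "up x f \<in> M" "sig a (up x f) \<in> M"
    using E.lin_closed lin_up[OF x] lin_sig[OF a] by blast+
  have "dn x (sig a (up x f)) g = q m \<boxdot> H k (V (gm (g + x)) a \<boxdot> V k (f g)) \<boxdot> q n"
    using M f by (simp add: dn_def sig_def) (simp add: up_def k_def m_def n_def)
  also have "\<dots> = q m \<boxdot> H k (V (gm (g + x)) a) \<boxdot> (f g \<boxdot> q n)"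
    using k c a by (simp add: H_mul_V mul_assoc)
  also have "\<dots> = (q m \<boxdot> H k (V (gm (g + x)) a) \<boxdot> q m) \<boxdot> f g"
    using k c a by (simp add: mul_assoc)
  \<comment> \<open>For \<open>0 \<le> g + x\<close> one has \<open>k + m = x\<close>, so
    \<open>H x\<close> ends in \<open>H m\<close>, and \<open>V m\<close> undoes it up to
    \<open>q m\<close>. Otherwise \<open>k = 0\<close> and \<open>x \<le> m\<close>, so
    \<open>V m\<close> starts with \<open>V x\<close> and undoes all of \<open>H x\<close>.\<close>
  also have "q m \<boxdot> H k (V (gm (g + x)) a) \<boxdot> q m = V m (H x a)"
  proof (cases "0 \<le> g + x")
    case True
    have "k + m = x"
      using True shift_eq[of "g + x" x] by (simp add: k_def m_def)
    then have "V m (H x a) = V m (H m (H k a))" using k a by (simp add: H_H add.commute)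
    also have "\<dots> = q m \<boxdot> H k a \<boxdot> q m" using k a by (simp add: V_H flip: q_def)
    finally show ?thesis using True a by simp
  next
    case False
    then have g1: "g + x \<le> 0" by simp
    have g2: "g \<le> 0" by (rule order_trans[OF _ g1]) (use x in simp)
    have "x \<le> - g" using add_right_mono[OF g1, of "- g"] by simp
    then have km: "k = 0" "gm (g + x) = m - x" "x \<le> m"
      using g1 g2 by (simp_all add: k_def m_def)
    have "V m (H x a) = V (m - x) (V x (H x a))" using km x a by (simp add: V_V)
    also have "\<dots> = V (m - x) (q x \<boxdot> a \<boxdot> q x)" using x a by (simp add: V_H flip: q_def)
    also have "\<dots> = q m \<boxdot> V (m - x) a \<boxdot> q m"
      using V_of_q[of "m - x" x] x a km by (simp add: V_mul)
    finally show ?thesis using km a by simp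
  qed
  also have "V m (H x a) \<boxdot> f g = sig (H x a) f g" using f by (simp add: sig_def m_def)
  finally show "dn x (sig a (up x f)) g = sig (H x a) f g" .
qed

text \<open>\<open>up_sig_dn\<close> at the unit identifies \<open>sig (q x)\<close> with
  \<open>U(x) U(x)\<^sup>\<star>\<close>, so this is one half of the partial isometry law;
  \<open>dn_sig_q\<close> is the half for the adjoint.\<close>

lemma sig_q_up:
  assumes x: "0 \<le> x" and f: "f \<in> M"
  shows "sig (q x) (up x f) = up x f"
proof
  fix g
  define k m where "k = gp g - gp (g - x)" and "m = gm (g - x)"
  have k: "0 \<le> k" "0 \<le> m" "k + m = gm g + x"
    using gp_diff_ge(1)[OF x] shift_eq[of g x] by (simp_all add: k_def m_def)
  have c: "f (g - x) \<in> car A" "q m \<boxdot> f (g - x) = f (g - x)"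
    using M_car[OF f] M_left[OF f] by (simp_all add: m_def)
  have M: "up x f \<in> M" using E.lin_closed lin_up[OF x] by blast
  have "sig (q x) (up x f) g = q (k + m) \<boxdot> V k (f (g - x))"
    using M f x k by (simp add: sig_def V_of_q) (simp add: up_def k_def)
  also have "\<dots> = V k (q m \<boxdot> f (g - x))" using k c(1) by (simp add: V_mul V_of_q)
  finally show "sig (q x) (up x f) g = up x f g" using c f by (simp add: up_def k_def)
qed

lemma dn_sig_q:
  assumes x: "0 \<le> x" and h: "h \<in> M"
  shows "dn x (sig (q x) h) = dn x h"
proof
  fix g
  define k m where "k = gp (g + x) - gp g" and "m = gm g"
  have k: "0 \<le> k" "0 \<le> m" "k + m = gm (g + x) + x"
    using gp_diff_ge(2)[OF x] shift_eq[of "g + x" x] by (simp_all add: k_def m_def)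
  have c: "h (g + x) \<in> car A" using M_car[OF h] .
  have M: "sig (q x) h \<in> M" using E.lin_closed lin_sig x by simp
  have "dn x (sig (q x) h) g = q m \<boxdot> H k (q (gm (g + x) + x) \<boxdot> h (g + x)) \<boxdot> q (gp g)"
    using M h x by (simp add: dn_def) (simp add: sig_def V_of_q k_def m_def)
  also have "q (gm (g + x) + x) = V k (q m)" using k by (simp add: V_of_q)
  also have "q m \<boxdot> H k (V k (q m) \<boxdot> h (g + x)) \<boxdot> q (gp g) = q m \<boxdot> H k (h (g + x)) \<boxdot> q (gp g)"
    using k c by (simp add: H_V_mul q_q_le flip: mul_assoc)
  finally show "dn x (sig (q x) h) g = dn x h g" using h by (simp add: dn_def k_def m_def)
qed

lemma up_add:
  assumes "0 \<le> x" "0 \<le> y" shows "up (x + y) f = up x (up y f)"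
proof (cases "f \<in> M")
  case True
  have M: "up y f \<in> M" using E.lin_closed lin_up[OF assms(2)] by blast
  show ?thesis
  proof
    fix g
    have "up x (up y f) g = V (gp g - gp (g - x)) (V (gp (g - x) - gp (g - x - y)) (f (g - x - y)))"
      using M True by (simp add: up_def[of x]) (simp add: up_def)
    also have "\<dots> = V (gp g - gp (g - x - y)) (f (g - x - y))"
      using gp_diff_ge(1)[OF assms(1), of g] gp_diff_ge(1)[OF assms(2), of "g - x"] M_car[OF True]
      by (simp only: V_V) simp
    finally show "up (x + y) f g = up x (up y f) g" using True by (simp add: up_def diff_diff_eq)
  qed
next
  case False
  then show ?thesis using E.lin_mzero[OF lin_up[OF assms(1)]] by (simp add: up_def[of y] up_def[of "x + y"])
qed

lemma dn_add:
  assumes x: "0 \<le> x" and y: "0 \<le> y" shows "dn (x + y) f = dn y (dn x f)"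
proof (cases "f \<in> M")
  case True
  have M: "dn x f \<in> M" using E.lin_closed lin_dn[OF x] by blast
  show ?thesis
  proof
    fix g
    define j k where "j = gp (g + y) - gp g" and "k = gp (g + y + x) - gp (g + y)"
    define m m' n where "m = gm g" and "m' = gm (g + y)" and "n = gp g"
    have jk: "0 \<le> j" "0 \<le> k" "j + k = gp (g + (x + y)) - gp g" "gp (g + y) = j + n"
      unfolding j_def k_def n_def
      by (rule gp_diff_ge(2)[OF y], rule gp_diff_ge(2)[OF x]) (simp_all add: add_ac)
    have mn: "0 \<le> m" "0 \<le> m'" "0 \<le> n" by (simp_all add: m_def m'_def n_def)
    define h where "h = H k (f (g + y + x))"
    have h: "h \<in> car A" using M_car[OF True] jk by (simp add: h_def)
    have "dn y (dn x f) g = q m \<boxdot> H j (q m' \<boxdot> h \<boxdot> q (gp (g + y))) \<boxdot> q n"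
      using M True by (simp add: dn_def[of y]) (simp add: dn_def h_def j_def k_def m_def m'_def n_def)
    also have "q (gp (g + y)) = V j (q n)" using jk mn by (simp add: V_of_q)
    also have "H j (q m' \<boxdot> h \<boxdot> V j (q n)) = H j (q m' \<boxdot> h) \<boxdot> q n"
      using jk(1) mn h by (simp add: H_mul_V)
    also have "q m \<boxdot> (H j (q m' \<boxdot> h) \<boxdot> q n) \<boxdot> q n = (q m \<boxdot> H j (q m' \<boxdot> h)) \<boxdot> q n"
      using jk(1) mn h by (simp add: mul_assoc q_q_le)
    \<comment> \<open>The inner projection \<open>q m'\<close> has to disappear: for
      \<open>0 \<le> g + y\<close> it is the unit, and otherwise \<open>j = 0\<close> and the
      smaller projection \<open>q m\<close> absorbs it.\<close>
    also have "q m \<boxdot> H j (q m' \<boxdot> h) = q m \<boxdot> H j h"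
    proof (cases "0 \<le> g + y")
      case True
      then show ?thesis using h by (simp add: m'_def)
    next
      case False
      then have g1: "g + y \<le> 0" by simp
      have "g \<le> 0" by (rule order_trans[OF _ g1]) (use y in simp)
      then have "j = 0" using g1 by (simp add: j_def)
      moreover have "m' \<le> m" using y by (simp add: m_def m'_def gm_antimono)
      ultimately show ?thesis using h mn q_q_le(2)[of m' m] by (simp flip: mul_assoc)
    qed
    also have "H j h = H (j + k) (f (g + (x + y)))"
      using jk M_car[OF True] by (simp add: h_def H_H add_ac)
    finally show "dn (x + y) f g = dn y (dn x f) g"
      using True jk(3) by (simp add: dn_def m_def n_def)
  qed
next
  case False
  then show ?thesis using E.lin_mzero[OF lin_dn[OF y]] by (simp add: dn_def[of x] dn_def[of "x + y"])
qed

lemma bdd_up: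
  assumes x: "0 \<le> x" shows "E.bdd (up x)"
proof -
  let ?p = "H x \<^bold>1"
  have p: "?p \<in> car A" using x by simp
  obtain K where K: "K \<ge> 0" "\<And>f. f \<in> M \<Longrightarrow> E.mn (sig ?p f) \<le> K * E.mn f"
    using bdd_sig[OF p] unfolding E.bdd_def by blast
  have "E.mn (up x f) \<le> sqrt K * E.mn f" if f: "f \<in> M" for f
  proof -
    have M: "up x f \<in> M" "sig ?p f \<in> M" using E.lin_closed lin_up[OF x] lin_sig[OF p] by blast+
    have "dn x (up x f) = sig ?p f"
      using dn_sig_up[OF x un_closed f] M by (simp add: sig_un)
    then have "(E.mn (up x f))\<^sup>2 = \<parallel>ip f (sig ?p f)\<parallel>"
      using adj_up[OF x] M f by (simp add: E.mn_sq E.adj_def)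
    also have "\<dots> \<le> E.mn f * (K * E.mn f)"
      using E.cauchy_schwarz[OF f M(2)] mult_left_mono[OF K(2)[OF f], of "E.mn f"] f by simp
    also have "\<dots> = (sqrt K * E.mn f)\<^sup>2"
      using K(1) by (simp add: power_mult_distrib) (simp add: power2_eq_square)
    finally show ?thesis by (rule power2_le_imp_le) (use K f in simp)
  qed
  then show ?thesis unfolding E.bdd_def using K(1) by (intro exI[of _ "sqrt K"]) simp
qed

theorem finely_representable: "finely_representable A V \<and> finely_representable A H"
proof (rule finely_representableI[of A E.opalg "\<lambda>a. (sig a, sig (a\<^sup>\<star>))" "\<lambda>x. (up x, dn x)" V H])
  show "cstar A" ..
  show "pre_cstar E.opalg" by (rule E.opalg_pre_cstar)
  have sM: "sig a f = mzero" if "f \<notin> M" for a f using that by (simp add: sig_def)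
  have z: "madd mzero mzero = mzero" "msm c mzero = mzero" for c by (simp_all add: madd_def msm_def mzero_def)
  have sig_pl: "sig (a \<boxplus> b) = (\<lambda>f. madd (sig a f) (sig b f))" if "a \<in> car A" "b \<in> car A" for a b
  proof
    fix f
    show "sig (a \<boxplus> b) f = madd (sig a f) (sig b f)"
    proof (cases "f \<in> M")
      case True
      then show ?thesis using that M_car[OF True] by (simp add: sig_def madd_def V_pl pl_mul)
    qed (simp add: sM z)
  qed
  have sig_sm: "sig (c \<bullet> a) = (\<lambda>f. msm c (sig a f))" if "a \<in> car A" for c a
  proof
    fix f
    show "sig (c \<bullet> a) f = msm c (sig a f)"
    proof (cases "f \<in> M")
      case True
      then show ?thesis using that M_car[OF True] by (simp add: sig_def msm_def V_sm)
    qed (simp add: sM z)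
  qed
  show "star_hom A E.opalg (\<lambda>a. (sig a, sig (a\<^sup>\<star>)))"
    unfolding star_hom_def linear_map_def
    by (simp add: E.opalg_def lin_sig adj_sig bdd_sig sig_pl sig_sm sig_sig st_pl st_sm st_mul)
  show "(sig \<^bold>1, sig (\<^bold>1\<^sup>\<star>)) = un E.opalg" by (simp add: E.opalg_def sig_un)
  have pair: "(up x, dn x) \<in> car E.opalg" if "0 \<le> x" for x
    using that by (simp add: E.opalg_def lin_up lin_dn adj_up bdd_up)
  have cov1: "(\<lambda>f. up x (sig a (dn x f))) = sig (V x a)" if "0 \<le> x" "a \<in> car A" for x a
  proof
    fix f
    show "up x (sig a (dn x f)) = sig (V x a) f"
    proof (cases "f \<in> M")
      case False
      then show ?thesis
        using E.lin_mzero[OF lin_up[OF that(1)]] E.lin_mzero[OF lin_sig[OF that(2)]]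
        by (simp add: sM dn_def)
    qed (use up_sig_dn that in simp)
  qed
  have cov2: "(\<lambda>f. dn x (sig a (up x f))) = sig (H x a)" if "0 \<le> x" "a \<in> car A" for x a
  proof
    fix f
    show "dn x (sig a (up x f)) = sig (H x a) f"
    proof (cases "f \<in> M")
      case False
      then show ?thesis
        using E.lin_mzero[OF lin_dn[OF that(1)]] E.lin_mzero[OF lin_sig[OF that(2)]]
        by (simp add: sM up_def)
    qed (use dn_sig_up that in simp)
  qed
  show "(sig (V x a), sig ((V x a)\<^sup>\<star>))
      = mul E.opalg (mul E.opalg (up x, dn x) (sig a, sig (a\<^sup>\<star>))) (st E.opalg (up x, dn x))"
    if "0 \<le> x" "a \<in> car A" for x a
    using cov1[OF that] cov1[of x "a\<^sup>\<star>"] that by (simp add: E.opalg_def V_st)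
  show "(sig (H x a), sig ((H x a)\<^sup>\<star>))
      = mul E.opalg (mul E.opalg (st E.opalg (up x, dn x)) (sig a, sig (a\<^sup>\<star>))) (up x, dn x)"
    if "0 \<le> x" "a \<in> car A" for x a
    using cov2[OF that] cov2[of x "a\<^sup>\<star>"] that by (simp add: E.opalg_def H_st)
  show "(up (x + y), dn (x + y)) = mul E.opalg (up x, dn x) (up y, dn y)" if "0 \<le> x" "0 \<le> y" for x y
    using that by (simp add: E.opalg_def fun_eq_iff up_add dn_add)
  show "partial_isometry E.opalg (up x, dn x)" if x: "0 \<le> x" for x
  proof -
    have ud: "up x (dn x h) = sig (q x) h" if "h \<in> M" for h
      using up_sig_dn[OF x un_closed that] E.lin_closed[OF lin_dn[OF x]] by (simp add: sig_un q_def)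
    have "up x (dn x (up x f)) = up x f" for f
    proof (cases "f \<in> M")
      case True
      then show ?thesis using ud[OF E.lin_closed[OF lin_up[OF x]]] sig_q_up[OF x True] by simp
    next
      case False
      then have "up x f = mzero" by (simp add: up_def)
      then show ?thesis by (simp add: E.lin_mzero[OF lin_dn[OF x]] E.lin_mzero[OF lin_up[OF x]])
    qed
    moreover have "dn x (up x (dn x h)) = dn x h" for h
    proof (cases "h \<in> M")
      case True
      then show ?thesis using ud[OF True] dn_sig_q[OF x True] by simp
    next
      case False
      then have "dn x h = mzero" by (simp add: dn_def)
      then show ?thesis by (simp add: E.lin_mzero[OF lin_dn[OF x]] E.lin_mzero[OF lin_up[OF x]])
    qed
    ultimately show ?thesis using pair[OF x] by (simp add: partial_isometry_def E.opalg_def)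
  qed
  show "a = \<^bold>0" if a: "a \<in> car A" "nm E.opalg (sig a, sig (a\<^sup>\<star>)) = 0" for a
  proof -
    \<comment> \<open>The unit placed in degree zero: \<open>sig a e\<close> has inner square
      \<open>a\<^sup>\<star> a\<close>, so the representation is faithful.\<close>
    define e where "e = (\<lambda>g::'g. if g = 0 then \<^bold>1 else \<^bold>0)"
    have e: "e \<in> M" by (rule M_I[of "{0}"]) (auto simp: e_def)
    have s: "sig a e \<in> M" "sig a e 0 = a" "\<And>g. g \<noteq> 0 \<Longrightarrow> sig a e g = \<^bold>0"
    proof -
      show "sig a e \<in> M" by (rule E.lin_closed[OF lin_sig[OF a(1)]])
      show "sig a e 0 = a" "\<And>g. g \<noteq> 0 \<Longrightarrow> sig a e g = \<^bold>0"
        using a by (simp_all add: sig_def e) (simp_all add: e_def)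
    qed
    have "ip (sig a e) (sig a e) = fs (\<lambda>g. H (gp g) ((sig a e g)\<^sup>\<star> \<boxdot> sig a e g)) {0}"
      using s by (intro ip_eq) auto
    also have "\<dots> = a\<^sup>\<star> \<boxdot> a" by (subst fs_insert) (use s a in simp_all)
    finally have "(E.mn (sig a e))\<^sup>2 = \<parallel>a\<parallel>\<^sup>2" using E.mn_sq[OF s(1)] nm_cstar[OF a(1)] by simp
    moreover have "E.mn (sig a e) \<le> 0"
      using E.opn_bound[OF bdd_sig[OF a(1)] e] a(2) by (simp add: E.opalg_def)
    ultimately have "\<parallel>a\<parallel>\<^sup>2 = 0" using E.mn_ge_0[OF s(1)] by (metis antisym power_zero_numeral)
    then show ?thesis using a by simp
  qed
qed simp_all

end

section \<open>Complete interactions\<close>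

context cstar
begin

lemma bounded_positive_map_facts:
  assumes "bounded_positive_map A T"
  shows "a \<in> car A \<Longrightarrow> T a \<in> car A"
    and "a \<in> car A \<Longrightarrow> b \<in> car A \<Longrightarrow> T (a \<boxplus> b) = T a \<boxplus> T b"
    and "a \<in> car A \<Longrightarrow> T (c \<bullet> a) = c \<bullet> T a"
    and "a \<in> car A \<Longrightarrow> pos (T (a\<^sup>\<star> \<boxdot> a))"
proof -
  show "a \<in> car A \<Longrightarrow> pos (T (a\<^sup>\<star> \<boxdot> a))"
  proof -
    assume a: "a \<in> car A"
    then have "positive A (a\<^sup>\<star> \<boxdot> a)" unfolding positive_def by auto
    then have "positive A (T (a\<^sup>\<star> \<boxdot> a))" using assms unfolding bounded_positive_map_def by blast
    then show "pos (T (a\<^sup>\<star> \<boxdot> a))" unfolding positive_def using pos_star_mul by auto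
  qed
qed (use assms in \<open>simp_all add: bounded_positive_map_def linear_map_def\<close>)

text \<open>A self-adjoint \<open>a\<close> is the difference of the squares of \<open>(1 + a)/2\<close> and \<open>(1 - a)/2\<close>.\<close>

lemma positive_map_st:
  assumes T: "bounded_positive_map A T" and a: "a \<in> car A"
  shows "T (a\<^sup>\<star>) = (T a)\<^sup>\<star>"
proof -
  note f = bounded_positive_map_facts[OF T]
  have sa: "sa (T x)" if x: "sa x" for x
  proof -
    define b where "b = (1/2) \<bullet> (\<^bold>1 \<boxplus> x)"
    define c where "c = (1/2) \<bullet> (\<^bold>1 \<boxplus> (-1) \<bullet> x)"
    have bc: "b \<in> car A" "c \<in> car A" "b\<^sup>\<star> = b" "c\<^sup>\<star> = c"
      using x sa_st[OF x] by (simp_all add: b_def c_def st_sm st_pl)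
    define y where "y = x \<boxdot> x"
    have xy: "x \<in> car A" "y \<in> car A" "x \<boxdot> x = y" using x by (simp_all add: y_def)
    have "b \<boxdot> b \<boxplus> (-1) \<bullet> (c \<boxdot> c) = x"
      using xy by (simp add: b_def c_def mul_pl pl_mul sm_pl)
        (rule linear_coordinates[of "\<^bold>1" x y x]; simp)
    then have "T x = T (b\<^sup>\<star> \<boxdot> b) \<boxminus> T (c\<^sup>\<star> \<boxdot> c)"
      using f(2)[of "b \<boxdot> b" "(-1) \<bullet> (c \<boxdot> c)"] f(3)[of "c \<boxdot> c" "-1"] bc by (simp add: minus_def)
    then show ?thesis using f(4)[OF bc(1)] f(4)[OF bc(2)] pos_sa sa_minus by simp
  qed
  define d where "d = a\<^sup>\<star>"
  have d: "d \<in> car A" "a\<^sup>\<star> = d" "d\<^sup>\<star> = a" using a by (simp_all add: d_def)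
  define x where "x = (1/2) \<bullet> (a \<boxplus> d)"
  define y where "y = (1/2) \<bullet> ((-\<i>) \<bullet> a \<boxplus> \<i> \<bullet> d)"
  have c: "x \<in> car A" "y \<in> car A" using a d by (simp_all add: x_def y_def)
  have "x\<^sup>\<star> = (1/2) \<bullet> (d \<boxplus> a)" using a d by (simp add: x_def st_sm st_pl)
  then have "x\<^sup>\<star> = x" unfolding x_def using a d by (simp add: pl_comm[of d a])
  moreover have "y\<^sup>\<star> = (1/2) \<bullet> (\<i> \<bullet> d \<boxplus> (-\<i>) \<bullet> a)" using a d by (simp add: y_def st_sm st_pl)
  then have "y\<^sup>\<star> = y" unfolding y_def using a d by (simp add: pl_comm[of "\<i> \<bullet> d"])
  ultimately have xy: "(T x)\<^sup>\<star> = T x" "(T y)\<^sup>\<star> = T y" using sa c by (simp_all add: sa_def)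
  have "a = x \<boxplus> \<i> \<bullet> y" "d = x \<boxplus> (-\<i>) \<bullet> y"
    unfolding x_def y_def by (rule linear_coordinates[of a d a d]; use a d in simp)+
  then have "T a = T x \<boxplus> \<i> \<bullet> T y" "T d = T x \<boxplus> (-\<i>) \<bullet> T y"
    using f(2)[of x "\<i> \<bullet> y"] f(2)[of x "(-\<i>) \<bullet> y"] f(3)[of y] c by simp_all
  then show ?thesis using xy f(1)[OF c(1)] f(1)[OF c(2)] by (simp add: d(2) st_pl st_sm)
qed

end

text \<open>Reduces the alternatives (a') and (b') to (a) and (b).\<close>

lemma complete_interaction_swap:
  assumes "complete_interaction A V H" shows "complete_interaction A H V"
proof -
  note c = assms[unfolded complete_interaction_def]
  have "interaction A H V"
    using c[THEN conjunct1] unfolding interaction_def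
    by - (elim conjE, intro conjI, assumption, assumption, intro allI impI,
        drule spec, drule (1) mp, elim conjE, intro conjI; assumption)
  moreover have "\<forall>x\<ge>0. \<forall>a\<in>car A.
      V x (H x a) = mul A (mul A (V x (un A)) a) (V x (un A)) \<and>
      H x (V x a) = mul A (mul A (H x (un A)) a) (H x (un A))"
    using c[THEN conjunct2, THEN conjunct1]
    by - (intro allI impI ballI, drule spec, drule (1) mp, drule (1) bspec, elim conjE, intro conjI; assumption)
  moreover have "\<forall>x\<ge>0. \<forall>y\<ge>0. mul A (V y (un A)) (H x (un A)) = mul A (H x (un A)) (V y (un A))"
    using c[THEN conjunct2, THEN conjunct2] by metis
  ultimately show ?thesis unfolding complete_interaction_def by (intro conjI)
qed

context
  fixes A :: "'a calg" and V H :: "'g::linordered_ab_group_add \<Rightarrow> 'a \<Rightarrow> 'a"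
  assumes cst: "cstar A" and ci: "complete_interaction A V H"
begin

interpretation cstar A by (rule cst)

lemmas interaction_facts = ci[unfolded complete_interaction_def, THEN conjunct1, unfolded interaction_def]

lemmas V_action = interaction_facts[THEN conjunct1, unfolded is_action_def]
  and H_action = interaction_facts[THEN conjunct2, THEN conjunct1, unfolded is_action_def]

lemmas interaction_laws = interaction_facts[THEN conjunct2, THEN conjunct2, THEN spec, THEN mp]
  and completeness = ci[unfolded complete_interaction_def, THEN conjunct2, THEN conjunct1, THEN spec, THEN mp, THEN bspec]

lemmas V_map = V_action[THEN conjunct1, THEN spec, THEN mp]
  and H_map = H_action[THEN conjunct1, THEN spec, THEN mp]
  and V_zero = V_action[THEN conjunct2, THEN conjunct1, THEN bspec]
  and H_zero = H_action[THEN conjunct2, THEN conjunct1, THEN bspec]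
  and V_add = V_action[THEN conjunct2, THEN conjunct2, rule_format]
  and H_add = H_action[THEN conjunct2, THEN conjunct2, rule_format]
  and VHV = interaction_laws[THEN conjunct1, THEN bspec]
  and HVH = interaction_laws[THEN conjunct2, THEN conjunct1, THEN bspec]
  and HV_eq = completeness[THEN conjunct1]
  and VH_eq = completeness[THEN conjunct2]

lemma V_mult:
  "\<lbrakk>0 \<le> x; a \<in> H x ` car A; a \<in> car A; b \<in> car A\<rbrakk> \<Longrightarrow> V x (a \<boxdot> b) = V x a \<boxdot> V x b"
  by (rule interaction_laws[THEN conjunct2, THEN conjunct2, THEN conjunct1, THEN bspec, THEN bspec, THEN mp])
    simp_all

lemma H_mult:
  "\<lbrakk>0 \<le> x; a \<in> V x ` car A; a \<in> car A; b \<in> car A\<rbrakk> \<Longrightarrow> H x (a \<boxdot> b) = H x a \<boxdot> H x b"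
  by (rule interaction_laws[THEN conjunct2, THEN conjunct2, THEN conjunct2, THEN bspec, THEN bspec, THEN mp])
    simp_all

lemma unit_idem:
  assumes x: "0 \<le> x" shows "H x \<^bold>1 \<boxdot> H x \<^bold>1 = H x \<^bold>1"
proof -
  define p where "p = H x \<^bold>1"
  note cV = bounded_positive_map_facts(1)[OF V_map[OF x]]
  have p: "p \<in> car A" using bounded_positive_map_facts(1)[OF H_map[OF x]] by (simp add: p_def)
  have "H x (V x \<^bold>1) = p \<boxdot> p" using HV_eq[OF x] p by (simp add: p_def)
  moreover have "H x (V x \<^bold>1 \<boxdot> \<^bold>1) = H x (V x \<^bold>1) \<boxdot> p"
    unfolding p_def by (rule H_mult[OF x]) (simp_all add: cV)
  ultimately have "p \<boxdot> p = p \<boxdot> p \<boxdot> p" using cV by simp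
  moreover have "p = p \<boxdot> p \<boxdot> p" using HVH[OF x un_closed] HV_eq[OF x p] by (simp add: p_def)
  ultimately show ?thesis by (simp add: p_def)
qed

lemma transfer_pair_if_central:
  assumes central: "\<And>x. 0 \<le> x \<Longrightarrow> H x \<^bold>1 \<in> center A"
  shows "transfer_pair A V H"
proof (unfold_locales, goal_cases)
  \<comment> \<open>The axiom \<open>V_mul\<close>. \<open>V x\<close> sees only the corner of
    \<open>p\<close>, since \<open>V x c = V x (p c p)\<close>. For central \<open>p\<close> the
    product becomes \<open>(p a p) b\<close> with its first factor in the range of
    \<open>H x\<close>, where \<open>V x\<close> is multiplicative.\<close>
  case (4 x a b)
  define p where "p = H x \<^bold>1"
  have p: "p \<in> car A" "\<And>c. c \<in> car A \<Longrightarrow> p \<boxdot> c = c \<boxdot> p"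
    using central[OF 4(1)] by (auto simp: p_def center_def)
  note HV = HV_eq[OF 4(1)] VHV[OF 4(1)]
  note cl = bounded_positive_map_facts(1)[OF V_map[OF 4(1)]]
  have Vp: "V x c = V x (p \<boxdot> c \<boxdot> p)" if "c \<in> car A" for c using HV that by (simp add: p_def)
  have "V x (a \<boxdot> b) = V x (p \<boxdot> (a \<boxdot> b) \<boxdot> p)" using Vp 4 by simp
  also have "p \<boxdot> (a \<boxdot> b) \<boxdot> p = (p \<boxdot> a \<boxdot> p) \<boxdot> b"
    using 4 p(1) p(2)[of b] by (simp add: mul_assoc)
  also have "V x ((p \<boxdot> a \<boxdot> p) \<boxdot> b) = V x (p \<boxdot> a \<boxdot> p) \<boxdot> V x b"
  proof (rule V_mult[OF 4(1)])
    show "p \<boxdot> a \<boxdot> p \<in> H x ` car A" using HV(1)[OF 4(2)] cl[OF 4(2)] by (metis imageI p_def)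
  qed (use 4 p in auto)
  finally show ?case using Vp 4 by simp
next
  \<comment> \<open>The axiom \<open>H_V_mul\<close>. \<open>H x (V x a)\<close> is
    \<open>p a p\<close>; centrality moves both copies of \<open>p\<close> next to
    \<open>H x b\<close>, which absorbs them.\<close>
  case (16 x a b)
  define p where "p = H x \<^bold>1"
  have p: "p \<in> car A" "p \<boxdot> a = a \<boxdot> p" "p \<boxdot> p = p"
    using central[OF 16(1)] 16(2) unit_idem[OF 16(1)] unfolding p_def center_def by blast+
  have Hb: "H x b \<in> car A" using bounded_positive_map_facts(1)[OF H_map[OF 16(1)]] 16 by simp
  have Va: "V x a \<in> car A" using bounded_positive_map_facts(1)[OF V_map[OF 16(1)]] 16 by simp
  have pH: "p \<boxdot> H x b = H x b"
  proof -
    have H: "H x b = p \<boxdot> H x b \<boxdot> p"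
      using HVH[OF 16(1,3)] HV_eq[OF 16(1) Hb] by (simp add: p_def)
    then have "p \<boxdot> H x b = p \<boxdot> (p \<boxdot> H x b \<boxdot> p)" by simp
    also have "\<dots> = (p \<boxdot> p) \<boxdot> H x b \<boxdot> p" using p(1) Hb by (simp add: mul_assoc)
    finally show ?thesis using p(3) H by simp
  qed
  have "H x (V x a \<boxdot> b) = H x (V x a) \<boxdot> H x b" by (rule H_mult[OF 16(1)]) (use 16 Va in simp_all)
  also have "\<dots> = (p \<boxdot> a \<boxdot> p) \<boxdot> H x b" using HV_eq[OF 16(1,2)] by (simp add: p_def)
  also have "\<dots> = a \<boxdot> (p \<boxdot> (p \<boxdot> H x b))" using p(1,2) 16 Hb by (simp add: mul_assoc)
  finally show ?case using pH by simp
qed (auto intro: bounded_positive_map_facts[OF V_map] bounded_positive_map_facts[OF H_map]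
    positive_map_st[OF V_map] positive_map_st[OF H_map] VH_eq V_zero H_zero V_add H_add)

lemma unit_central_if_endo:
  assumes x: "0 \<le> x" and endo: "star_endo A (V x)"
  shows "H x \<^bold>1 \<in> center A"
proof -
  define p where "p = H x \<^bold>1"
  note fV = bounded_positive_map_facts[OF V_map[OF x]] and fH = bounded_positive_map_facts[OF H_map[OF x]]
  have p: "p \<in> car A" "p\<^sup>\<star> = p" "p \<boxdot> p = p"
    using fH(1)[of "\<^bold>1"] positive_map_st[OF H_map[OF x], of "\<^bold>1"] unit_idem[OF x] by (simp_all add: p_def)
  have Vm: "V x (a \<boxdot> b) = V x a \<boxdot> V x b" if "a \<in> car A" "b \<in> car A" for a b
    using endo that by (simp add: star_endo_def star_hom_def)
  have "V x p = V x \<^bold>1 \<boxdot> V x \<^bold>1" using VH_eq[OF x un_closed] fV(1) by (simp add: p_def)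
  then have Vp: "V x p = V x \<^bold>1" using Vm[of "\<^bold>1" "\<^bold>1"] by simp
  have pa: "p \<boxdot> a = p \<boxdot> a \<boxdot> p" if a: "a \<in> car A" for a
  proof -
    define d where "d = p \<boxdot> a \<boxminus> p \<boxdot> a \<boxdot> p"
    have d: "d \<in> car A" using p a by (simp add: d_def)
    have pd: "p \<boxdot> d = d" using p a by (simp add: d_def mul_minus flip: mul_assoc)
    have dp: "d\<^sup>\<star> \<boxdot> p = d\<^sup>\<star>" using st_mul[of p d] pd p d by simp
    have "d = p \<boxdot> a \<boxdot> (\<^bold>1 \<boxminus> p)" using p a by (simp add: d_def mul_minus)
    then have "V x d = V x (p \<boxdot> a) \<boxdot> V x (\<^bold>1 \<boxminus> p)" using Vm p a by simp
    also have "V x (\<^bold>1 \<boxminus> p) = V x \<^bold>1 \<boxminus> V x p" using p fV(2,3) by (simp add: minus_def)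
    finally have Vd: "V x d = \<^bold>0" using Vp fV(1) p a by simp
    have "p \<boxdot> (d \<boxdot> d\<^sup>\<star>) \<boxdot> p = H x (V x (d \<boxdot> d\<^sup>\<star>))" using HV_eq[OF x] d by (simp add: p_def)
    also have "V x (d \<boxdot> d\<^sup>\<star>) = \<^bold>0" using Vm[of d "d\<^sup>\<star>"] Vd d fV(1) by simp
    also have "H x \<^bold>0 = \<^bold>0" using fH(3)[of "\<^bold>0" 0] fH(1)[of "\<^bold>0"] by simp
    finally have "p \<boxdot> (d \<boxdot> d\<^sup>\<star>) \<boxdot> p = \<^bold>0" .
    moreover have "p \<boxdot> (d \<boxdot> d\<^sup>\<star>) \<boxdot> p = (p \<boxdot> d) \<boxdot> (d\<^sup>\<star> \<boxdot> p)" using p(1) d by (simp add: mul_assoc)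
    ultimately have "d \<boxdot> d\<^sup>\<star> = \<^bold>0" by (simp add: pd dp)
    then have "\<parallel>d\<^sup>\<star>\<parallel>\<^sup>2 = 0" using nm_cstar[of "d\<^sup>\<star>"] d by simp
    then have "d = \<^bold>0" using d by simp
    then show ?thesis using p a by (simp add: d_def minus_eq_zer_iff)
  qed
  have "p \<boxdot> a = a \<boxdot> p" if a: "a \<in> car A" for a
  proof -
    have "(p \<boxdot> a\<^sup>\<star>)\<^sup>\<star> = (p \<boxdot> a\<^sup>\<star> \<boxdot> p)\<^sup>\<star>" using pa[of "a\<^sup>\<star>"] a by simp
    then have "a \<boxdot> p = p \<boxdot> (a \<boxdot> p)" using a p by (simp add: st_mul)
    then show ?thesis using pa[OF a] a p by (simp add: mul_assoc)
  qed
  then show ?thesis unfolding center_def p_def[symmetric] using p(1) by blast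
qed

lemma finely_representable_if_endo_or_central:
  assumes "(\<forall>x\<ge>0. star_endo A (V x)) \<or> (\<forall>x\<ge>0. H x \<^bold>1 \<in> center A)"
  shows "finely_representable A V \<and> finely_representable A H"
proof -
  interpret transfer_pair A V H
    using transfer_pair_if_central unit_central_if_endo assms by blast
  show ?thesis by (rule finely_representable)
qed

end

theorem theorem4p3:
  fixes A :: "'a calg"
    and V H :: "'g::linordered_ab_group_add \<Rightarrow> 'a \<Rightarrow> 'a"
  assumes "unital_cstar_algebra A"
    and "complete_interaction A V H"
    and "(\<forall>x\<ge>0. star_endo A (V x)) \<or>
         (\<forall>x\<ge>0. H x (un A) \<in> center A) \<or>
         (\<forall>x\<ge>0. star_endo A (H x)) \<or>
         (\<forall>x\<ge>0. V x (un A) \<in> center A)"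
  shows "finely_representable A V \<and> finely_representable A H"
proof -
  have A: "cstar A" using assms(1) by (simp add: unital_cstar_algebra_iff_cstar)
  show ?thesis
    using assms(3) finely_representable_if_endo_or_central[OF A assms(2)]
      finely_representable_if_endo_or_central[OF A complete_interaction_swap[OF assms(2)]] by blast
qed

end
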